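(* Let $n$ be an odd perfect square. Then $n$ is the number of spanning trees in a planar self-dual graph without cut vertex if and only if $n\ne 1,\,9,\,49$.
   Context: Graphs are planar graphs, drawn in the plane; multiple edges between two vertices are allowed. The dual of a planar graph has a vertex for each face (region) of the drawing and an edge for each edge of the original graph, connecting the faces on the two sides of that edge. A planar graph is self-dual if it is isomorphic to its dual. A cut vertex is a vertex which, when removed together with all its incident edges, disconnects the graph.
   Formalization: The graph is required to have at least one edge, since the single vertex without edges is self-dual, has no cut vertex and has one spanning tree, so n = 1 would otherwise occur; graphs have no loops, multiple edges being allowed. *)

theory Defs
  imports "HOL-Analysis.Analysis" "HOL-Computational_Algebra.Nth_Powers"
begin

text \<open>Undirected multigraphs. An edge is an abstract object with a set of end vertices, which
  has two elements, or only one if the edge is a loop.\<close>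

record ('v, 'e) multigraph =
  verts :: "'v set"
  edges :: "'e set"
  ends :: "'e \<Rightarrow> 'v set"

definition isomorphic :: "('v, 'e) multigraph \<Rightarrow> ('w, 'f) multigraph \<Rightarrow> bool" where
  "isomorphic G H \<longleftrightarrow>
     (\<exists>f g. bij_betw f (verts G) (verts H) \<and> bij_betw g (edges G) (edges H) \<and>
            (\<forall>e\<in>edges G. ends H (g e) = f ` ends G e))"

definition reachable :: "('v, 'e) multigraph \<Rightarrow> 'v \<Rightarrow> 'v \<Rightarrow> bool" where
  "reachable G u v \<longleftrightarrow> (u, v) \<in> {(x, y). \<exists>e\<in>edges G. ends G e = {x, y}}\<^sup>*"

definition connected_graph :: "('v, 'e) multigraph \<Rightarrow> bool" where
  "connected_graph G \<longleftrightarrow> (\<forall>u\<in>verts G. \<forall>v\<in>verts G. reachable G u v)"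

definition delete_vertex :: "('v, 'e) multigraph \<Rightarrow> 'v \<Rightarrow> ('v, 'e) multigraph" where
  "delete_vertex G v = G\<lparr>verts := verts G - {v}, edges := {e \<in> edges G. v \<notin> ends G e}\<rparr>"

definition cut_vertex :: "('v, 'e) multigraph \<Rightarrow> 'v \<Rightarrow> bool" where
  "cut_vertex G v \<longleftrightarrow> v \<in> verts G \<and>
     (\<exists>u\<in>verts G - {v}. \<exists>w\<in>verts G - {v}. reachable G u w \<and> \<not> reachable (delete_vertex G v) u w)"

text \<open>A cycle is given by its vertices and edges in cyclic order. Length 1 is a loop, and
  length 2 is a pair of parallel edges.\<close>

definition is_cycle :: "('v, 'e) multigraph \<Rightarrow> 'v list \<Rightarrow> 'e list \<Rightarrow> bool" where
  "is_cycle G vs es \<longleftrightarrow>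
     es \<noteq> [] \<and> length vs = length es \<and> distinct vs \<and> distinct es \<and>
     set vs \<subseteq> verts G \<and> set es \<subseteq> edges G \<and>
     (\<forall>i<length es. ends G (es ! i) = {vs ! i, vs ! (Suc i mod length es)})"

definition is_tree :: "('v, 'e) multigraph \<Rightarrow> bool" where
  "is_tree G \<longleftrightarrow> connected_graph G \<and> \<not> (\<exists>vs es. is_cycle G vs es)"

definition spanning_trees :: "('v, 'e) multigraph \<Rightarrow> 'e set set" where
  "spanning_trees G = {T. T \<subseteq> edges G \<and> is_tree (G\<lparr>edges := T\<rparr>)}"

text \<open>Graphs drawn in the plane: vertices are points, and an edge is identified with the arc that
  represents it (including its two end points), so that parallel edges are different arcs.
  Since the end points of an arc are distinct, the drawing has no loops.\<close>

definition plane_drawing :: "complex set \<Rightarrow> complex set set \<Rightarrow> bool" where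
  "plane_drawing V E \<longleftrightarrow>
     finite V \<and> V \<noteq> {} \<and> finite E \<and>
     (\<forall>e\<in>E. \<exists>g. arc g \<and> path_image g = e \<and> e \<inter> V = {pathstart g, pathfinish g}) \<and>
     (\<forall>e\<in>E. \<forall>e'\<in>E. e \<noteq> e' \<longrightarrow> e \<inter> e' \<subseteq> V)"

definition drawn_graph :: "complex set \<Rightarrow> complex set set \<Rightarrow> (complex, complex set) multigraph" where
  "drawn_graph V E = \<lparr>verts = V, edges = E, ends = (\<lambda>e. e \<inter> V)\<rparr>"

definition faces :: "complex set \<Rightarrow> complex set set \<Rightarrow> complex set set" where
  "faces V E = components (- (V \<union> \<Union>E))"

text \<open>The faces on the two sides of an edge are those that have the edge on their boundary. If both
  sides belong to the same face, the dual edge is a loop.\<close>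

definition dual_graph :: "complex set \<Rightarrow> complex set set \<Rightarrow> (complex set, complex set) multigraph" where
  "dual_graph V E =
     \<lparr>verts = faces V E, edges = E, ends = (\<lambda>e. {F \<in> faces V E. e \<subseteq> frontier F})\<rparr>"

text \<open>The graph with a single vertex and no edges satisfies this definition and has exactly one
  spanning tree; statements that disregard this trivial graph need to assume \<open>E \<noteq> {}\<close>.\<close>

definition self_dual :: "complex set \<Rightarrow> complex set set \<Rightarrow> bool" where
  "self_dual V E \<longleftrightarrow> isomorphic (drawn_graph V E) (dual_graph V E)"

end

theory Submission
  imports Defs
begin

text \<open>A spanning tree and the complement of a spanning tree of the dual graph are the same thing, by Euler's
  formula and because the complement of a tree drawn in the plane is connected (\<open>dual_tree\<close>). If a graph with
  \<open>\<tau>\<close> spanning trees is isomorphic to its dual, then the isomorphism gives a map \<open>\<sigma>\<close> on the edges such that the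
  trees through \<open>\<sigma> e\<close> are as many as the trees that avoid \<open>e\<close> (\<open>self_dual_structure\<close>).

  \<^bold>\<open>The exceptions.\<close> Let \<open>J e f\<close> be the current through \<open>f\<close> if a current of \<open>\<tau>\<close> enters and leaves the network at the
  ends of \<open>e\<close>. This is an integer, \<open>J e e\<close> is the number of trees through \<open>e\<close>, and \<open>\<tau>\<close> times the number of trees
  through \<open>e\<close> and \<open>f\<close> is \<open>J e e * J f f - (J e f)\<^sup>2\<close>. Let \<open>\<tau> = p\<^sup>2\<close> with \<open>p\<close> equal to 3 or 7, so that a sum of
  two squares is divisible by \<open>p\<close> only if both squares are. As \<open>J (\<sigma> e) (\<sigma> e) = p\<^sup>2 - J e e\<close>, the formula for
  \<open>f = \<sigma> e\<close> shows that \<open>p\<close> divides \<open>J e e\<close>, and then all entries of \<open>J\<close>. So the edge \<open>e\<close> has the effective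
  resistance \<open>t e / p\<close> with an integer \<open>t e\<close>, where \<open>0 < t e < p\<close> and \<open>t (\<sigma> e) = p - t e\<close>, and the potentials of
  the vertices become integers between 0 and \<open>t e\<close> if a current of \<open>p\<close> flows through the network from one end of
  \<open>e\<close> to the other. Without cut vertices, only the ends of \<open>e\<close> have the extreme potentials. There are few such
  potentials for small \<open>t e\<close>: the values 1 and, for \<open>p = 7\<close>, also 2 are impossible (\<open>t_not_1\<close>, \<open>t_not_2\<close>). This
  excludes \<open>p = 3\<close>. For \<open>p = 7\<close> every \<open>t e\<close> is 3 or 4, which excludes parallel edges and vertices of degree at
  most 3, but there is a vertex of degree at most 3 as the graph has \<open>2 * card V - 2\<close> edges (\<open>no_edges\<close>).

  \<^bold>\<open>The other squares.\<close> Consider a self-dual drawing whose isomorphism comes from an involution \<open>\<sigma>\<close> of the edges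
  without fixed points. Subdividing \<open>e\<close> in the graph subdivides it in the drawing; doubling \<open>\<sigma> e\<close> beside itself
  subdivides the dual edge. If both are done, the drawing remains self-dual (\<open>polar_step\<close>). In tree counts with
  weights for the edges inside and outside of the tree, these operations change the pair of weights of \<open>e\<close> as a
  step of the Euclidean algorithm does. So \<open>e\<close> can be given any pair of coprime positive weights \<open>(p, q)\<close>, with
  \<open>(q, p)\<close> for \<open>\<sigma> e\<close> (\<open>network\<close>). A pair of parallel edges then has \<open>p\<^sup>2 + q\<^sup>2\<close> trees, which includes 25, and
  the complete graph on four vertices has \<open>(p1 p2 p3 + p1 q2 q3 + p2 q1 q3 + p3 q1 q2)\<^sup>2\<close> trees, which includes
  the squares of all odd numbers from 9 on except 11. The wheel with five spokes has 121 trees.\<close>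

section \<open>Reachability and spanning trees\<close>

definition reach :: "('e \<Rightarrow> 'v set) \<Rightarrow> 'e set \<Rightarrow> 'v \<Rightarrow> 'v \<Rightarrow> bool" where
  "reach d A u v \<longleftrightarrow> (u, v) \<in> {(x, y). \<exists>e\<in>A. d e = {x, y}}\<^sup>*"

lemma reachable_reach: "reachable G u v \<longleftrightarrow> reach (ends G) (edges G) u v"
  by (simp add: reachable_def reach_def)

lemma reach_refl [simp, intro!]: "reach d A x x"
  by (simp add: reach_def)

lemma reach_edge: "e \<in> A \<Longrightarrow> d e = {x, y} \<Longrightarrow> reach d A x y"
  by (auto simp: reach_def)

lemma reach_trans: "reach d A x y \<Longrightarrow> reach d A y z \<Longrightarrow> reach d A x z"
  by (auto simp: reach_def)

lemma reach_sym: "reach d A x y \<Longrightarrow> reach d A y x"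
proof -
  have "sym {(x, y). \<exists>e\<in>A. d e = {x, y}}"
    by (auto simp: sym_def insert_commute)
  then show "reach d A x y \<Longrightarrow> reach d A y x"
    unfolding reach_def by (meson symD sym_rtrancl)
qed

lemma reach_commute: "reach d A x y \<longleftrightarrow> reach d A y x"
  by (blast intro: reach_sym)

text \<open>Chains of reachability facts turn into equations between classes.\<close>

definition part :: "('e \<Rightarrow> 'v set) \<Rightarrow> 'e set \<Rightarrow> 'v \<Rightarrow> 'v set" where
  "part d A x = {y. reach d A x y}"

lemma reach_part: "reach d A x y \<longleftrightarrow> part d A x = part d A y"
  unfolding part_def by (auto intro: reach_trans reach_sym)

lemma reach_mono: "reach d A x y \<Longrightarrow> A \<subseteq> B \<Longrightarrow> reach d B x y"
  unfolding reach_def by (erule rev_subsetD, rule rtrancl_mono) auto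

lemma reach_induct [consumes 1, case_names refl step]:
  assumes "reach d A x y" "P x"
    and "\<And>y z e. reach d A x y \<Longrightarrow> P y \<Longrightarrow> e \<in> A \<Longrightarrow> d e = {y, z} \<Longrightarrow> P z"
  shows "P y"
  using assms(1) unfolding reach_def
proof (induction rule: rtrancl_induct)
  case base then show ?case by (rule assms(2))
next
  case (step y z)
  then show ?case using assms(3)[of y _ z] by (auto simp: reach_def)
qed

lemma reach_closed:
  assumes "reach d A x y" "x \<in> S" "\<And>e a b. e \<in> A \<Longrightarrow> d e = {a, b} \<Longrightarrow> a \<in> S \<Longrightarrow> b \<in> S"
  shows "y \<in> S"
  using assms(1)
proof (induction rule: reach_induct)
  case (step y z e)
  show ?case using step assms(3) by blast
qed (rule assms(2))

lemma reach_subst: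
  assumes "reach d A x y" "\<And>e a b. e \<in> A \<Longrightarrow> d e = {a, b} \<Longrightarrow> reach d' B a b"
  shows "reach d' B x y"
  using assms(1)
proof (induction rule: reach_induct)
  case (step y z e)
  show ?case using step assms(2) reach_trans by metis
qed simp

text \<open>A walk that uses the new edge can be cut at its first and at its last use of it.\<close>

lemma reach_insert:
  assumes "d e = {u, v}"
  shows "reach d (insert e A) x y \<longleftrightarrow>
    reach d A x y \<or> (reach d A x u \<and> reach d A v y) \<or> (reach d A x v \<and> reach d A u y)"
    (is "?L \<longleftrightarrow> ?R y")
proof
  assume ?L
  then show "?R y"
  proof (induction rule: reach_induct)
    case refl then show ?case by simp
  next
    case (step y z f)
    show ?case
    proof (cases "f = e")
      case True
      then have "{y, z} = {u, v}" using step assms by simp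
      then have "(y = u \<and> z = v) \<or> (y = v \<and> z = u)" by (auto simp: doubleton_eq_iff)
      then show ?thesis using step.IH unfolding reach_part by metis
    next
      case False
      then have "reach d A y z" using step by (auto intro: reach_edge)
      then show ?thesis using step.IH by (meson reach_trans)
    qed
  qed
next
  assume "?R y"
  moreover have "reach d (insert e A) u v" "reach d (insert e A) v u"
    using assms by (auto intro: reach_edge reach_sym)
  moreover have "reach d A a b \<Longrightarrow> reach d (insert e A) a b" for a b
    by (erule reach_mono) auto
  ultimately show ?L unfolding reach_part by metis
qed

lemma reach_cong:
  assumes "\<And>e. e \<in> A \<Longrightarrow> d e = d' e"
  shows "reach d A x y \<longleftrightarrow> reach d' A x y"
proof -
  have "{(x, y). \<exists>e\<in>A. d e = {x, y}} = {(x, y). \<exists>e\<in>A. d' e = {x, y}}" using assms by auto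
  then show ?thesis unfolding reach_def by simp
qed

definition spans :: "'v set \<Rightarrow> ('e \<Rightarrow> 'v set) \<Rightarrow> 'e set \<Rightarrow> bool" where
  "spans V d A \<longleftrightarrow> (\<forall>u\<in>V. \<forall>v\<in>V. reach d A u v)"

lemma spans_mono: "spans V d A \<Longrightarrow> A \<subseteq> B \<Longrightarrow> spans V d B"
  unfolding spans_def by (meson reach_mono)

lemma spansI_root: "(\<And>v. v \<in> V \<Longrightarrow> reach d A c v) \<Longrightarrow> spans V d A"
  unfolding spans_def by (meson reach_sym reach_trans)

text \<open>The right number of edges replaces the absence of cycles, so that exchanging edges and passing to the dual
  graph are matters of counting.\<close>

definition trees :: "'v set \<Rightarrow> ('e \<Rightarrow> 'v set) \<Rightarrow> 'e set \<Rightarrow> 'e set set" where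
  "trees V d E = {T. T \<subseteq> E \<and> spans V d T \<and> card T + 1 = card V}"

locale fin_graph =
  fixes V :: "'v set" and d :: "'e \<Rightarrow> 'v set" and E :: "'e set"
  assumes finV: "finite V" and neV: "V \<noteq> {}" and finE: "finite E"
    and ends_ex: "e \<in> E \<Longrightarrow> \<exists>u\<in>V. \<exists>v\<in>V. d e = {u, v}"
begin

lemma fin_graph_subset: "A \<subseteq> E \<Longrightarrow> fin_graph V d A"
  using finV neV finE ends_ex finite_subset by unfold_locales blast+

lemma ends_subset: "e \<in> E \<Longrightarrow> d e \<subseteq> V"
  using ends_ex[of e] by auto

text \<open>Every vertex other than a fixed root is sent to an edge towards a vertex
  that is closer to the root. The distances of its two ends tell from which of them an edge comes, which makes
  this injective.\<close>

lemma spans_obtain: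
  assumes "A \<subseteq> E" "spans V d A"
  obtains P where "P \<subseteq> A" "spans V d P" "card P + 1 = card V"
proof -
  obtain r where r: "r \<in> V" using neV by blast
  define R where "R = {(x, y). \<exists>e\<in>A. d e = {x, y}}"
  define D where "D x = (LEAST n. (r, x) \<in> R ^^ n)" for x
  have ex: "\<exists>n. (r, x) \<in> R ^^ n" if "x \<in> V" for x
    using assms(2) r that unfolding spans_def reach_def R_def by (meson rtrancl_imp_relpow)
  have D: "(r, x) \<in> R ^^ D x" if "x \<in> V" for x
    unfolding D_def using ex[OF that] by (rule LeastI_ex)
  have "\<exists>e y. e \<in> A \<and> d e = {y, x} \<and> y \<in> V \<and> D y < D x" if x: "x \<in> V - {r}" for x
  proof -
    have "D x \<noteq> 0" using D[of x] x by (cases "D x") auto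
    then obtain n where n: "D x = Suc n" using not0_implies_Suc by blast
    then obtain y where y: "(r, y) \<in> R ^^ n" "(y, x) \<in> R" using D[of x] x by auto
    have "D y \<le> n" unfolding D_def using y(1) by (rule Least_le)
    moreover have "y \<in> V" using y(2) assms(1) ends_subset unfolding R_def by blast
    ultimately show ?thesis using y(2) n unfolding R_def by fastforce
  qed
  then obtain p q where pq: "\<And>x. x \<in> V - {r} \<Longrightarrow>
      p x \<in> A \<and> d (p x) = {q x, x} \<and> q x \<in> V \<and> D (q x) < D x"
    by metis
  have inj: "inj_on p (V - {r})"
  proof (rule inj_onI)
    fix x x' assume x: "x \<in> V - {r}" "x' \<in> V - {r}" "p x = p x'"
    then have "{q x, x} = {q x', x'}" using pq by metis
    then show "x = x'" using pq[OF x(1)] pq[OF x(2)] by (auto simp: doubleton_eq_iff)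
  qed
  define P where "P = p ` (V - {r})"
  have "reach d P r x" if "x \<in> V" for x
    using that
  proof (induction "D x" arbitrary: x rule: less_induct)
    case less
    show ?case
    proof (cases "x = r")
      case False
      then have x: "x \<in> V - {r}" using less by blast
      then have "reach d P r (q x)" using pq less by blast
      moreover have "reach d P (q x) x"
        using pq[OF x] x by (intro reach_edge[of "p x"]) (auto simp: P_def)
      ultimately show ?thesis by (rule reach_trans)
    qed simp
  qed
  then have "spans V d P" by (rule spansI_root)
  moreover have "P \<subseteq> A" using pq by (auto simp: P_def)
  moreover have "card P + 1 = card V"
    unfolding P_def using inj r finV card_Suc_Diff1[of V r] by (simp add: card_image)
  ultimately show thesis using that by blast
qed

lemma spans_card: "A \<subseteq> E \<Longrightarrow> spans V d A \<Longrightarrow> card V \<le> card A + 1"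
  by (metis spans_obtain card_mono finE finite_subset add_le_mono1)

lemma trees_minimal:
  assumes "T \<in> trees V d E" "e \<in> T"
  shows "\<not> spans V d (T - {e})"
proof
  assume "spans V d (T - {e})"
  moreover have T: "T \<subseteq> E" "finite T" "card T + 1 = card V"
    using assms finite_subset[OF _ finE] unfolding trees_def by blast+
  ultimately have "card V \<le> card (T - {e}) + 1" by (intro spans_card) auto
  with T assms(2) card_Diff1_less[of T e] show False by linarith
qed

lemma trees_minimal_iff:
  assumes "T \<subseteq> E" "spans V d T"
  shows "T \<in> trees V d E \<longleftrightarrow> (\<forall>e\<in>T. \<not> spans V d (T - {e}))"
proof
  assume *: "\<forall>e\<in>T. \<not> spans V d (T - {e})"
  obtain P where P: "P \<subseteq> T" "spans V d P" "card P + 1 = card V"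
    using spans_obtain[OF assms] .
  have "P = T"
  proof (rule ccontr)
    assume "P \<noteq> T"
    then obtain e where "e \<in> T" "P \<subseteq> T - {e}" using P by blast
    then show False using * spans_mono[OF P(2)] by blast
  qed
  then show "T \<in> trees V d E" using P assms by (auto simp: trees_def)
qed (use trees_minimal in blast)

lemma trees_finite: "finite (trees V d E)"
  by (rule finite_subset[of _ "Pow E"]) (auto simp: trees_def finE)

lemma finite_tree: "T \<in> trees V d E \<Longrightarrow> finite T"
  unfolding trees_def using finite_subset[OF _ finE] by blast

lemma trees_nonempty:
  assumes "spans V d E"
  shows "trees V d E \<noteq> {}"
  proof -
  obtain P where "P \<subseteq> E" "spans V d P" "card P + 1 = card V"
    using spans_obtain[OF subset_refl assms] .
  then show ?thesis unfolding trees_def by blast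
qed

text \<open>Without \<open>e\<close> there are too few edges to connect everything, so the ends of \<open>e\<close> come
  to lie in different parts. There are only two parts, as \<open>e\<close> would reconnect no third one.\<close>

lemma tree_edge_split:
  assumes "T \<in> trees V d E" "e \<in> T" "d e = {a, b}"
  shows "\<not> reach d (T - {e}) a b" "x \<in> V \<Longrightarrow> reach d (T - {e}) a x \<or> reach d (T - {e}) b x"
proof -
  have T: "spans V d T" "T \<subseteq> E" using assms by (auto simp: trees_def)
  have iT: "insert e (T - {e}) = T" using assms by auto
  have R: "reach d T x y \<longleftrightarrow> reach d (T - {e}) x y \<or>
     (reach d (T - {e}) x a \<and> reach d (T - {e}) b y) \<or>
     (reach d (T - {e}) x b \<and> reach d (T - {e}) a y)" for x y
    using reach_insert[where d = d and e = e and A = "T - {e}", OF assms(3)] iT by simp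
  have ab: "a \<in> V" "b \<in> V" using assms T ends_subset by blast+
  show "\<not> reach d (T - {e}) a b"
  proof
    assume "reach d (T - {e}) a b"
    then have "spans V d (T - {e})" using T(1) R unfolding spans_def reach_part by metis
    then show False using trees_minimal assms by blast
  qed
  show "reach d (T - {e}) a x \<or> reach d (T - {e}) b x" if "x \<in> V"
    using T(1) R[of a x] ab that unfolding spans_def reach_part by metis
qed

lemma tree_exchange:
  assumes "T \<in> trees V d E" "e \<in> T" "g \<in> E" "d g = {x, y}" "\<not> reach d (T - {e}) x y"
  shows "insert g (T - {e}) \<in> trees V d E"
proof -
  have T: "T \<subseteq> E" "card T + 1 = card V" using assms by (auto simp: trees_def)
  obtain a b where ab: "d e = {a, b}" using ends_ex T assms by blast
  note sp = tree_edge_split[OF assms(1,2) ab]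
  have xy: "x \<in> V" "y \<in> V" using assms ends_subset by blast+
  have g: "g \<notin> T - {e}" using assms(4,5) reach_edge by metis
  have gmono: "reach d (T - {e}) u v \<Longrightarrow> reach d (insert g (T - {e})) u v" for u v
    by (erule reach_mono) auto
  have gxy: "reach d (insert g (T - {e})) x y" using assms(4) by (auto intro: reach_edge)
  have "reach d (insert g (T - {e})) a b"
    using sp(2)[OF xy(1)] sp(2)[OF xy(2)] assms(5) gxy gmono[of a x] gmono[of b x] gmono[of a y]
      gmono[of b y] unfolding reach_part by metis
  then have "reach d (insert g (T - {e})) a v" if "v \<in> V" for v
    using sp(2)[OF that] gmono by (meson reach_trans)
  then have "spans V d (insert g (T - {e}))" by (rule spansI_root)
  moreover have "card (insert g (T - {e})) + 1 = card V"
    using T(2) g card_Suc_Diff1[OF finite_tree[OF assms(1)] assms(2)] finite_tree[OF assms(1)]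
    by (simp only: card_insert_disjoint finite_Diff not_False_eq_True)
  ultimately show ?thesis using T assms by (auto simp: trees_def)
qed

end

section \<open>Trees in the sense of acyclic connected graphs\<close>

lemma reach_simple_path:
  assumes "reach d A u v"
  shows "\<exists>vs es. length vs = Suc (length es) \<and> hd vs = u \<and> last vs = v \<and> distinct vs \<and> set es \<subseteq> A \<and>
    (\<forall>i<length es. d (es ! i) = {vs ! i, vs ! Suc i})"
  using assms
proof (induction rule: reach_induct)
  case refl
  show ?case by (intro exI[of _ "[u]"] exI[of _ "[]"]) auto
next
  case (step y z e)
  then obtain vs es where p: "length vs = Suc (length es)" "hd vs = u" "last vs = y" "distinct vs"
    "set es \<subseteq> A" "\<forall>i<length es. d (es ! i) = {vs ! i, vs ! Suc i}" by blast
  show ?case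
  proof (cases "z \<in> set vs")
    case True
    then obtain k where k: "k < length vs" "vs ! k = z" by (auto simp: in_set_conv_nth)
    have "set (take k es) \<subseteq> A" using p(5) set_take_subset by (rule dual_order.trans)
    moreover have "last (take (Suc k) vs) = z"
      using k by (simp add: take_Suc_conv_app_nth)
    moreover have "hd (take (Suc k) vs) = u" using p(2) by simp
    ultimately show ?thesis using k p
      by (intro exI[of _ "take (Suc k) vs"] exI[of _ "take k es"]) (auto simp: nth_append)
  next
    case False
    have ne: "vs \<noteq> []" using p(1) by auto
    have "vs ! length es = y" using p(1,3) ne by (simp add: last_conv_nth)
    then show ?thesis using p step False ne
      by (intro exI[of _ "vs @ [z]"] exI[of _ "es @ [e]"])
        (auto simp: nth_append less_Suc_eq)
  qed
qed

lemma is_cycle_bridge: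
  assumes "is_cycle G vs es"
  shows "\<exists>e\<in>edges G. \<exists>a b. ends G e = {a, b} \<and> reach (ends G) (edges G - {e}) a b"
proof -
  have c: "es \<noteq> []" "length vs = length es" "distinct es" "set es \<subseteq> edges G"
    "\<And>i. i < length es \<Longrightarrow> ends G (es ! i) = {vs ! i, vs ! (Suc i mod length es)}"
    using assms by (auto simp: is_cycle_def)
  define n where "n = length es"
  have n: "0 < n" using c by (auto simp: n_def)
  have "reach (ends G) (edges G - {es ! (n - 1)}) (vs ! 0) (vs ! k)" if "k < n" for k
    using that
  proof (induction k)
    case (Suc k)
    have "es ! k \<noteq> es ! (n - 1)"
      using c Suc.prems n by (subst nth_eq_iff_index_eq) (auto simp: n_def)
    then have "reach (ends G) (edges G - {es ! (n - 1)}) (vs ! k) (vs ! Suc k)"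
      using c(5)[of k] c(4) Suc.prems by (intro reach_edge[of "es ! k"]) (auto simp: n_def)
    then show ?case using Suc reach_trans by fastforce
  qed simp
  then have "reach (ends G) (edges G - {es ! (n - 1)}) (vs ! 0) (vs ! (n - 1))"
    using n by simp
  then have "reach (ends G) (edges G - {es ! (n - 1)}) (vs ! (n - 1)) (vs ! 0)"
    by (rule reach_sym)
  moreover have "ends G (es ! (n - 1)) = {vs ! (n - 1), vs ! 0}"
    using c(5)[of "n - 1"] n by (simp add: n_def)
  moreover have "es ! (n - 1) \<in> edges G" using c(4) n by (auto simp: n_def)
  ultimately show ?thesis by blast
qed

lemma bridge_is_cycle:
  assumes "e \<in> edges G" "ends G e = {a, b}" "reach (ends G) (edges G - {e}) a b"
    and sub: "\<And>e. e \<in> edges G \<Longrightarrow> ends G e \<subseteq> verts G"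
  shows "\<exists>vs es. is_cycle G vs es"
proof -
  obtain vs es where p: "length vs = Suc (length es)" "hd vs = a" "last vs = b" "distinct vs"
    "set es \<subseteq> edges G - {e}" "\<forall>i<length es. ends G (es ! i) = {vs ! i, vs ! Suc i}"
    using reach_simple_path[OF assms(3)] by blast
  have ne: "vs \<noteq> []" using p(1) by auto
  have ends: "ends G ((es @ [e]) ! i) = {vs ! i, vs ! (Suc i mod length (es @ [e]))}"
    if "i < length (es @ [e])" for i
  proof (cases "i < length es")
    case True
    then show ?thesis using p by (simp add: nth_append)
  next
    case False
    then have "i = length es" using that by simp
    then show ?thesis using p assms(2) ne by (simp add: hd_conv_nth last_conv_nth insert_commute)
  qed
  have "es ! i \<noteq> es ! j" if ij: "i < length es" "j < length es" "i < j" for i j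
  proof
    assume "es ! i = es ! j"
    then have "{vs ! i, vs ! Suc i} = {vs ! j, vs ! Suc j}" using p(6) ij by metis
    then have "vs ! i = vs ! j \<or> vs ! i = vs ! Suc j" by (auto simp: doubleton_eq_iff)
    then show False using p(1,4) ij by (auto simp: nth_eq_iff_index_eq)
  qed
  then have "distinct es" unfolding distinct_conv_nth by (metis linorder_neqE_nat)
  moreover have "set vs \<subseteq> verts G"
  proof
    fix x assume "x \<in> set vs"
    then obtain i where "i < length (es @ [e])" "x = vs ! i" using p(1) by (auto simp: in_set_conv_nth)
    then have "x \<in> ends G ((es @ [e]) ! i)" "(es @ [e]) ! i \<in> edges G"
      using ends p(5) assms(1) nth_mem[of i "es @ [e]"] by auto
    then show "x \<in> verts G" using sub by blast
  qed
  ultimately have "is_cycle G vs (es @ [e])"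
    unfolding is_cycle_def using p assms(1) ends by auto
  then show ?thesis by blast
qed

text \<open>An edge lies on a cycle if and only if its ends remain connected without it. So a connected graph is acyclic
  if it is a minimal connected graph, and these have one edge less than vertices.\<close>

lemma spanning_trees_eq_trees:
  assumes "fin_graph (verts G) (ends G) (edges G)"
  shows "spanning_trees G = trees (verts G) (ends G) (edges G)"
proof -
  interpret fin_graph "verts G" "ends G" "edges G" by fact
  have "is_tree (G\<lparr>edges := T\<rparr>) \<longleftrightarrow> T \<in> trees (verts G) (ends G) (edges G)" if T: "T \<subseteq> edges G" for T
  proof -
    interpret T: fin_graph "verts G" "ends G" T by (rule fin_graph_subset[OF T])
    have conn: "connected_graph (G\<lparr>edges := T\<rparr>) \<longleftrightarrow> spans (verts G) (ends G) T"
      by (simp add: connected_graph_def reachable_reach spans_def)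
    show ?thesis
    proof (cases "spans (verts G) (ends G) T")
      case sp: True
      have "(\<exists>vs es. is_cycle (G\<lparr>edges := T\<rparr>) vs es) \<longleftrightarrow> (\<exists>e\<in>T. spans (verts G) (ends G) (T - {e}))"
      proof
        assume "\<exists>vs es. is_cycle (G\<lparr>edges := T\<rparr>) vs es"
        then obtain vs es where "is_cycle (G\<lparr>edges := T\<rparr>) vs es" by blast
        from is_cycle_bridge[OF this] obtain e a b
          where e: "e \<in> T" "ends G e = {a, b}" "reach (ends G) (T - {e}) a b" by auto
        have "reach (ends G) (T - {e}) x y" if "reach (ends G) T x y" for x y
          using reach_insert[where d = "ends G" and e = e and A = "T - {e}" and x = x and y = y, OF e(2)]
            that e(3) insert_Diff[OF e(1)] unfolding reach_part by metis
        then show "\<exists>e\<in>T. spans (verts G) (ends G) (T - {e})"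
          using sp e(1) unfolding spans_def by blast
      next
        assume "\<exists>e\<in>T. spans (verts G) (ends G) (T - {e})"
        then obtain e where e: "e \<in> T" "spans (verts G) (ends G) (T - {e})" by blast
        then obtain a b where "a \<in> verts G" "b \<in> verts G" "ends G e = {a, b}"
          using T.ends_ex by blast
        then show "\<exists>vs es. is_cycle (G\<lparr>edges := T\<rparr>) vs es"
          using e T.ends_subset by (intro bridge_is_cycle[of e _ a b]) (auto simp: spans_def)
      qed
      then show ?thesis using conn sp trees_minimal_iff[OF T sp] by (simp add: is_tree_def)
    qed (auto simp: is_tree_def conn trees_def)
  qed
  then show ?thesis unfolding spanning_trees_def trees_def by auto
qed

lemma connected_component_mono_Compl:
  "connected_component (- K) x y \<Longrightarrow> L \<subseteq> K \<Longrightarrow> connected_component (- L) x y"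
  by (meson Compl_anti_mono connected_component_of_subset)

text \<open>Janiszewski's theorem, applied to an arc, which does not separate the plane.\<close>

lemma Janiszewski_arc:
  fixes K :: "complex set"
  assumes "compact K" "arc g" "connected (K \<inter> path_image g)" "connected_component (- K) x y"
    "x \<notin> path_image g" "y \<notin> path_image g"
  shows "connected_component (- (K \<union> path_image g)) x y"
proof (rule Janiszewski)
  have "connected (- path_image g)"
    by (rule connected_arc_complement[OF assms(2)]) simp
  then show "connected_component (- path_image g) x y"
    unfolding connected_component_def using assms by blast
qed (use assms compact_arc_image compact_imp_closed in blast)+

lemma connected_subset_sing: "S \<subseteq> {a} \<Longrightarrow> connected S"
  using subset_singletonD by fastforce

lemma component_closure_subset:
  fixes K :: "complex set"
  assumes "compact K" "U \<in> components (- K)"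
  shows "closure U \<subseteq> U \<union> K" "open U" "frontier U \<subseteq> K"
proof -
  have K: "closed K" by (rule compact_imp_closed[OF assms(1)])
  show "frontier U \<subseteq> K" by (rule frontier_of_components_closed_complement[OF K assms(2)])
  then show "closure U \<subseteq> U \<union> K" using closure_Un_frontier by blast
  show "open U" using assms K open_components by blast
qed

text \<open>A new arc meets a compact set \<open>K\<close> only in its ends and runs through the component
  \<open>F\<close> of the complement. What it does to this component decides how faces change if an edge is
  drawn.\<close>

locale arc_attached =
  fixes K :: "complex set" and g :: "real \<Rightarrow> complex" and F :: "complex set"
  assumes K: "compact K" and g: "arc g"
    and gK: "path_image g \<inter> K \<subseteq> {pathstart g, pathfinish g}"
    and F: "F \<in> components (- K)" and gF: "path_image g - {pathstart g, pathfinish g} \<subseteq> F"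
begin

abbreviation "e \<equiv> path_image g"

lemma compact_Ke: "compact (K \<union> e)"
  using K g compact_arc_image by blast

lemma interior_param: "0 < t \<Longrightarrow> t < 1 \<Longrightarrow> g t \<in> F \<and> g t \<notin> K \<and> g t \<in> e"
proof -
  assume t: "0 < t" "t < 1"
  have "inj_on g {0..1}" using g by (simp add: arc_def)
  then have "g t \<noteq> g 0" "g t \<noteq> g 1" using t by (auto dest: inj_onD)
  moreover have "g t \<in> e" using t by (auto simp: path_image_def)
  ultimately have "g t \<in> F" using gF by (auto simp: pathstart_def pathfinish_def)
  then show ?thesis using \<open>g t \<in> e\<close> in_components_subset[OF F] by blast
qed

text \<open>If some part of the arc were away from a component \<open>U\<close>, then \<open>U\<close> would still be separated
  from that part by \<open>K\<close> together with the two remaining pieces of the arc. But these are two pendant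
  arcs, which separate nothing.\<close>

lemma component_frontier:
  assumes U: "U \<in> components (- (K \<union> e))" "U \<subseteq> F"
  shows "e \<subseteq> frontier U"
proof (rule ccontr)
  assume "\<not> e \<subseteq> frontier U"
  moreover have UK: "U \<inter> (K \<union> e) = {}" "U \<noteq> {}" "connected U"
    using in_components_subset[OF U(1)] in_components_nonempty[OF U(1)] in_components_connected[OF U(1)]
    by blast+
  moreover have "open U" by (rule component_closure_subset(2)[OF compact_Ke U(1)])
  ultimately obtain p where "p \<in> e" "p \<notin> closure U"
    unfolding frontier_def by (auto simp: interior_open)
  then obtain t where t: "0 \<le> t" "t \<le> 1" "g t \<notin> closure U" by (auto simp: path_image_def)
  have cg: "continuous_on {0..1} g" using g by (simp add: arc_def path_def)
  have "\<exists>\<delta>>0. \<forall>s\<in>{0..1}. \<bar>s - t\<bar> < \<delta> \<longrightarrow> g s \<notin> closure U"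
  proof -
    have "openin (top_of_set {0..1}) ({0..1} \<inter> g -` (- closure U))"
      by (rule continuous_openin_preimage_gen[OF cg]) auto
    moreover have "t \<in> {0..1} \<inter> g -` (- closure U)" using t by simp
    ultimately obtain \<delta> where \<delta>: "\<delta> > 0" "ball t \<delta> \<inter> {0..1} \<subseteq> {0..1} \<inter> g -` (- closure U)"
      unfolding openin_contains_ball by blast
    have "g s \<notin> closure U" if "s \<in> {0..1}" "\<bar>s - t\<bar> < \<delta>" for s
    proof -
      have "s \<in> ball t \<delta> \<inter> {0..1}" using that by (simp add: dist_real_def abs_minus_commute)
      then show ?thesis using \<delta>(2) by blast
    qed
    then show ?thesis using \<delta>(1) by blast
  qed
  then obtain \<delta> where \<delta>: "\<delta> > 0" "\<And>s. 0 \<le> s \<Longrightarrow> s \<le> 1 \<Longrightarrow> \<bar>s - t\<bar> < \<delta> \<Longrightarrow> g s \<notin> closure U"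
    by auto
  obtain a b where ab: "0 < a" "a < b" "b < 1" "\<And>s. a \<le> s \<Longrightarrow> s \<le> b \<Longrightarrow> \<bar>s - t\<bar> < \<delta>"
  proof (cases "t < 1")
    case True
    define c where "c = min (1 - t) \<delta>"
    have "c > 0" "c \<le> 1 - t" "c \<le> \<delta>" using True \<delta> by (auto simp: c_def)
    then show ?thesis by (intro that[of "t + c / 4" "t + c / 2"]) (use t in auto)
  next
    case False
    define c where "c = min 1 \<delta>"
    have "c > 0" "c \<le> 1" "c \<le> \<delta>" using \<delta> by (auto simp: c_def)
    then show ?thesis by (intro that[of "t - c / 2" "t - c / 4"]) (use t False in auto)
  qed
  define g1 where "g1 = subpath 0 a g"
  define g2 where "g2 = subpath b 1 g"
  have arcs: "arc g1" "arc g2" unfolding g1_def g2_def using g ab by (auto intro: arc_subpath_arc)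
  have im: "path_image g1 = g ` {0..a}" "path_image g2 = g ` {b..1}"
    using ab by (auto simp: g1_def g2_def path_image_subpath)
  have sub: "path_image g1 \<subseteq> e" "path_image g2 \<subseteq> e"
    using ab unfolding im by (auto simp: path_image_def)
  have inj: "inj_on g {0..1}" using g by (simp add: arc_def)
  define y where "y = g ((a + b) / 2)"
  have yy: "y \<in> F" "y \<notin> K" "y \<in> e" using interior_param[of "(a + b) / 2"] ab by (auto simp: y_def)
  have y12: "y \<notin> path_image g1" "y \<notin> path_image g2"
    unfolding im y_def using inj_onD[OF inj, of "(a + b) / 2"] ab by (auto, force, force)
  obtain x where x: "x \<in> U" using UK by blast
  have x12: "x \<notin> path_image g1" "x \<notin> path_image g2" using x UK sub by blast+
  have "connected_component (- K) x y"
    using x yy U(2) F in_components_connected in_components_subset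
    unfolding connected_component_def by blast
  moreover have "K \<inter> path_image g1 \<subseteq> {g 0}"
  proof
    fix z assume z: "z \<in> K \<inter> path_image g1"
    then obtain s where s: "0 \<le> s" "s \<le> a" "z = g s" by (auto simp: im)
    have "s = 0" using interior_param[of s] s z ab by force
    then show "z \<in> {g 0}" using s by simp
  qed
  ultimately have c1: "connected_component (- (K \<union> path_image g1)) x y"
    using K arcs x12 y12 connected_subset_sing by (intro Janiszewski_arc) auto
  have "(K \<union> path_image g1) \<inter> path_image g2 \<subseteq> {g 1}"
  proof
    fix z assume z: "z \<in> (K \<union> path_image g1) \<inter> path_image g2"
    then obtain s where s: "b \<le> s" "s \<le> 1" "z = g s" by (auto simp: im)
    have "z \<notin> path_image g1"
      unfolding im using inj_onD[OF inj, of s] s ab by force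
    then have "z \<in> K" using z by blast
    then have "s = 1" using interior_param[of s] s ab by force
    then show "z \<in> {g 1}" using s by simp
  qed
  then have "connected_component (- ((K \<union> path_image g1) \<union> path_image g2)) x y"
    using K arcs x12 y12 c1 connected_subset_sing compact_arc_image
    by (intro Janiszewski_arc[where K = "K \<union> path_image g1"] compact_Un) auto
  then obtain C where C: "connected C" "C \<subseteq> - (K \<union> path_image g1 \<union> path_image g2)" "x \<in> C" "y \<in> C"
    unfolding connected_component_def by blast
  have "closure U \<inter> C \<subseteq> U"
  proof
    fix z assume z: "z \<in> closure U \<inter> C"
    have "z \<notin> e"
    proof
      assume "z \<in> e"
      then obtain s where s: "0 \<le> s" "s \<le> 1" "z = g s" by (auto simp: path_image_def)
      then have "a < s" "s < b" using z C(2) unfolding im by force+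
      then show False using \<delta>(2)[of s] ab s z by auto
    qed
    then show "z \<in> U" using component_closure_subset(1)[OF compact_Ke U(1)] z C(2) by blast
  qed
  moreover have "open U" by (rule component_closure_subset(2)[OF compact_Ke U(1)])
  ultimately have "U \<inter> C = {} \<or> - closure U \<inter> C = {}"
    using connectedD[OF C(1), of U "- closure U"] closure_subset by blast
  then show False using C x yy UK(1) \<open>closure U \<inter> C \<subseteq> U\<close> by blast
qed

text \<open>Components outside \<open>F\<close> stay away from the inner points of the arc, since \<open>F\<close> is
  open.\<close>

lemma frontier_component_iff:
  assumes U: "U \<in> components (- (K \<union> e))"
  shows "e \<subseteq> frontier U \<longleftrightarrow> U \<subseteq> F"
proof
  assume eU: "e \<subseteq> frontier U"
  have "g (1/2) \<in> F" "g (1/2) \<in> e" using interior_param[of "1/2"] by auto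
  moreover have "open F" by (rule component_closure_subset(2)[OF K F])
  ultimately have "F \<inter> U \<noteq> {}" using eU unfolding frontier_def
    by (metis DiffD1 IntI disjoint_iff empty_iff open_Int_closure_eq_empty subsetD)
  moreover have "U \<subseteq> - K" using in_components_subset[OF U] by blast
  ultimately show "U \<subseteq> F" using components_maximal[OF F in_components_connected[OF U]] by blast
qed (rule component_frontier[OF U])

lemma components_attach:
  "components (- (K \<union> e)) = (components (- K) - {F}) \<union> {U \<in> components (- (K \<union> e)). U \<subseteq> F}"
proof -
  have other: "H \<in> components (- (K \<union> e))" if H: "H \<in> components (- K)" "H \<noteq> F" for H
  proof -
    have "H \<inter> F = {}" using components_nonoverlap[OF H(1) F] H(2) by blast
    moreover have Ho: "open H" by (rule component_closure_subset(2)[OF K H(1)])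
    ultimately have "H \<inter> closure F = {}" by (simp add: open_Int_closure_eq_empty)
    moreover have "e \<subseteq> closure F"
    proof
      fix z assume "z \<in> e"
      then obtain s where s: "0 \<le> s" "s \<le> 1" "z = g s" by (auto simp: path_image_def)
      have "continuous_on {0..1} g" using g by (simp add: arc_def path_def)
      then have "g ` closure {0<..<1} \<subseteq> closure (g ` {0<..<1})"
        by (intro image_closure_subset) (auto simp: closure_greaterThanLessThan closure_subset)
      then have "z \<in> closure (g ` {0<..<1})" using s by (auto simp: closure_greaterThanLessThan)
      moreover have "g ` {0<..<1} \<subseteq> F" using interior_param by auto
      ultimately show "z \<in> closure F" using closure_mono by blast
    qed
    ultimately have "H \<subseteq> - (K \<union> e)" using in_components_subset[OF H(1)] by blast
    then show ?thesis using H(1) unfolding in_components_maximal by blast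
  qed
  have "U \<subseteq> F \<or> U \<in> components (- K) - {F}" if U: "U \<in> components (- (K \<union> e))" for U
  proof -
    have "U \<subseteq> - K" "connected U" "U \<noteq> {}"
      using in_components_subset[OF U] in_components_connected[OF U] in_components_nonempty[OF U] by blast+
    then obtain H where H: "H \<in> components (- K)" "U \<subseteq> H" using exists_component_superset
      by (metis subset_empty)
    show ?thesis
    proof (cases "H = F")
      case False
      have "H = U"
        using other[OF H(1) False] U H(2) \<open>U \<noteq> {}\<close> components_eq by blast
      then show ?thesis using H False by blast
    qed (use H in blast)
  qed
  then show ?thesis using other by blast
qed

text \<open>If \<open>K\<close> joins the ends of the arc, then the arc lies on a Jordan curve \<open>C\<close> whose other part is in
  \<open>K\<close>. Points of \<open>F\<close> on the same side of \<open>C\<close> remain connected by Janiszewski's theorem, since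
  \<open>K \<inter> C\<close> is an arc.\<close>

lemma split_two:
  assumes p: "arc p" "path_image p \<subseteq> K" "pathstart p = pathfinish g" "pathfinish p = pathstart g"
  obtains c where "simple_path c" "pathfinish c = pathstart c" "path_image c = e \<union> path_image p"
    "{U \<in> components (- (K \<union> e)). U \<subseteq> F} = {F \<inter> inside (path_image c), F \<inter> outside (path_image c)}"
    "F \<inter> inside (path_image c) \<noteq> F \<inter> outside (path_image c)"
proof -
  define c where "c = g +++ p"
  have c: "simple_path c" "pathfinish c = pathstart c"
    unfolding c_def using g p gK by (auto intro!: simple_path_join_loop)
  have ic: "path_image c = e \<union> path_image p"
    unfolding c_def using p by (simp add: path_image_join)
  note J = Jordan_inside_outside[OF c]
  have Kc: "K \<union> path_image c = K \<union> e" using ic p by blast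
  have Kic: "K \<inter> path_image c = path_image p"
  proof -
    have "pathstart g \<in> path_image p" "pathfinish g \<in> path_image p"
      using p pathstart_in_path_image pathfinish_in_path_image by metis+
    then show ?thesis using ic p gK by blast
  qed
  have Fo: "open F" by (rule component_closure_subset(2)[OF K F])
  have conn: "connected_component (- (K \<union> e)) x y"
    if xy: "x \<in> F" "y \<in> F" and S: "connected S" "S \<subseteq> - path_image c" "x \<in> S" "y \<in> S" for x y S
    unfolding Kc[symmetric]
  proof (rule Janiszewski[OF K])
    show "closed (path_image c)" by (simp add: c closed_simple_path_image)
    show "connected (K \<inter> path_image c)" unfolding Kic using p by (simp add: connected_arc_image)
    show "connected_component (- K) x y"
      using xy F in_components_connected in_components_subset unfolding connected_component_def by blast
    show "connected_component (- path_image c) x y" using S unfolding connected_component_def by blast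
  qed
  have half: "F \<inter> S \<in> components (- (K \<union> e))"
    if S: "connected S" "S = inside (path_image c) \<or> S = outside (path_image c)" for S
  proof -
    have fr: "frontier S = path_image c" and So: "open S" and Sc: "S \<subseteq> - path_image c"
      using J S(2) by blast+
    have mid: "g (1/2) \<in> F" "g (1/2) \<in> e" using interior_param[of "1/2"] by auto
    then have "g (1/2) \<in> closure S" using fr ic by (auto simp: frontier_def)
    then have "F \<inter> S \<noteq> {}" using mid Fo open_Int_closure_eq_empty by blast
    then obtain a where a: "a \<in> F" "a \<in> S" by blast
    have "F \<inter> S = connected_component_set (- (K \<union> e)) a"
    proof (intro equalityI subsetI)
      fix y assume "y \<in> F \<inter> S"
      then show "y \<in> connected_component_set (- (K \<union> e)) a" using conn[OF a(1) _ S(1) Sc a(2)] by blast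
    next
      fix y assume y: "y \<in> connected_component_set (- (K \<union> e)) a"
      then obtain C where C: "connected C" "C \<subseteq> - (K \<union> e)" "a \<in> C" "y \<in> C"
        unfolding connected_component_def by auto
      have "C \<subseteq> F" using components_maximal[OF F C(1)] C a by blast
      moreover have "C \<inter> frontier S = {}" using C fr Kc by blast
      then have "C \<subseteq> S" using connected_Int_frontier[OF C(1), of S] C a by blast
      ultimately show "y \<in> F \<inter> S" using C by blast
    qed
    moreover have "a \<in> - (K \<union> e)" using a Sc ic in_components_subset[OF F] by blast
    ultimately show ?thesis by (simp add: componentsI)
  qed
  define U1 where "U1 = F \<inter> inside (path_image c)"
  define U2 where "U2 = F \<inter> outside (path_image c)"
  have U: "U1 \<in> components (- (K \<union> e))" "U2 \<in> components (- (K \<union> e))"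
    unfolding U1_def U2_def using half J by auto
  have cov: "U \<subseteq> F \<Longrightarrow> U \<in> components (- (K \<union> e)) \<Longrightarrow> U = U1 \<or> U = U2" for U
  proof -
    assume Us: "U \<subseteq> F" "U \<in> components (- (K \<union> e))"
    obtain x where x: "x \<in> U" using in_components_nonempty[OF Us(2)] by blast
    have "x \<notin> path_image c" using in_components_subset[OF Us(2)] x Kc by blast
    then have "x \<in> U1 \<or> x \<in> U2" unfolding U1_def U2_def using J x Us by blast
    then show "U = U1 \<or> U = U2" using components_eq[OF Us(2)] U x by blast
  qed
  have "U1 \<noteq> U2"
  proof
    assume "U1 = U2"
    then have "U1 = {}" unfolding U1_def U2_def using J by blast
    then show False using U in_components_nonempty by blast
  qed
  moreover have "{U \<in> components (- (K \<union> e)). U \<subseteq> F} = {U1, U2}"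
    using cov U by (auto simp: U1_def U2_def)
  ultimately show thesis using that[of c] c ic unfolding U1_def U2_def by simp
qed

text \<open>If the ends of the arc lie in different parts of \<open>K\<close> that are both closed, the arc is pendant
  at each of them and separates nothing.\<close>

lemma split_none:
  assumes AB: "K = A \<union> B" "closed A" "closed B" "A \<inter> B = {}" "pathfinish g \<notin> A" "pathstart g \<notin> B"
  obtains U where "{U \<in> components (- (K \<union> e)). U \<subseteq> F} = {U}"
proof -
  have cAB: "compact A" "compact B"
    using K AB compact_Int_closed[OF K AB(2)] compact_Int_closed[OF K AB(3)] by (auto simp: Int_absorb1)
  have conn: "connected_component (- (K \<union> e)) x y" if xy: "x \<in> F - e" "y \<in> F - e" for x y
  proof -
    have Kxy: "connected_component (- K) x y"
      using xy F in_components_connected in_components_subset unfolding connected_component_def by blast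
    have "A \<inter> e \<subseteq> {pathstart g}" using AB gK by blast
    then have 1: "connected_component (- (A \<union> e)) x y"
    proof (intro Janiszewski_arc[OF cAB(1) g])
      show "connected_component (- A) x y"
        by (rule connected_component_mono_Compl[OF Kxy]) (simp add: AB(1))
    qed (use xy connected_subset_sing in auto)
    have 2: "connected_component (- B) x y"
      by (rule connected_component_mono_Compl[OF Kxy]) (simp add: AB(1))
    have "connected_component (- ((A \<union> e) \<union> B)) x y"
    proof (rule Janiszewski[OF _ AB(3) _ 1 2])
      show "compact (A \<union> e)" using cAB compact_arc_image[OF g] by blast
      have "(A \<union> e) \<inter> B \<subseteq> {pathfinish g}" using AB gK by blast
      then show "connected ((A \<union> e) \<inter> B)" by (rule connected_subset_sing)
    qed
    then show ?thesis using AB(1) by (simp add: Un_ac)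
  qed
  have "F - e \<noteq> {}"
  proof
    assume "F - e = {}"
    then have Fe: "F \<subseteq> e" by blast
    have "connected (- {pathstart g, pathfinish g})"
      using connected_open_diff_countable[of "UNIV :: complex set" "{pathstart g, pathfinish g}"]
        connected_UNIV by (simp add: Compl_eq_Diff_UNIV)
    moreover have "open F" by (rule component_closure_subset(2)[OF K F])
    moreover have "open (- e)" using g by (simp add: closed_arc_image open_Compl)
    moreover have "- {pathstart g, pathfinish g} \<subseteq> F \<union> (- e)" using gF by blast
    ultimately have "F \<inter> - {pathstart g, pathfinish g} = {} \<or> - e \<inter> - {pathstart g, pathfinish g} = {}"
      using connectedD[of "- {pathstart g, pathfinish g}" F "- e"] Fe by blast
    moreover have "g (1/2) \<in> F" "g (1/2) \<noteq> g 0" "g (1/2) \<noteq> g 1"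
      using interior_param[of "1/2"] g by (auto simp: arc_def dest: inj_onD)
    ultimately have "- e \<inter> - {pathstart g, pathfinish g} = {}"
      by (auto simp: pathstart_def pathfinish_def)
    then have "e = UNIV" using pathstart_in_path_image pathfinish_in_path_image by blast
    then show False using bounded_arc_image[OF g] not_bounded_UNIV by metis
  qed
  then obtain x where x: "x \<in> F - e" by blast
  define U where "U = connected_component_set (- (K \<union> e)) x"
  have xK: "x \<in> - (K \<union> e)" using x in_components_subset[OF F] by blast
  then have U: "U \<in> components (- (K \<union> e))" by (simp add: U_def componentsI)
  have "x \<in> U" using xK by (simp add: U_def)
  have "U \<subseteq> - K" using in_components_subset[OF U] by blast
  then have UF: "U \<subseteq> F"
    using components_maximal[OF F in_components_connected[OF U]] \<open>x \<in> U\<close> x by blast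
  have "U' = U" if U': "U' \<in> components (- (K \<union> e))" "U' \<subseteq> F" for U'
  proof -
    obtain y where y: "y \<in> U'" using in_components_nonempty[OF U'(1)] by blast
    then have "y \<in> F - e" using U' in_components_subset by blast
    then have "y \<in> U" using conn[OF x] by (simp add: U_def)
    then show ?thesis using components_eq[OF U'(1) U] y by blast
  qed
  then show thesis using that[of U] U UF by blast
qed

end

section \<open>Faces of plane drawings\<close>

abbreviation (input) drawn_ends :: "complex set \<Rightarrow> complex set \<Rightarrow> complex set" where
  "drawn_ends V e \<equiv> e \<inter> V"

definition sides :: "complex set \<Rightarrow> complex set set \<Rightarrow> complex set \<Rightarrow> complex set set" where
  "sides V E e = {F \<in> faces V E. e \<subseteq> frontier F}"

locale plane_graph =
  fixes V :: "complex set" and E :: "complex set set"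
  assumes drawing: "plane_drawing V E"
begin

lemma plane_graph_subset:
  assumes "A \<subseteq> E"
  shows "plane_graph V A"
proof -
  have "finite A" using drawing finite_subset[OF assms] by (simp add: plane_drawing_def)
  then show ?thesis
    using drawing subsetD[OF assms] unfolding plane_graph_def plane_drawing_def by simp
qed

lemma arc_ex: "e \<in> E \<Longrightarrow> \<exists>g. arc g \<and> path_image g = e \<and> e \<inter> V = {pathstart g, pathfinish g}"
  using drawing unfolding plane_drawing_def by blast

lemma edges_meet: "e \<in> E \<Longrightarrow> e' \<in> E \<Longrightarrow> e \<noteq> e' \<Longrightarrow> e \<inter> e' \<subseteq> V"
  using drawing unfolding plane_drawing_def by blast

sublocale fin_graph V "drawn_ends V" E
proof
  show "finite V" "V \<noteq> {}" "finite E" using drawing by (auto simp: plane_drawing_def)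
  show "\<exists>u\<in>V. \<exists>v\<in>V. drawn_ends V e = {u, v}" if "e \<in> E" for e
    using arc_ex[OF that] by (metis IntD2 insert_iff)
qed

lemma ends_ex2: "e \<in> E \<Longrightarrow> \<exists>u\<in>V. \<exists>v\<in>V. u \<noteq> v \<and> e \<inter> V = {u, v}"
  using arc_ex[of e] arc_distinct_ends by (metis IntD2 insert_iff)

lemma edge_uncountable: "e \<in> E \<Longrightarrow> uncountable e"
  using arc_ex arc_image_uncountable by metis

lemma compact_edge: "e \<in> E \<Longrightarrow> compact e"
  using arc_ex compact_arc_image by metis

lemma compact_drawing: "A \<subseteq> E \<Longrightarrow> compact (V \<union> \<Union>A)"
proof -
  assume A: "A \<subseteq> E"
  then have "finite A" using finE by (rule finite_subset)
  then have "compact (\<Union>A)" using A compact_edge by (intro compact_Union) auto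
  then show ?thesis by (rule compact_Un[OF finite_imp_compact[OF finV]])
qed

lemma path_component_reach:
  assumes "reach (drawn_ends V) A s t" "s \<in> V" "A \<subseteq> E"
  shows "path_component (V \<union> \<Union>A) s t"
  using assms(1)
proof (induction rule: reach_induct)
  case refl
  then show ?case using assms by (simp add: path_component_refl)
next
  case (step y z e)
  then obtain g where g: "arc g" "path_image g = e" "e \<inter> V = {pathstart g, pathfinish g}"
    using arc_ex assms by blast
  have "path_connected (path_image g)" by (rule path_connected_path_image[OF arc_imp_path[OF g(1)]])
  moreover have "y \<in> path_image g" "z \<in> path_image g" using g step by blast+
  moreover have "path_image g \<subseteq> V \<union> \<Union>A" using g step by blast
  ultimately have "path_component (V \<union> \<Union>A) y z"
    unfolding path_connected_component by (meson path_component_of_subset)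
  then show ?case using step path_component_trans by blast
qed

lemma attach:
  assumes "e \<in> E" "A \<subseteq> E" "e \<notin> A"
  obtains g F where "path_image g = e" "e \<inter> V = {pathstart g, pathfinish g}"
    "arc_attached (V \<union> \<Union>A) g F"
proof -
  obtain g where g: "arc g" "path_image g = e" "e \<inter> V = {pathstart g, pathfinish g}"
    using arc_ex[OF assms(1)] by blast
  have "e \<inter> \<Union>A \<subseteq> V" using edges_meet assms by blast
  then have eK: "e \<inter> (V \<union> \<Union>A) \<subseteq> {pathstart g, pathfinish g}" using g by blast
  have "connected (e - {pathstart g, pathfinish g})"
    using connected_simple_path_endless[OF arc_imp_simple_path[OF g(1)]] g(2) by simp
  moreover have "e - {pathstart g, pathfinish g} \<subseteq> - (V \<union> \<Union>A)" using eK by blast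
  moreover have "- (V \<union> \<Union>A) \<noteq> {}"
    using compact_imp_bounded[OF compact_drawing[OF assms(2)]] not_bounded_UNIV
    by (metis Compl_empty_eq double_complement)
  ultimately obtain F where "F \<in> components (- (V \<union> \<Union>A))" "e - {pathstart g, pathfinish g} \<subseteq> F"
    using exists_component_superset by metis
  then have "arc_attached (V \<union> \<Union>A) g F"
    unfolding arc_attached_def using g eK compact_drawing[OF assms(2)] by auto
  then show thesis using that g by blast
qed

lemma Un_insert_drawing: "V \<union> \<Union>(insert e A) = V \<union> \<Union>A \<union> e"
  by blast

lemma insert_arc:
  assumes e: "e \<in> E" "A \<subseteq> E" "e \<notin> A" and p: "arc p" "path_image p \<subseteq> V \<union> \<Union>A"
    "e \<inter> V = {pathstart p, pathfinish p}"
  obtains c F U1 U2 where "F \<in> faces V A" "U1 \<noteq> U2"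
    "faces V (insert e A) = (faces V A - {F}) \<union> {U1, U2}" "sides V (insert e A) e = {U1, U2}"
    "U1 = F \<inter> inside (path_image c)" "U2 = F \<inter> outside (path_image c)"
    "simple_path c" "pathfinish c = pathstart c" "path_image c = e \<union> path_image p"
proof -
  obtain g F where g: "path_image g = e" "e \<inter> V = {pathstart g, pathfinish g}"
    and att: "arc_attached (V \<union> \<Union>A) g F" using attach[OF e(1-3)] .
  interpret att: arc_attached "V \<union> \<Union>A" g F by fact
  have ends: "{pathstart g, pathfinish g} = {pathstart p, pathfinish p}" using g p by simp
  obtain q where q: "arc q" "path_image q = path_image p" "pathstart q = pathfinish g" "pathfinish q = pathstart g"
  proof (cases "pathstart p = pathfinish g")
    case True
    moreover have "pathfinish p = pathstart g"
      using ends True arc_distinct_ends[OF att.g] by (auto simp: doubleton_eq_iff)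
    ultimately show thesis using p(1) by (intro that[of p]) auto
  next
    case False
    then have "pathstart p = pathstart g" "pathfinish p = pathfinish g"
      using ends by (auto simp: doubleton_eq_iff)
    then show thesis using p(1) by (intro that[of "reversepath p"]) (auto simp: arc_reversepath)
  qed
  have "path_image q \<subseteq> V \<union> \<Union>A" using q p by simp
  from att.split_two[OF q(1) this q(3,4)] obtain c where c: "simple_path c" "pathfinish c = pathstart c"
    "path_image c = path_image g \<union> path_image q"
    "{U \<in> components (- (V \<union> \<Union>A \<union> path_image g)). U \<subseteq> F} =
      {F \<inter> inside (path_image c), F \<inter> outside (path_image c)}"
    "F \<inter> inside (path_image c) \<noteq> F \<inter> outside (path_image c)" .
  have f: "faces V (insert e A) = components (- (V \<union> \<Union>A \<union> path_image g))"
    unfolding faces_def Un_insert_drawing g ..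
  have "sides V (insert e A) e = {U \<in> components (- (V \<union> \<Union>A \<union> path_image g)). U \<subseteq> F}"
    unfolding sides_def f using att.frontier_component_iff g by auto
  moreover have "faces V (insert e A) = (faces V A - {F}) \<union>
      {F \<inter> inside (path_image c), F \<inter> outside (path_image c)}"
    unfolding f using att.components_attach c(4) by (simp add: faces_def)
  moreover have "F \<in> faces V A" using att.F by (simp add: faces_def)
  ultimately show thesis using c g q(2)
    by (intro that[of F "F \<inter> inside (path_image c)" "F \<inter> outside (path_image c)" c]) simp_all
qed

text \<open>A path between the ends of the edge in the rest of the drawing contains an arc, which closes a Jordan curve
  together with the edge.\<close>

lemma insert_nonbridge:
  assumes e: "e \<in> E" "A \<subseteq> E" "e \<notin> A" "e \<inter> V = {s, t}"
    and r: "reach (drawn_ends V) A s t"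
  obtains c F U1 U2 where "F \<in> faces V A" "U1 \<noteq> U2"
    "faces V (insert e A) = (faces V A - {F}) \<union> {U1, U2}" "sides V (insert e A) e = {U1, U2}"
    "U1 = F \<inter> inside (path_image c)" "U2 = F \<inter> outside (path_image c)"
proof -
  have "s \<in> V" using e by blast
  then have "path_component (V \<union> \<Union>A) s t" using path_component_reach r e by blast
  then obtain q where q: "path q" "path_image q \<subseteq> V \<union> \<Union>A" "pathstart q = s" "pathfinish q = t"
    unfolding path_component_def by auto
  have "s \<noteq> t" using ends_ex2[OF e(1)] e(4) by (auto simp: doubleton_eq_iff)
  then obtain p where p: "arc p" "path_image p \<subseteq> path_image q" "pathstart p = s" "pathfinish p = t"
    using path_contains_arc[OF q(1,3,4)] by metis
  have "path_image p \<subseteq> V \<union> \<Union>A" "e \<inter> V = {pathstart p, pathfinish p}" using p q e by auto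
  from insert_arc[OF e(1-3) p(1) this] show thesis using that by metis
qed

text \<open>The part of the drawing that is connected with one end of the edge, and the rest of the drawing, are
  disjoint closed sets.\<close>

lemma insert_bridge:
  assumes e: "e \<in> E" "A \<subseteq> E" "e \<notin> A" "e \<inter> V = {s, t}"
    and r: "\<not> reach (drawn_ends V) A s t"
  obtains F U where "F \<in> faces V A" "U \<subseteq> F"
    "faces V (insert e A) = (faces V A - {F}) \<union> {U}" "sides V (insert e A) e = {U}"
proof -
  obtain g F where g: "path_image g = e" "e \<inter> V = {pathstart g, pathfinish g}"
    and att: "arc_attached (V \<union> \<Union>A) g F" using attach[OF e(1-3)] .
  interpret att: arc_attached "V \<union> \<Union>A" g F by fact
  let ?R = "reach (drawn_ends V) A (pathstart g)"
  have "{pathstart g, pathfinish g} = {s, t}" using g e by simp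
  then have nr: "\<not> ?R (pathfinish g)"
    using r by (auto simp: doubleton_eq_iff intro: reach_sym)
  define A1 where "A1 = {f \<in> A. \<exists>v\<in>f \<inter> V. ?R v}"
  define P where "P = {v \<in> V. ?R v} \<union> \<Union>A1"
  define Q where "Q = {v \<in> V. \<not> ?R v} \<union> \<Union>(A - A1)"
  have fin: "finite A1" "finite (A - A1)" using e finE finite_subset unfolding A1_def by fastforce+
  have all: "?R w" if "f \<in> A1" "w \<in> f \<inter> V" for f w
  proof -
    from that obtain v where v: "v \<in> f \<inter> V" "?R v" "f \<in> A" unfolding A1_def by blast
    have "f \<in> E" using v e by blast
    from ends_ex[OF this] obtain a b where ab: "f \<inter> V = {a, b}" by auto
    then have "reach (drawn_ends V) A a b" using v by (auto intro: reach_edge)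
    then show ?thesis using v(1,2) that(2) ab by (auto intro: reach_trans reach_sym)
  qed
  have none: "\<not> ?R w" if "f \<in> A - A1" "w \<in> f \<inter> V" for f w
    using that unfolding A1_def by blast
  have inter: "f \<inter> h \<subseteq> V" if "f \<in> A1" "h \<in> A - A1" for f h
    using edges_meet[of f h] that e unfolding A1_def by blast
  have PQ: "P \<inter> Q = {}"
  proof -
    have "x \<notin> Q" if "x \<in> P" for x
      using that all none inter unfolding P_def Q_def by blast
    then show ?thesis by blast
  qed
  have ce: "closed f" if "f \<in> A" for f using that e compact_edge compact_imp_closed by blast
  have "closed P" unfolding P_def
    by (intro closed_Un finite_imp_closed closed_Union ballI ce) (use fin finV in \<open>auto simp: A1_def\<close>)
  moreover have "closed Q" unfolding Q_def
    by (intro closed_Un finite_imp_closed closed_Union ballI ce) (use fin finV in auto)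
  moreover have "V \<union> \<Union>A = P \<union> Q" unfolding P_def Q_def A1_def by blast
  moreover have "pathstart g \<in> P" "pathfinish g \<in> Q" using g nr unfolding P_def Q_def by auto
  ultimately obtain U where U: "{U \<in> components (- (V \<union> \<Union>A \<union> path_image g)). U \<subseteq> F} = {U}"
    using att.split_none[of P Q] PQ by blast
  have f: "faces V (insert e A) = components (- (V \<union> \<Union>A \<union> path_image g))"
    unfolding faces_def Un_insert_drawing g ..
  have "sides V (insert e A) e = {U \<in> components (- (V \<union> \<Union>A \<union> path_image g)). U \<subseteq> F}"
    unfolding sides_def f using att.frontier_component_iff g by auto
  moreover have "faces V (insert e A) = (faces V A - {F}) \<union> {U}"
    unfolding f using att.components_attach U by (simp add: faces_def)
  moreover have "F \<in> faces V A" using att.F by (simp add: faces_def)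
  moreover have "U \<subseteq> F" using U by blast
  ultimately show thesis using U by (intro that[of F U]) simp_all
qed

lemma faces_nonempty: "F \<in> faces V A \<Longrightarrow> F \<noteq> {}"
  unfolding faces_def by (rule in_components_nonempty)

lemma faces_disjoint: "F \<in> faces V A \<Longrightarrow> F' \<in> faces V A \<Longrightarrow> F \<noteq> F' \<Longrightarrow> F \<inter> F' = {}"
  unfolding faces_def using components_nonoverlap by blast

lemma subface_notin: "F \<in> faces V A \<Longrightarrow> U \<subseteq> F \<Longrightarrow> U \<noteq> {} \<Longrightarrow> U \<notin> faces V A - {F}"
  using faces_disjoint by blast

lemma card_faces_insert:
  assumes e: "e \<in> E" "A \<subseteq> E" "e \<notin> A" "e \<inter> V = {s, t}" and fin: "finite (faces V A)"
  shows "finite (faces V (insert e A))"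
    "card (faces V (insert e A)) = (if reach (drawn_ends V) A s t then Suc (card (faces V A)) else card (faces V A))"
proof -
  show "finite (faces V (insert e A))"
    using insert_nonbridge[OF e] insert_bridge[OF e] fin by (metis finite.simps finite_Diff finite_Un)
  show "card (faces V (insert e A)) = (if reach (drawn_ends V) A s t then Suc (card (faces V A)) else card (faces V A))"
  proof (cases "reach (drawn_ends V) A s t")
    case True
    obtain c F U1 U2 where U: "F \<in> faces V A" "U1 \<noteq> U2"
      "faces V (insert e A) = (faces V A - {F}) \<union> {U1, U2}"
      "U1 = F \<inter> inside (path_image c)" "U2 = F \<inter> outside (path_image c)"
      using insert_nonbridge[OF e True] by metis
    have "U1 \<in> faces V (insert e A)" "U2 \<in> faces V (insert e A)" using U by auto
    then have "U1 \<noteq> {}" "U2 \<noteq> {}" using faces_nonempty by auto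
    then have "U1 \<notin> faces V A - {F}" "U2 \<notin> faces V A - {F}"
      using subface_notin[OF U(1)] U(4,5) by blast+
    then show ?thesis
      unfolding U(3) using True fin U(1,2) card_Suc_Diff1[OF fin U(1)] by simp
  next
    case False
    obtain F U where U: "F \<in> faces V A" "U \<subseteq> F" "faces V (insert e A) = (faces V A - {F}) \<union> {U}"
      using insert_bridge[OF e False] by metis
    then have "U \<in> faces V (insert e A)" by auto
    then have "U \<notin> faces V A - {F}" using subface_notin[OF U(1,2)] faces_nonempty by blast
    then show ?thesis
      unfolding U(3) using False fin U(1) card_Suc_Diff1[OF fin U(1)] by simp
  qed
qed

lemma faces_no_edges: "faces V {} = {- V}"
proof -
  have "connected (- V)"
    using connected_open_diff_countable[of "UNIV :: complex set" V] connected_UNIV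
      countable_finite[OF finV] by (simp add: Compl_eq_Diff_UNIV)
  moreover have "- V \<noteq> {}" using finV infinite_UNIV_char_0 by (metis Compl_empty_eq double_complement)
  ultimately show ?thesis unfolding faces_def by (simp add: components_eq_sing_iff)
qed

text \<open>A forest is drawn edge by edge, and no edge joins vertices that are connected already.\<close>

lemma faces_forest:
  assumes "T \<subseteq> E" "\<And>e s t. e \<in> T \<Longrightarrow> e \<inter> V = {s, t} \<Longrightarrow> \<not> reach (drawn_ends V) (T - {e}) s t"
  shows "finite (faces V T) \<and> card (faces V T) = 1"
proof -
  have "finite T" using assms finE finite_subset by blast
  then show ?thesis using assms
  proof (induction T rule: finite_induct)
    case empty
    then show ?case by (simp add: faces_no_edges)
  next
    case (insert e T)
    have IH: "finite (faces V T) \<and> card (faces V T) = 1"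
    proof (rule insert.IH)
      show "\<not> reach (drawn_ends V) (T - {f}) s t" if "f \<in> T" "f \<inter> V = {s, t}" for f s t
      proof -
        have "T - {f} \<subseteq> insert e T - {f}" by blast
        then have "reach (drawn_ends V) (T - {f}) s t \<Longrightarrow> reach (drawn_ends V) (insert e T - {f}) s t"
          by (rule reach_mono[rotated])
        then show ?thesis using insert.prems(2)[of f s t] that by auto
      qed
    qed (use insert in blast)
    obtain s t where st: "e \<inter> V = {s, t}" using ends_ex[of e] insert by auto
    have "\<not> reach (drawn_ends V) T s t" using insert.prems(2)[of e s t] st insert.hyps by simp
    then show ?case using card_faces_insert[of e T s t] insert st IH by simp
  qed
qed

lemma faces_tree:
  assumes "T \<in> trees V (drawn_ends V) E"
  shows "finite (faces V T)" "card (faces V T) = 1"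
  using faces_forest[of T] tree_edge_split[OF assms] assms by (auto simp: trees_def)

text \<open>The edges outside of a spanning tree are drawn one by one, and each of them splits a face.\<close>

lemma euler:
  assumes "spans V (drawn_ends V) E"
  shows "finite (faces V E)" "card (faces V E) + card V = card E + 2"
proof -
  obtain T where T: "T \<in> trees V (drawn_ends V) E" using trees_nonempty[OF assms] by blast
  have *: "finite (faces V (T \<union> B)) \<and> card (faces V (T \<union> B)) = 1 + card B" if "B \<subseteq> E - T" for B
  proof -
    have "finite B" using that finE finite_subset by blast
    then show ?thesis using that
    proof (induction B rule: finite_induct)
      case empty then show ?case using faces_tree[OF T] by simp
    next
      case (insert e B)
      obtain s t where st: "e \<inter> V = {s, t}" "s \<in> V" "t \<in> V" using ends_ex[of e] insert by auto
      have "reach (drawn_ends V) T s t" using T st by (auto simp: trees_def spans_def)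
      then have "reach (drawn_ends V) (T \<union> B) s t" by (rule reach_mono) blast
      moreover have "T \<union> B \<subseteq> E" "e \<in> E" "e \<notin> T \<union> B" using insert T by (auto simp: trees_def)
      ultimately show ?case using card_faces_insert[of e "T \<union> B" s t] insert st by simp
    qed
  qed
  have TE: "T \<subseteq> E" "card T + 1 = card V" using T by (auto simp: trees_def)
  then have "T \<union> (E - T) = E" by blast
  then show "finite (faces V E)" using *[of "E - T"] by simp
  have "card (faces V E) = 1 + card (E - T)" using *[of "E - T"] \<open>T \<union> (E - T) = E\<close> by simp
  moreover have "card E = card T + card (E - T)"
    using TE(1) finE by (metis card_Diff_subset card_mono finite_subset le_add_diff_inverse)
  ultimately show "card (faces V E) + card V = card E + 2" using TE(2) by simp
qed

lemma sides_nonbridge: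
  assumes "e \<in> E" "e \<inter> V = {s, t}" "reach (drawn_ends V) (E - {e}) s t"
  obtains U1 U2 where "U1 \<noteq> U2" "sides V E e = {U1, U2}"
  using insert_nonbridge[of e "E - {e}" s t] assms insert_Diff[OF assms(1)] by (metis Diff_iff Diff_subset insertI1)

lemma sides_ex: "e \<in> E \<Longrightarrow> \<exists>U1\<in>faces V E. \<exists>U2\<in>faces V E. sides V E e = {U1, U2}"
proof -
  assume e: "e \<in> E"
  obtain s t where st: "e \<inter> V = {s, t}" using ends_ex e by blast
  have "\<exists>U1 U2. sides V E e = {U1, U2}"
  proof (cases "reach (drawn_ends V) (E - {e}) s t")
    case True
    then show ?thesis using sides_nonbridge[OF e st] by metis
  next
    case False
    show ?thesis using insert_bridge[OF e _ _ st False] insert_Diff[OF e]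
      by (metis Diff_iff Diff_subset insertI1 insert_absorb2)
  qed
  then show ?thesis unfolding sides_def by blast
qed

text \<open>Only the faces beside an edge come close to its inner points.\<close>

lemma sides_near:
  assumes "e \<in> E" "p \<in> e" "p \<notin> V"
  obtains r where "r > 0" "ball p r \<inter> (V \<union> \<Union>(E - {e})) = {}"
    "\<And>U. U \<in> faces V E \<Longrightarrow> U \<inter> ball p r \<noteq> {} \<Longrightarrow> U \<in> sides V E e"
proof -
  obtain g F where g: "path_image g = e" "e \<inter> V = {pathstart g, pathfinish g}"
    and att: "arc_attached (V \<union> \<Union>(E - {e})) g F" using attach[of e "E - {e}"] assms by blast
  interpret att: arc_attached "V \<union> \<Union>(E - {e})" g F by fact
  have pF: "p \<in> F" using att.gF assms g by blast
  have "open F" by (rule component_closure_subset(2)[OF att.K att.F])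
  then obtain r where r: "r > 0" "ball p r \<subseteq> F" using pF open_contains_ball by blast
  have f: "faces V E = components (- (V \<union> \<Union>(E - {e}) \<union> path_image g))"
    unfolding faces_def g Un_insert_drawing[symmetric] insert_Diff[OF assms(1)] ..
  have "U \<in> sides V E e" if U: "U \<in> faces V E" "U \<inter> ball p r \<noteq> {}" for U
  proof -
    have Uc: "U \<in> components (- (V \<union> \<Union>(E - {e}) \<union> path_image g))" using U f by simp
    then have "U \<subseteq> - (V \<union> \<Union>(E - {e}))" using in_components_subset by blast
    then have "U \<subseteq> F"
      using components_maximal[OF att.F in_components_connected[OF Uc]] U r by blast
    then show ?thesis using att.frontier_component_iff[OF Uc] U g by (simp add: sides_def)
  qed
  moreover have "ball p r \<inter> (V \<union> \<Union>(E - {e})) = {}" using r in_components_subset[OF att.F] by blast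
  ultimately show thesis using that r by blast
qed

text \<open>A class of faces that is closed under crossing the edges outside \<open>T\<close>, together with these edges,
  is open. So the classes split the complement of \<open>T\<close> into open parts.\<close>

lemma open_face_class:
  assumes S: "S \<subseteq> faces V E" "\<And>e. e \<in> E - T \<Longrightarrow> sides V E e \<subseteq> S \<or> sides V E e \<inter> S = {}"
  shows "open (\<Union>S \<union> \<Union>{e - V |e. e \<in> E - T \<and> sides V E e \<inter> S \<noteq> {}})" (is "open ?W")
proof (rule openI)
  fix p assume p: "p \<in> ?W"
  show "\<exists>r>0. ball p r \<subseteq> ?W"
  proof (cases "p \<in> \<Union>S")
    case True
    then obtain U where U: "U \<in> S" "p \<in> U" by blast
    then have "open U" using S(1) component_closure_subset(2)[OF compact_drawing[OF subset_refl]]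
      unfolding faces_def by blast
    then obtain r where "r > 0" "ball p r \<subseteq> U" using U open_contains_ball by blast
    then show ?thesis using U by blast
  next
    case False
    then obtain e where e: "e \<in> E - T" "sides V E e \<inter> S \<noteq> {}" "p \<in> e" "p \<notin> V" using p by blast
    then obtain r where r: "r > 0" "ball p r \<inter> (V \<union> \<Union>(E - {e})) = {}"
      "\<And>U. U \<in> faces V E \<Longrightarrow> U \<inter> ball p r \<noteq> {} \<Longrightarrow> U \<in> sides V E e"
      using sides_near[of e p] by blast
    have "q \<in> ?W" if q: "q \<in> ball p r" for q
    proof (cases "q \<in> e")
      case True
      then show ?thesis using e q r by blast
    next
      case False
      then have "q \<in> - (V \<union> \<Union>E)" using q r by blast
      then have "q \<in> \<Union>(faces V E)" unfolding faces_def Union_components .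
      then obtain U where U: "U \<in> faces V E" "q \<in> U" by blast
      then have "U \<in> sides V E e" using r(3) q by blast
      then show ?thesis using S(2)[OF e(1)] e(2) U by blast
    qed
    then show ?thesis using r(1) by blast
  qed
qed

text \<open>The complement of a drawn tree is connected. It is covered by the faces and the inner parts of the other
  edges, so these edges connect all faces by \<open>open_face_class\<close>. Euler's formula says that their
  number is right.\<close>

theorem dual_tree:
  assumes "T \<in> trees V (drawn_ends V) E"
  shows "E - T \<in> trees (faces V E) (sides V E) E"
proof -
  have T: "T \<subseteq> E" "spans V (drawn_ends V) T" "card T + 1 = card V" using assms by (auto simp: trees_def)
  have eu: "card (faces V E) + card V = card E + 2" using euler spans_mono T by blast
  have cE: "card E = card T + card (E - T)"
    using T(1) finE by (metis card_Diff_subset card_mono finite_subset le_add_diff_inverse)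
  obtain H where H: "components (- (V \<union> \<Union>T)) = {H}"
    using card_1_singletonE[OF faces_tree(2)[OF assms]] unfolding faces_def by metis
  then have "- (V \<union> \<Union>T) = H" using Union_components[of "- (V \<union> \<Union>T)"] by simp
  then have conn: "connected (- (V \<union> \<Union>T))" using H in_components_connected[of H "- (V \<union> \<Union>T)"] by simp
  have "spans (faces V E) (sides V E) (E - T)"
    unfolding spans_def
  proof (intro ballI)
    fix X Y assume XY: "X \<in> faces V E" "Y \<in> faces V E"
    define S where "S = {F \<in> faces V E. reach (sides V E) (E - T) X F}"
    have cl: "sides V E e \<subseteq> S \<or> sides V E e \<inter> S = {}" if e: "e \<in> E - T" for e
    proof -
      obtain U1 U2 where U: "U1 \<in> faces V E" "U2 \<in> faces V E" "sides V E e = {U1, U2}"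
        using sides_ex e by blast
      then have "reach (sides V E) (E - T) U1 U2" using e by (auto intro: reach_edge)
      then have "reach (sides V E) (E - T) X U1 \<longleftrightarrow> reach (sides V E) (E - T) X U2"
        by (meson reach_sym reach_trans)
      then show ?thesis using U unfolding S_def by auto
    qed
    then have cl': "sides V E e \<subseteq> faces V E - S \<or> sides V E e \<inter> (faces V E - S) = {}" if "e \<in> E - T" for e
      using that unfolding sides_def by blast
    define W where "W S = \<Union>S \<union> \<Union>{e - V |e. e \<in> E - T \<and> sides V E e \<inter> S \<noteq> {}}" for S
    have o: "open (W S)" "open (W (faces V E - S))"
      unfolding W_def by (rule open_face_class; use cl cl' in \<open>auto simp: S_def\<close>)+
    have off: "U \<inter> (V \<union> \<Union>E) = {}" if "U \<in> faces V E" for U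
      using that in_components_subset unfolding faces_def by blast
    have disj: "W S \<inter> W (faces V E - S) = {}"
    proof -
      have "z \<notin> W (faces V E - S)" if z: "z \<in> W S" for z
      proof (cases "z \<in> \<Union>S")
        case True
        then obtain U where U: "U \<in> S" "z \<in> U" by blast
        then have "z \<notin> V \<union> \<Union>E" using off unfolding S_def by blast
        then show ?thesis using U faces_disjoint unfolding W_def S_def by blast
      next
        case False
        then obtain e where e: "e \<in> E - T" "sides V E e \<inter> S \<noteq> {}" "z \<in> e - V"
          using z unfolding W_def by blast
        show ?thesis
        proof
          assume "z \<in> W (faces V E - S)"
          then consider U where "U \<in> faces V E" "z \<in> U" |
            f where "f \<in> E - T" "sides V E f \<inter> (faces V E - S) \<noteq> {}" "z \<in> f - V"
            unfolding W_def by blast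
          then show False
          proof cases
            case 1 then show False using off e by blast
          next
            case 2
            then have "f = e" using edges_meet[of e f] e by blast
            then show False using cl[OF e(1)] e 2 by blast
          qed
        qed
      qed
      then show ?thesis by blast
    qed
    have cov: "- (V \<union> \<Union>T) \<subseteq> W S \<union> W (faces V E - S)"
    proof
      fix z assume z: "z \<in> - (V \<union> \<Union>T)"
      show "z \<in> W S \<union> W (faces V E - S)"
      proof (cases "z \<in> \<Union>E")
        case True
        then obtain e where e: "e \<in> E - T" "z \<in> e - V" using z by blast
        have "e \<in> E" using e by blast
        from sides_ex[OF this] have "sides V E e \<noteq> {}" by force
        moreover have "sides V E e \<subseteq> faces V E" unfolding sides_def by blast
        ultimately have or: "sides V E e \<inter> S \<noteq> {} \<or> sides V E e \<inter> (faces V E - S) \<noteq> {}" by blast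
        have inW: "z \<in> W S'" if "sides V E e \<inter> S' \<noteq> {}" for S'
        proof -
          have "e - V \<in> {e - V |e. e \<in> E - T \<and> sides V E e \<inter> S' \<noteq> {}}" using e that by blast
          then have "z \<in> \<Union>{e - V |e. e \<in> E - T \<and> sides V E e \<inter> S' \<noteq> {}}" using e(2) by (rule UnionI)
          then show ?thesis unfolding W_def by (rule UnI2)
        qed
        show ?thesis using or inW[of S] inW[of "faces V E - S"] by (simp only: Un_iff) metis
      next
        case False
        then have "z \<in> \<Union>(faces V E)" using z unfolding faces_def Union_components by blast
        then have "z \<in> \<Union>S \<or> z \<in> \<Union>(faces V E - S)" by blast
        then show ?thesis unfolding W_def by (auto simp only: Un_iff)
      qed
    qed
    have sub: "W S' \<subseteq> - (V \<union> \<Union>T)" if "S' \<subseteq> faces V E" for S'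
    proof -
      have "e \<inter> f \<subseteq> V" if "e \<in> E - T" "f \<in> T" for e f
        using edges_meet[of e f] that T(1) by blast
      then have "(e - V) \<inter> (V \<union> \<Union>T) = {}" if "e \<in> E - T" for e using that by blast
      moreover have "U \<inter> (V \<union> \<Union>T) = {}" if "U \<in> S'" for U
        using off[of U] that \<open>S' \<subseteq> faces V E\<close> T(1) by blast
      ultimately show ?thesis unfolding W_def by blast
    qed
    have "X \<in> S" using XY by (simp add: S_def)
    then have "X \<subseteq> W S" "X \<noteq> {}" using faces_nonempty[OF XY(1)] unfolding W_def by blast+
    moreover have "W S \<subseteq> - (V \<union> \<Union>T)" by (rule sub) (auto simp: S_def)
    ultimately have "W S \<inter> - (V \<union> \<Union>T) \<noteq> {}" by blast
    then have "W (faces V E - S) \<inter> - (V \<union> \<Union>T) = {}"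
      using connectedD[OF conn o _ cov] disj by blast
    then have "W (faces V E - S) = {}" using sub[of "faces V E - S"] by blast
    then have "U = {}" if "U \<in> faces V E - S" for U using that unfolding W_def by blast
    then have "faces V E - S = {}" using faces_nonempty by blast
    then show "reach (sides V E) (E - T) X Y" using XY unfolding S_def by blast
  qed
  moreover have "card (E - T) + 1 = card (faces V E)" using eu cE T(3) by simp
  ultimately show ?thesis by (auto simp: trees_def)
qed

end

section \<open>The current matrix\<close>

text \<open>The orientation only serves to give signs to currents and potential differences. Kirchhoff's node law is not
  stated for single vertices, but by the pairing with all potential differences.\<close>

locale oriented_graph = fin_graph V d E for V :: "'v set" and d :: "'e \<Rightarrow> 'v set" and E :: "'e set" +
  fixes src tgt :: "'e \<Rightarrow> 'v"
  assumes spansE: "spans V d E"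
    and ori: "e \<in> E \<Longrightarrow> d e = {src e, tgt e}"
    and loopless: "e \<in> E \<Longrightarrow> src e \<noteq> tgt e"
begin

lemma src_V: "e \<in> E \<Longrightarrow> src e \<in> V" and tgt_V: "e \<in> E \<Longrightarrow> tgt e \<in> V"
  using ends_subset ori by blast+

definition diff :: "('v \<Rightarrow> int) \<Rightarrow> 'e \<Rightarrow> int" where
  "diff \<phi> e = \<phi> (src e) - \<phi> (tgt e)"

definition TT :: "'e set \<Rightarrow> 'e set set" where
  "TT S = {T \<in> trees V d E. S \<subseteq> T}"

lemma finite_TT [simp]: "finite (TT S)"
  using trees_finite by (simp add: TT_def)

definition tree_flow :: "'e set \<Rightarrow> 'v \<Rightarrow> 'v \<Rightarrow> 'e \<Rightarrow> int" where
  "tree_flow T x y e = (if e \<in> T then of_bool (reach d (T - {e}) x (src e)) -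
     of_bool (reach d (T - {e}) y (src e)) else 0)"

lemma tree_flow_self:
  assumes "T \<in> trees V d E" "e \<in> T"
  shows "tree_flow T (src e) (tgt e) e = 1"
proof -
  have "d e = {src e, tgt e}" using ori assms by (auto simp: trees_def)
  then have "\<not> reach d (T - {e}) (tgt e) (src e)"
    using tree_edge_split(1)[OF assms] reach_sym by metis
  then show ?thesis using assms by (simp add: tree_flow_def)
qed

lemma tree_flow_trans: "tree_flow T x y e + tree_flow T y z e = tree_flow T x z e"
  by (simp add: tree_flow_def)

lemma tree_flow_swap: "tree_flow T y x e = - tree_flow T x y e"
  by (simp add: tree_flow_def)

text \<open>Summation by parts along the tree: the potential difference between \<open>x\<close> and \<open>y\<close> is
  the sum over the edges of the path that joins them.\<close>

lemma tree_flow_pairing: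
  assumes T: "T \<in> trees V d E" and "x \<in> V" "y \<in> V"
  shows "(\<Sum>e\<in>E. tree_flow T x y e * diff \<phi> e) = \<phi> x - \<phi> y"
proof -
  have TE: "T \<subseteq> E" "spans V d T" using T by (auto simp: trees_def)
  have edge: "(\<Sum>e\<in>E. tree_flow T (src h) (tgt h) e * diff \<phi> e) = diff \<phi> h" if h: "h \<in> T" for h
  proof -
    have "tree_flow T (src h) (tgt h) e = of_bool (e = h)" for e
    proof (cases "e = h")
      case False
      show ?thesis
      proof (cases "e \<in> T")
        case True
        have "d h = {src h, tgt h}" using ori h TE by blast
        then have "reach d (T - {e}) (src h) (tgt h)" using h False by (intro reach_edge) auto
        then have "reach d (T - {e}) (src h) (src e) \<longleftrightarrow> reach d (T - {e}) (tgt h) (src e)"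
          unfolding reach_part by simp
        then show ?thesis using False by (simp add: tree_flow_def)
      qed (use False in \<open>simp add: tree_flow_def\<close>)
    qed (use tree_flow_self[OF T h] in simp)
    then have "(\<Sum>e\<in>E. tree_flow T (src h) (tgt h) e * diff \<phi> e) = (\<Sum>e\<in>E. if e = h then diff \<phi> h else 0)"
      by (intro sum.cong) (auto simp del: of_bool_eq_0_iff)
    then show ?thesis using h TE finE by auto
  qed
  have "reach d T x y" using TE assms by (auto simp: spans_def)
  then show ?thesis
  proof (induction rule: reach_induct)
    case refl
    then show ?case by (auto simp: tree_flow_def intro!: sum.neutral)
  next
    case (step y z h)
    have "d h = {src h, tgt h}" using ori step TE by blast
    then have "y = src h \<and> z = tgt h \<or> y = tgt h \<and> z = src h"
      using step by (auto simp: doubleton_eq_iff)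
    then have "(\<Sum>e\<in>E. tree_flow T y z e * diff \<phi> e) = \<phi> y - \<phi> z"
    proof
      assume "y = tgt h \<and> z = src h"
      then have "(\<Sum>e\<in>E. tree_flow T y z e * diff \<phi> e) = - (\<Sum>e\<in>E. tree_flow T (src h) (tgt h) e * diff \<phi> e)"
        using tree_flow_swap[of T "src h" "tgt h"] by (simp add: sum_negf[symmetric])
      then show ?thesis using edge[OF \<open>h \<in> T\<close>] \<open>y = tgt h \<and> z = src h\<close> by (simp add: diff_def)
    qed (use edge[OF \<open>h \<in> T\<close>] in \<open>simp add: diff_def\<close>)
    then have "(\<Sum>e\<in>E. (tree_flow T x y e + tree_flow T y z e) * diff \<phi> e) = \<phi> x - \<phi> z"
      using step.IH by (simp add: algebra_simps sum.distrib)
    then show ?case by (simp add: tree_flow_trans)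
  qed
qed

text \<open>The sum of the unit flows along all trees that contain \<open>S\<close>. By Kirchhoff's theorem this is the
  electrical current, up to normalization.\<close>

definition current :: "'e set \<Rightarrow> 'e \<Rightarrow> 'e \<Rightarrow> int" where
  "current S f e = (\<Sum>T\<in>TT S. tree_flow T (src f) (tgt f) e)"

lemma current_pairing:
  assumes "f \<in> E"
  shows "(\<Sum>e\<in>E. current S f e * diff \<phi> e) = int (card (TT S)) * diff \<phi> f"
proof -
  have "(\<Sum>e\<in>E. current S f e * diff \<phi> e) = (\<Sum>T\<in>TT S. \<Sum>e\<in>E. tree_flow T (src f) (tgt f) e * diff \<phi> e)"
    unfolding current_def by (simp add: sum_distrib_right) (rule sum.swap)
  also have "\<dots> = (\<Sum>T\<in>TT S. diff \<phi> f)"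
    using tree_flow_pairing src_V[OF assms] tgt_V[OF assms] by (simp add: TT_def diff_def)
  finally show ?thesis by simp
qed

lemma current_self:
  assumes "f \<in> E"
  shows "current S f f = int (card (TT (insert f S)))"
proof -
  have "tree_flow T (src f) (tgt f) f = of_bool (f \<in> T)" if "T \<in> TT S" for T
    using that tree_flow_self[of T f] by (auto simp: TT_def tree_flow_def)
  then have "current S f f = (\<Sum>T\<in>TT S. of_bool (f \<in> T))" unfolding current_def by simp
  also have "\<dots> = int (card (TT S \<inter> {T. f \<in> T}))" by simp
  also have "TT S \<inter> {T. f \<in> T} = TT (insert f S)" by (auto simp: TT_def)
  finally show ?thesis .
qed

text \<open>Removing an edge \<open>e\<close> from the trees through \<open>e\<close> gives the forests with two components that \<open>e\<close>
  joins. The potential of a vertex counts the forests that separate the ends of \<open>f\<close> and have this vertex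
  on the side of the first end.\<close>

lemma current_potential:
  assumes "f \<in> E"
  shows "\<exists>\<psi>. (\<forall>e\<in>E - S. current S f e = diff \<psi> e) \<and> (\<forall>e\<in>E \<inter> S. diff \<psi> e = 0)"
proof -
  define FF where "FF = {T - {h} |T h. T \<in> TT S \<and> h \<in> T - S}"
  have finFF: "finite FF"
    by (rule finite_subset[of _ "Pow E"]) (auto simp: FF_def TT_def trees_def finE)
  define \<psi> where "\<psi> y = (\<Sum>F\<in>FF. of_bool (reach d F (src f) y \<and> \<not> reach d F (src f) (tgt f)) :: int)" for y
  have "current S f e = diff \<psi> e" if e: "e \<in> E - S" for e
  proof -
    have ends: "d e = {src e, tgt e}" using ori e by blast
    define Fe where "Fe = {F \<in> FF. \<not> reach d F (src e) (tgt e)}"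
    have bij: "bij_betw (\<lambda>T. T - {e}) {T \<in> TT S. e \<in> T} Fe"
    proof (rule bij_betwI[where g = "insert e"])
      show "(\<lambda>T. T - {e}) \<in> {T \<in> TT S. e \<in> T} \<rightarrow> Fe"
        using e tree_edge_split(1) ends unfolding Fe_def FF_def TT_def by blast
      show "insert e \<in> Fe \<rightarrow> {T \<in> TT S. e \<in> T}"
      proof
        fix F assume "F \<in> Fe"
        then obtain T h where T: "F = T - {h}" "T \<in> TT S" "h \<in> T - S" "\<not> reach d (T - {h}) (src e) (tgt e)"
          unfolding Fe_def FF_def by blast
        then have "insert e F \<in> trees V d E"
          using tree_exchange[of T h e "src e" "tgt e"] e ends by (auto simp: TT_def)
        then show "insert e F \<in> {T \<in> TT S. e \<in> T}" using T by (auto simp: TT_def)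
      qed
      show "insert e (T - {e}) = T" if "T \<in> {T \<in> TT S. e \<in> T}" for T using that by auto
      show "insert e F - {e} = F" if "F \<in> Fe" for F
        using that reach_edge[where d = d, OF _ ends] unfolding Fe_def by auto
    qed
    let ?c = "\<lambda>F. of_bool (reach d F (src f) (src e)) - of_bool (reach d F (tgt f) (src e)) :: int"
    let ?p = "\<lambda>F y. of_bool (reach d F (src f) y \<and> \<not> reach d F (src f) (tgt f)) :: int"
    have "current S f e = (\<Sum>T\<in>{T \<in> TT S. e \<in> T}. ?c (T - {e}))"
      unfolding current_def by (rule sum.mono_neutral_cong_right) (auto simp: tree_flow_def)
    also have "\<dots> = (\<Sum>F\<in>Fe. ?c F)" by (rule sum.reindex_bij_betw[OF bij])
    also have "\<dots> = (\<Sum>F\<in>FF. ?p F (src e) - ?p F (tgt e))"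
    proof (rule sum.mono_neutral_cong_left)
      show "\<forall>F\<in>FF - Fe. ?p F (src e) - ?p F (tgt e) = 0"
        unfolding Fe_def reach_part by simp
      show "?c F = ?p F (src e) - ?p F (tgt e)" if F: "F \<in> Fe" for F
      proof -
        obtain T h where T: "F = T - {h}" "T \<in> TT S" "h \<in> T"
          and sep: "\<not> reach d F (src e) (tgt e)"
          using F unfolding Fe_def FF_def by blast
        have TT: "T \<in> trees V d E" and hE: "h \<in> E" using T by (auto simp: TT_def trees_def)
        have two: "reach d F (src h) x \<or> reach d F (tgt h) x" if "x \<in> V" for x
          using tree_edge_split(2)[OF TT T(3) ori[OF hE] that] T(1) by simp
        show ?thesis
        proof -
          define P where "P = part d F"
          have eE: "e \<in> E" using e by blast
          note R = reach_part[where d = d and A = F, folded P_def]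
          have "P (src f) = P (src e) \<or> P (src f) = P (tgt e)" "P (tgt f) = P (src e) \<or> P (tgt f) = P (tgt e)"
            using two[OF src_V[OF eE]] two[OF tgt_V[OF eE]] two[OF src_V[OF assms]] two[OF tgt_V[OF assms]] sep
            unfolding R by metis+
          then show ?thesis using sep unfolding R by (elim disjE) simp_all
        qed
      qed
    qed (auto simp: Fe_def finFF)
    also have "\<dots> = diff \<psi> e" by (simp add: \<psi>_def diff_def sum_subtractf)
    finally show ?thesis .
  qed
  moreover have "diff \<psi> e = 0" if e: "e \<in> E \<inter> S" for e
  proof -
    have "reach d F (src e) (tgt e)" if "F \<in> FF" for F
      using that e ori[of e] unfolding FF_def TT_def by (intro reach_edge[of e]) auto
    then have "\<psi> (src e) = \<psi> (tgt e)"
      unfolding \<psi>_def reach_part by (intro sum.cong) auto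
    then show ?thesis by (simp add: diff_def)
  qed
  ultimately show ?thesis by blast
qed

definition J :: "'e \<Rightarrow> 'e \<Rightarrow> int" where "J = current {}"
definition \<tau> :: int where "\<tau> = int (card (TT {}))"
definition tc :: "'e set \<Rightarrow> int" where "tc S = int (card (TT S))"

text \<open>The potential exists by \<open>current_potential\<close>.\<close>

definition pot :: "'e \<Rightarrow> 'v \<Rightarrow> int" where "pot f = (SOME \<psi>. \<forall>e\<in>E. J f e = diff \<psi> e)"

lemma J_pot: "f \<in> E \<Longrightarrow> e \<in> E \<Longrightarrow> J f e = diff (pot f) e"
proof -
  assume f: "f \<in> E" "e \<in> E"
  obtain \<psi> where "\<forall>e\<in>E. current {} f e = diff \<psi> e"
    using current_potential[OF f(1), of "{}"] by auto
  then have "\<exists>\<psi>. \<forall>e\<in>E. J f e = diff \<psi> e" unfolding J_def by blast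
  then have "\<forall>e\<in>E. J f e = diff (pot f) e" unfolding pot_def by (rule someI_ex)
  then show ?thesis using f by blast
qed

lemma J_pairing: "f \<in> E \<Longrightarrow> (\<Sum>e\<in>E. J f e * diff \<phi> e) = \<tau> * diff \<phi> f"
  unfolding J_def \<tau>_def by (rule current_pairing)

lemma J_self: "f \<in> E \<Longrightarrow> J f f = tc {f}"
  by (simp add: J_def current_self tc_def)

lemma \<tau>_pos: "\<tau> > 0"
  using trees_nonempty[OF spansE] trees_finite by (simp add: \<tau>_def TT_def card_gt_0_iff)

text \<open>Reciprocity: the pairing of a current with the potential of another one is computed in both ways.\<close>

lemma J_sym: "f \<in> E \<Longrightarrow> g \<in> E \<Longrightarrow> J f g = J g f"
proof -
  assume f: "f \<in> E" "g \<in> E"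
  have "\<tau> * diff (pot g) f = (\<Sum>e\<in>E. J f e * J g e)"
    using J_pairing[OF f(1), of "pot g"] J_pot[OF f(2)] by simp
  also have "\<dots> = (\<Sum>e\<in>E. J g e * J f e)" by (simp add: mult.commute)
  also have "\<dots> = \<tau> * diff (pot f) g" using J_pairing[OF f(2), of "pot f"] J_pot[OF f(1)] by simp
  finally show ?thesis using \<tau>_pos J_pot f by simp
qed

text \<open>The currents of the contraction of \<open>S\<close>, compared with those of the whole graph. For small \<open>S\<close> these
  equations express the numbers of trees through \<open>S\<close> by minors of \<open>J\<close>.\<close>

lemma contraction:
  assumes f: "f \<in> E" and S: "S \<subseteq> E" "f \<notin> S"
  shows "\<exists>z. (\<forall>k\<in>S. (\<Sum>s\<in>S. z s * J k s) = tc S * J k f) \<and>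
    (\<Sum>s\<in>S. z s * J f s) + \<tau> * tc (insert f S) = tc S * J f f"
proof -
  obtain \<psi> where \<psi>: "\<And>e. e \<in> E - S \<Longrightarrow> current S f e = diff \<psi> e" "\<And>e. e \<in> E \<inter> S \<Longrightarrow> diff \<psi> e = 0"
    using current_potential[OF f, of S] by blast
  have *: "(\<Sum>s\<in>S. current S f s * J k s) + \<tau> * diff \<psi> k = tc S * J k f" if k: "k \<in> E" for k
  proof -
    have "tc S * J k f = (\<Sum>e\<in>E. current S f e * J k e)"
      using current_pairing[OF f, of S "pot k"] J_pot[OF k] f by (simp add: tc_def)
    also have "\<dots> = (\<Sum>e\<in>E - S. current S f e * J k e) + (\<Sum>e\<in>S. current S f e * J k e)"
      using sum.subset_diff[OF S(1) finE] by simp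
    also have "(\<Sum>e\<in>E - S. current S f e * J k e) = (\<Sum>e\<in>E. J k e * diff \<psi> e)"
      using \<psi> S(1) finE by (intro sum.mono_neutral_cong_left) (auto simp: mult.commute)
    finally show ?thesis using J_pairing[OF k, of \<psi>] by simp
  qed
  show ?thesis
  proof (intro exI[of _ "current S f"] conjI ballI)
    show "(\<Sum>s\<in>S. current S f s * J k s) = tc S * J k f" if "k \<in> S" for k
      using *[of k] \<psi>(2)[of k] that S by auto
    have "diff \<psi> f = tc (insert f S)" using \<psi>(1)[of f] f S current_self[OF f, of S] by (simp add: tc_def)
    then show "(\<Sum>s\<in>S. current S f s * J f s) + \<tau> * tc (insert f S) = tc S * J f f"
      using *[OF f] by simp
  qed
qed

lemma tc_pos: "f \<in> E \<Longrightarrow> tc {f} > 0"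
proof (rule ccontr)
  assume f: "f \<in> E" and "\<not> tc {f} > 0"
  then have "J f f = 0" by (simp add: J_self tc_def)
  moreover have "(\<Sum>e\<in>E. J f e * J f e) = \<tau> * J f f"
    using J_pairing[OF f, of "pot f"] J_pot[OF f] f by simp
  ultimately have "\<forall>e\<in>E. J f e * J f e = 0"
    using sum_nonneg_eq_0_iff[OF finE, of "\<lambda>e. J f e * J f e"] by simp
  then have "(\<Sum>e\<in>E. J f e * diff (\<lambda>v. of_bool (v = src f)) e) = 0" by (simp add: sum.neutral)
  then show False using J_pairing[OF f, of "\<lambda>v. of_bool (v = src f)"] \<tau>_pos loopless[OF f]
    by (simp add: diff_def)
qed

text \<open>The determinant of the submatrix of \<open>J\<close> for two edges counts the trees through both.\<close>

lemma two_edges: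
  assumes "e \<in> E" "f \<in> E" "e \<noteq> f"
  shows "\<tau> * tc {e, f} = tc {e} * tc {f} - (J e f)\<^sup>2"
proof -
  obtain z where z: "z e * J e e = tc {e} * J e f" "z e * J f e + \<tau> * tc {f, e} = tc {e} * J f f"
    using contraction[of f "{e}"] assms by auto
  have "tc {e} \<noteq> 0" using tc_pos[OF assms(1)] by simp
  then have "z e = J e f" using z(1) J_self[OF assms(1)] by simp
  then show ?thesis using z(2) J_self[OF assms(2)] J_sym assms
    by (simp add: power2_eq_square insert_commute)
qed


lemma three_edges:
  assumes "e \<in> E" "f \<in> E" "g \<in> E" "e \<noteq> f" "g \<noteq> e" "g \<noteq> f" "tc {e, f} \<noteq> 0"
  shows "\<tau>\<^sup>2 * tc {e, f, g} = J e e * J f f * J g g + 2 * J e f * J f g * J e g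
    - J e e * (J f g)\<^sup>2 - J f f * (J e g)\<^sup>2 - J g g * (J e f)\<^sup>2"
proof -
  let ?T = "tc {e, f}"
  obtain z where z: "z e * J e e + z f * J e f = ?T * J e g" "z e * J f e + z f * J f f = ?T * J f g"
    "z e * J g e + z f * J g f + \<tau> * tc {g, e, f} = ?T * J g g"
    using contraction[of g "{e, f}"] assms by auto
  have sym: "J f e = J e f" "J g e = J e g" "J g f = J f g" using J_sym assms by blast+
  have D: "\<tau> * ?T = J e e * J f f - (J e f)\<^sup>2" using two_edges[of e f] J_self assms by simp
  have "z e * (J e e * J f f - (J e f)\<^sup>2) = ?T * (J e g * J f f - J f g * J e f)"
  proof -
    have "z e * (J e e * J f f - (J e f)\<^sup>2) =
      (z e * J e e + z f * J e f) * J f f - (z e * J f e + z f * J f f) * J e f"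
      by (simp add: sym algebra_simps power2_eq_square)
    then show ?thesis unfolding z by (simp add: algebra_simps)
  qed
  then have "?T * (z e * \<tau>) = ?T * (J e g * J f f - J f g * J e f)"
    unfolding D[symmetric] by (simp add: mult_ac)
  then have ze: "z e * \<tau> = J e g * J f f - J f g * J e f" using assms(7) by simp
  have "z f * (J e e * J f f - (J e f)\<^sup>2) = ?T * (J e e * J f g - J e f * J e g)"
  proof -
    have "z f * (J e e * J f f - (J e f)\<^sup>2) =
      (z e * J f e + z f * J f f) * J e e - (z e * J e e + z f * J e f) * J e f"
      by (simp add: sym algebra_simps power2_eq_square)
    then show ?thesis unfolding z by (simp add: algebra_simps)
  qed
  then have "?T * (z f * \<tau>) = ?T * (J e e * J f g - J e f * J e g)"
    unfolding D[symmetric] by (simp add: mult_ac)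
  then have zf: "z f * \<tau> = J e e * J f g - J e f * J e g" using assms(7) by simp
  have "{g, e, f} = {e, f, g}" by auto
  then have "\<tau>\<^sup>2 * tc {e, f, g} = \<tau> * (\<tau> * tc {g, e, f})" by (simp add: power2_eq_square)
  also have "\<dots> = \<tau> * (?T * J g g - z e * J e g - z f * J f g)" using z(3) sym by simp
  also have "\<dots> = (\<tau> * ?T) * J g g - (z e * \<tau>) * J e g - (z f * \<tau>) * J f g"
    by (simp add: algebra_simps)
  finally show ?thesis unfolding D ze zf by (simp add: algebra_simps power2_eq_square)
qed

text \<open>Any edge of a tree can be exchanged unless it lies in all trees. So a set of edges that lies in
  only one tree is that tree.\<close>

lemma unique_tree:
  assumes "tc S = 1" "\<And>e. e \<in> E \<Longrightarrow> tc {e} < \<tau>"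
  shows "card S + 1 = card V"
proof -
  have "card (TT S) = 1" using assms(1) by (simp add: tc_def)
  then obtain T where T: "TT S = {T}" by (rule card_1_singletonE)
  then have TT: "T \<in> trees V d E" "S \<subseteq> T" by (auto simp: TT_def)
  have "T \<subseteq> S"
  proof (rule ccontr)
    assume "\<not> T \<subseteq> S"
    then obtain g where g: "g \<in> T" "g \<notin> S" by blast
    have gE: "g \<in> E" using g TT by (auto simp: trees_def)
    have "TT {g} \<noteq> TT {}" using assms(2)[OF gE] by (auto simp: tc_def \<tau>_def)
    then obtain T' where T': "T' \<in> trees V d E" "g \<notin> T'" by (auto simp: TT_def)
    obtain a b where ab: "d g = {a, b}" "a \<in> V" "b \<in> V" using ends_ex[OF gE] by blast
    have "reach d T' a b" using T' ab by (auto simp: trees_def spans_def)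
    moreover have "\<not> reach d (T - {g}) a b" by (rule tree_edge_split(1)[OF TT(1) g(1) ab(1)])
    ultimately have "\<exists>h x y. h \<in> T' \<and> d h = {x, y} \<and> \<not> reach d (T - {g}) x y"
      using reach_subst[where d = d and A = T' and d' = d and B = "T - {g}" and x = a and y = b] by blast
    then obtain h x y where h: "h \<in> T'" "d h = {x, y}" "\<not> reach d (T - {g}) x y" by blast
    have "h \<in> E" using h T' by (auto simp: trees_def)
    then have "insert h (T - {g}) \<in> trees V d E" by (rule tree_exchange[OF TT(1) g(1) _ h(2,3)])
    then have "insert h (T - {g}) \<in> TT S" using TT g by (auto simp: TT_def)
    then have "insert h (T - {g}) = T" using T by simp
    then have "g = h" using g(1) by (metis Diff_iff insertE singletonI)
    then show False using h(1) T'(2) by simp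
  qed
  then show ?thesis using TT by (auto simp: trees_def)
qed

end

section \<open>Integral levels\<close>

text \<open>The data that a self-dual graph without cut vertex leaves in abstract terms, for a square
  \<open>\<tau> = p\<^sup>2\<close>. The last condition on \<open>p\<close> holds for the primes of the form \<open>4 * k + 3\<close>.\<close>

locale square_graph = oriented_graph V d E src tgt
  for V :: "'v set" and d :: "'e \<Rightarrow> 'v set" and E src tgt +
  fixes p :: int and \<sigma> :: "'e \<Rightarrow> 'e"
  assumes no_cut: "v \<in> V \<Longrightarrow> spans (V - {v}) d {e \<in> E. v \<notin> d e}"
    and cardE: "card E + 2 = 2 * card V"
    and \<tau>: "\<tau> = p\<^sup>2"
    and p: "p > 1" "odd p" "\<And>x y :: int. p dvd x\<^sup>2 + y\<^sup>2 \<Longrightarrow> p dvd x"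
    and \<sigma>E: "e \<in> E \<Longrightarrow> \<sigma> e \<in> E"
    and tc\<sigma>: "e \<in> E \<Longrightarrow> tc {\<sigma> e} = \<tau> - tc {e}"
begin

text \<open>The formula for two edges, applied to \<open>e\<close> and \<open>\<sigma> e\<close>, makes the sum of the
  squares of \<open>J e e\<close> and \<open>J e (\<sigma> e)\<close> divisible by \<open>p\<close>.\<close>

lemma p_dvd_tc: "e \<in> E \<Longrightarrow> p dvd tc {e}"
proof -
  assume e: "e \<in> E"
  have ne: "\<sigma> e \<noteq> e"
  proof
    assume "\<sigma> e = e"
    then have "2 * tc {e} = p\<^sup>2" using tc\<sigma>[OF e] \<tau> by simp
    then have "even (p\<^sup>2)" by (metis dvd_triv_left)
    then show False using p(2) by simp
  qed
  have "\<tau> * tc {e, \<sigma> e} = tc {e} * (\<tau> - tc {e}) - (J e (\<sigma> e))\<^sup>2"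
    using two_edges[OF e \<sigma>E[OF e]] ne tc\<sigma>[OF e] by simp
  then have "(tc {e})\<^sup>2 + (J e (\<sigma> e))\<^sup>2 = p * (p * (tc {e} - tc {e, \<sigma> e}))"
    unfolding \<tau> by (simp add: algebra_simps power2_eq_square)
  then show ?thesis using p(3) by (metis dvd_triv_left)
qed

text \<open>The transfer currents in units of \<open>p\<close>; the division is exact by \<open>J_N\<close>.\<close>

definition N :: "'e \<Rightarrow> 'e \<Rightarrow> int" where "N e f = J e f div p"

abbreviation t :: "'e \<Rightarrow> int" where "t e \<equiv> N e e"

lemma J_N: "e \<in> E \<Longrightarrow> f \<in> E \<Longrightarrow> J e f = p * N e f"
proof -
  assume e: "e \<in> E" "f \<in> E"
  have "p dvd J e f"
  proof (cases "e = f")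
    case True
    then show ?thesis using J_self p_dvd_tc e by simp
  next
    case False
    obtain a b where "tc {e} = p * a" "tc {f} = p * b" using p_dvd_tc e by (meson dvdE)
    then have "(J e f)\<^sup>2 + 0\<^sup>2 = p * (p * (a * b - tc {e, f}))"
      using two_edges[OF e False] unfolding \<tau> by (simp add: algebra_simps power2_eq_square)
    then show ?thesis using p(3)[of "J e f" 0] by (metis dvd_triv_left)
  qed
  then show ?thesis by (simp add: N_def)
qed

lemma tc_t: "e \<in> E \<Longrightarrow> tc {e} = p * t e"
  using J_self J_N by simp

lemma t_pos: "e \<in> E \<Longrightarrow> t e > 0"
  using tc_pos[of e] tc_t[of e] p(1) by (simp add: zero_less_mult_iff)

lemma t_\<sigma>: "e \<in> E \<Longrightarrow> t (\<sigma> e) = p - t e"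
proof -
  assume e: "e \<in> E"
  have "p * t (\<sigma> e) = p * (p - t e)"
    using tc\<sigma>[OF e] tc_t[OF e] tc_t[OF \<sigma>E[OF e]] \<tau> by (simp add: algebra_simps power2_eq_square)
  then show ?thesis using p(1) by simp
qed

lemma tc_less: "e \<in> E \<Longrightarrow> tc {e} < \<tau>"
  using tc_pos[OF \<sigma>E] tc\<sigma> by fastforce

lemma N_sym: "e \<in> E \<Longrightarrow> f \<in> E \<Longrightarrow> N e f = N f e"
  using J_sym by (simp add: N_def)

lemma two_N: "e \<in> E \<Longrightarrow> f \<in> E \<Longrightarrow> e \<noteq> f \<Longrightarrow> tc {e, f} = t e * t f - (N e f)\<^sup>2"
proof -
  assume e: "e \<in> E" "f \<in> E" "e \<noteq> f"
  have "p\<^sup>2 * tc {e, f} = p\<^sup>2 * (t e * t f - (N e f)\<^sup>2)"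
    using two_edges[OF e] tc_t e J_N[OF e(1,2)] \<tau> by (simp add: algebra_simps power2_eq_square)
  then show ?thesis using p(1) by simp
qed

lemma three_N:
  assumes "e \<in> E" "f \<in> E" "g \<in> E" "e \<noteq> f" "g \<noteq> e" "g \<noteq> f" "tc {e, f} \<noteq> 0"
  shows "p * tc {e, f, g} = t e * t f * t g + 2 * N e f * N f g * N e g
    - t e * (N f g)\<^sup>2 - t f * (N e g)\<^sup>2 - t g * (N e f)\<^sup>2"
proof -
  have "p ^ 3 * (p * tc {e, f, g}) = p ^ 3 * (t e * t f * t g + 2 * N e f * N f g * N e g
    - t e * (N f g)\<^sup>2 - t f * (N e g)\<^sup>2 - t g * (N e f)\<^sup>2)"
    using three_edges[OF assms] J_N assms \<tau>
    by (simp add: algebra_simps power2_eq_square power3_eq_cube)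
  then show ?thesis using p(1) by simp
qed

definition sg :: "'v \<Rightarrow> 'e \<Rightarrow> int" where "sg u e = (if src e = u then 1 else - 1)"
definition drop :: "('v \<Rightarrow> int) \<Rightarrow> 'v \<Rightarrow> 'e \<Rightarrow> int" where "drop \<phi> u e = sg u e * diff \<phi> e"
definition star :: "'v \<Rightarrow> 'e set" where "star u = {e \<in> E. u \<in> d e}"

lemma sg_sg [simp]: "sg u e * sg u e = 1" "(sg u e)\<^sup>2 = 1"
  by (auto simp: sg_def)

lemma finite_star [simp]: "finite (star u)"
  using finE by (simp add: star_def)

lemma star_E: "e \<in> star u \<Longrightarrow> e \<in> E"
  by (simp add: star_def)

lemma star_other: "e \<in> star u \<Longrightarrow> \<exists>w\<in>V. d e = {u, w} \<and> w \<noteq> u"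
proof -
  assume "e \<in> star u"
  then have e: "e \<in> E" "u = src e \<or> u = tgt e" using ori[of e] by (auto simp: star_def)
  show ?thesis
  proof (cases "u = src e")
    case True
    then show ?thesis using ori[OF e(1)] loopless[OF e(1)] tgt_V[OF e(1)] by metis
  next
    case False
    then show ?thesis using e ori[OF e(1)] loopless[OF e(1)] src_V[OF e(1)] by (metis insert_commute)
  qed
qed

lemma drop_eq: "e \<in> E \<Longrightarrow> d e = {u, w} \<Longrightarrow> drop \<phi> u e = \<phi> u - \<phi> w"
  using ori[of e] loopless[of e] by (auto simp: drop_def sg_def diff_def doubleton_eq_iff)

lemma drop_square: "(drop \<phi> u e)\<^sup>2 = (diff \<phi> e)\<^sup>2"
  by (simp add: drop_def power_mult_distrib)

lemma sum_star: "(\<Sum>e\<in>E. diff \<phi> e * diff (\<lambda>v. of_bool (v = y)) e) = (\<Sum>e\<in>star y. drop \<phi> y e)"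
proof -
  have "diff \<phi> e * diff (\<lambda>v. of_bool (v = y)) e = (if e \<in> star y then drop \<phi> y e else 0)" if "e \<in> E" for e
    using ori[OF that] loopless[OF that] that by (auto simp: drop_def sg_def diff_def star_def)
  then have "(\<Sum>e\<in>E. diff \<phi> e * diff (\<lambda>v. of_bool (v = y)) e) = (\<Sum>e\<in>E. if e \<in> star y then drop \<phi> y e else 0)"
    by (intro sum.cong) auto
  also have "\<dots> = (\<Sum>e\<in>star y. drop \<phi> y e)"
    using finE by (simp add: sum.inter_filter[symmetric] star_def)
  finally show ?thesis .
qed

text \<open>The integral potential of a current of \<open>p\<close> that enters at \<open>u\<close> and leaves at
  \<open>v\<close>, normalized to 0 at \<open>v\<close>.\<close>

definition level :: "('v \<Rightarrow> int) \<Rightarrow> 'e \<Rightarrow> 'v \<Rightarrow> 'v \<Rightarrow> bool" where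
  "level l e u v \<longleftrightarrow> e \<in> E \<and> d e = {u, v} \<and> u \<noteq> v \<and> l v = 0 \<and> l u = t e \<and>
     (\<forall>g\<in>E. drop l u g = sg u g * sg u e * N e g) \<and>
     (\<forall>\<phi>. (\<Sum>g\<in>E. diff l g * diff \<phi> g) = p * (\<phi> u - \<phi> v)) \<and>
     (\<forall>y\<in>V - {u, v}. 0 < l y \<and> l y < t e)"

text \<open>A harmonic function has no other vertex on its top level, since no vertex cuts these vertices off
  from the lower end.\<close>

lemma max_principle:
  assumes uv: "u \<in> V" "v \<in> V" "u \<noteq> v" "l v < l u"
    and harm: "\<And>\<phi>. (\<Sum>g\<in>E. diff l g * diff \<phi> g) = c * (\<phi> u - \<phi> v)"
    and y: "y \<in> V - {u}"
  shows "l y < l u"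
proof (rule ccontr)
  assume ly: "\<not> l y < l u"
  define m where "m = Max (l ` (V - {u}))"
  have fin: "finite (l ` (V - {u}))" "l ` (V - {u}) \<noteq> {}" using finV y by auto
  have le: "l x \<le> m" if "x \<in> V - {u}" for x unfolding m_def using fin that by (intro Max_ge) auto
  have mu: "l u \<le> m" using le[OF y] ly by simp
  have le': "l x \<le> m" if "x \<in> V" for x using le[of x] mu that by (cases "x = u") auto
  obtain y0 where y0: "y0 \<in> V - {u}" "l y0 = m" using Max_in[OF fin] unfolding m_def by (metis imageE)
  define S where "S = {x \<in> V - {u}. l x = m}"
  have nb: "l w = m" if x: "x \<in> S" and g: "g \<in> E" "d g = {x, w}" for x w g
  proof -
    have xuv: "x \<noteq> u" "x \<noteq> v" "x \<in> V" "l x = m" using x uv mu by (auto simp: S_def)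
    have "(\<Sum>e\<in>star x. drop l x e) = 0"
      using harm[of "\<lambda>v. of_bool (v = x)"] xuv by (simp add: sum_star)
    moreover have "drop l x e \<ge> 0" if "e \<in> star x" for e
    proof -
      from star_other[OF that] obtain w where "w \<in> V" "d e = {x, w}" by auto
      then show ?thesis using drop_eq[OF star_E[OF that]] le' xuv by simp
    qed
    ultimately have "\<forall>e\<in>star x. drop l x e = 0" by (subst (asm) sum_nonneg_eq_0_iff) auto
    moreover have "g \<in> star x" using g by (auto simp: star_def)
    ultimately show ?thesis using drop_eq[OF g, of l] xuv by simp
  qed
  have "reach d {e \<in> E. u \<notin> d e} y0 v" using no_cut[OF uv(1)] y0 uv by (auto simp: spans_def)
  then have "v \<in> S"
  proof (rule reach_closed)
    show "y0 \<in> S" using y0 by (simp add: S_def)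
    show "b \<in> S" if "e \<in> {e \<in> E. u \<notin> d e}" "d e = {a, b}" "a \<in> S" for e a b
      using nb[of a e b] that ends_subset[of e] by (auto simp: S_def)
  qed
  then show False using mu uv by (simp add: S_def)
qed

text \<open>Potential differences along edges are entries of \<open>J\<close>, which are divisible by \<open>p\<close>.
  As the graph is connected, so are all potential differences.\<close>

lemma level_exists:
  assumes e: "e \<in> E" "d e = {u, v}"
  obtains l where "level l e u v"
proof -
  have uv: "{u, v} = {src e, tgt e}" "u \<noteq> v" "u \<in> V" "v \<in> V"
  proof -
    show 1: "{u, v} = {src e, tgt e}" using ori[OF e(1)] e(2) by simp
    then have "u = src e \<and> v = tgt e \<or> u = tgt e \<and> v = src e" by (simp add: doubleton_eq_iff)
    then show "u \<noteq> v" "u \<in> V" "v \<in> V"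
      using loopless[OF e(1)] src_V[OF e(1)] tgt_V[OF e(1)] by (elim disjE; simp)+
  qed
  define l where "l y = sg u e * ((pot e y - pot e v) div p)" for y
  have pd: "p dvd pot e y - pot e v" if "y \<in> V" for y
  proof -
    have "reach d E v y" using spansE uv that by (auto simp: spans_def)
    then show ?thesis
    proof (induction rule: reach_induct)
      case (step y z g)
      have "p dvd diff (pot e) g" using J_pot[OF e(1) \<open>g \<in> E\<close>] J_N[OF e(1) \<open>g \<in> E\<close>] by (metis dvd_triv_left)
      moreover have "pot e z - pot e y = diff (pot e) g \<or> pot e z - pot e y = - diff (pot e) g"
        using ori[OF \<open>g \<in> E\<close>] \<open>d g = {y, z}\<close> by (auto simp: diff_def doubleton_eq_iff)
      ultimately have "p dvd (pot e z - pot e y) + (pot e y - pot e v)"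
        using step.IH by (metis dvd_add dvd_minus_iff)
      then show ?case by simp
    qed simp
  qed
  have pl: "p * l y = sg u e * (pot e y - pot e v)" if "y \<in> V" for y
    using pd[OF that] by (auto simp: l_def sg_def)
  have dl: "diff l g = sg u e * N e g" if g: "g \<in> E" for g
  proof -
    have "p * diff l g = sg u e * diff (pot e) g"
      using pl[OF src_V[OF g]] pl[OF tgt_V[OF g]] by (simp add: diff_def algebra_simps)
    also have "\<dots> = p * (sg u e * N e g)" using J_pot[OF e(1) g] J_N[OF e(1) g] by simp
    finally show ?thesis using p(1) by simp
  qed
  have harm: "(\<Sum>g\<in>E. diff l g * diff \<phi> g) = p * (\<phi> u - \<phi> v)" for \<phi>
  proof -
    have "p * (\<Sum>g\<in>E. diff l g * diff \<phi> g) = sg u e * (\<Sum>g\<in>E. J e g * diff \<phi> g)"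
      unfolding sum_distrib_left using dl J_N[OF e(1)] by (intro sum.cong) auto
    also have "\<dots> = p * (p * (sg u e * diff \<phi> e))"
      using J_pairing[OF e(1), of \<phi>] \<tau> by (simp add: power2_eq_square)
    also have "sg u e * diff \<phi> e = \<phi> u - \<phi> v"
      using uv by (auto simp: sg_def diff_def doubleton_eq_iff)
    finally show ?thesis using p(1) by simp
  qed
  have lv: "l v = 0" by (simp add: l_def)
  have "sg u e * diff l e = l u - l v" using uv by (auto simp: sg_def diff_def doubleton_eq_iff)
  moreover have "sg u e * diff l e = t e" using dl[OF e(1)] by (simp add: mult.assoc[symmetric])
  ultimately have lu: "l u = t e" using lv by simp
  have less: "l v < l u" using lu lv t_pos[OF e(1)] by simp
  have "l y < t e" if "y \<in> V - {u}" for y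
    using max_principle[OF uv(3,4,2) less harm that] lu by simp
  moreover have "0 < l y" if "y \<in> V - {v}" for y
  proof -
    have "diff (\<lambda>y. - l y) g = - diff l g" for g by (simp add: diff_def)
    then have "(\<Sum>g\<in>E. diff (\<lambda>y. - l y) g * diff \<phi> g) = p * (\<phi> v - \<phi> u)" for \<phi>
      using harm[of \<phi>] by (simp add: sum_negf right_diff_distrib)
    then show ?thesis using max_principle[of v u "\<lambda>y. - l y" p y] uv less that lv by simp
  qed
  ultimately have bounds: "\<forall>y\<in>V - {u, v}. 0 < l y \<and> l y < t e" by blast
  have "\<forall>g\<in>E. drop l u g = sg u g * sg u e * N e g" using dl by (simp add: drop_def mult.assoc)
  then have "level l e u v" unfolding level_def using e uv(2) lv lu harm bounds by blast
  then show thesis by (rule that)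
qed

context
  fixes l e u v
  assumes L: "level l e u v"
begin

lemma level_star: "(\<Sum>g\<in>star y. drop l y g) = p * (of_bool (u = y) - of_bool (v = y))"
  using L unfolding sum_star[symmetric] level_def by blast

lemma level_norm: "(\<Sum>g\<in>E. (diff l g)\<^sup>2) = p * t e"
proof -
  have "(\<Sum>g\<in>E. diff l g * diff l g) = p * (l u - l v)" using L unfolding level_def by blast
  then show ?thesis using L by (simp add: level_def power2_eq_square)
qed

lemma level_top: "y \<in> V \<Longrightarrow> y \<noteq> u \<Longrightarrow> l y < l u"
  using L t_pos[of e] by (cases "y = v") (auto simp: level_def)

lemma level_drop_top: "g \<in> star u \<Longrightarrow> drop l u g \<ge> 1"
  using star_other[of g u] drop_eq[OF star_E] level_top by fastforce

lemma level_reciprocal: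
  assumes M: "level m f a b"
  shows "l a - l b = m u - m v"
proof -
  have "(\<Sum>g\<in>E. diff l g * diff m g) = p * (m u - m v)" using L unfolding level_def by blast
  moreover have "(\<Sum>g\<in>E. diff m g * diff l g) = p * (l a - l b)" using M unfolding level_def by blast
  ultimately have "p * (l a - l b) = p * (m u - m v)" by (simp only: mult.commute)
  then show ?thesis using p(1) by auto
qed

lemma levelD: "e \<in> E" "d e = {u, v}" "u \<noteq> v" "l v = 0" "l u = t e" "u \<in> V" "v \<in> V"
    "e \<in> star u" "e \<in> star v"
    "\<And>g. g \<in> E \<Longrightarrow> drop l u g = sg u g * sg u e * N e g"
    "\<And>y. y \<in> V \<Longrightarrow> y \<noteq> u \<Longrightarrow> y \<noteq> v \<Longrightarrow> 0 < l y \<and> l y < t e"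
  using L ends_subset[of e] by (auto simp: level_def star_def)

end

text \<open>There is no integer strictly between 0 and 1. So the ends of \<open>e\<close> are the only vertices and the
  graph consists of \<open>p\<close> parallel edges, but a graph with two vertices and as many faces has two
  edges, and \<open>p\<close> is odd.\<close>

lemma t_not_1:
  assumes "e \<in> E"
  shows "t e \<noteq> 1"
proof
  assume t1: "t e = 1"
  obtain u v where uv: "d e = {u, v}" using ends_ex[OF assms] by blast
  obtain l where L: "level l e u v" using level_exists[OF assms uv] .
  note LD = levelD[OF L]
  have V: "V = {u, v}"
  proof -
    have False if "y \<in> V" "y \<noteq> u" "y \<noteq> v" for y using LD(11)[OF that] t1 by linarith
    then show ?thesis using LD by blast
  qed
  have "(diff l g)\<^sup>2 = 1" if g: "g \<in> E" for g
  proof -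
    have "src g \<in> {u, v}" "tgt g \<in> {u, v}" "src g \<noteq> tgt g" using g V src_V tgt_V loopless by blast+
    then show ?thesis using LD t1 by (auto simp: diff_def)
  qed
  then have "int (card E) = p" using level_norm[OF L] t1 by simp
  moreover have "card V = 2" using V LD by simp
  ultimately show False using cardE p(2) by simp
qed


end

section \<open>The prime seven\<close>

locale graph49 = square_graph V d E src tgt p \<sigma>
  for V :: "'v set" and d :: "'e \<Rightarrow> 'v set" and E src tgt p \<sigma> +
  assumes p7: "p = 7"
begin

text \<open>The arithmetic for three edges at \<open>u\<close> that lead to the middle level: their potential
  differences are the rows of a symmetric matrix with known row sums, and \<open>T1\<close>,
  \<open>T2\<close>, \<open>T3\<close> are numbers of trees through sets of three edges.\<close>

lemma three_rows_5:
  fixes t1 t2 t3 a b c T1 T2 T3 :: int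
  assumes "t1 + c + b = 5" "t2 + c + a = 5" "t3 + b + a = 5"
    and "1 \<le> a" "1 \<le> b" "1 \<le> c" "2 \<le> t1" "2 \<le> t2" "2 \<le> t3"
    and "7 * T3 = 2 * t1 * t2 - 2 * c\<^sup>2 - t1 - t2 + 2 * c"
    and "7 * T2 = 2 * t1 * t3 - 2 * b\<^sup>2 - t1 - t3 + 2 * b"
    and "7 * T1 = 2 * t2 * t3 - 2 * a\<^sup>2 - t2 - t3 + 2 * a"
  shows "T1 = 1 \<or> T2 = 1 \<or> T3 = 1"
proof -
  have "c = 1 \<or> c = 2" "b = 1 \<or> b = 2" "a = 1 \<or> a = 2" using assms(1-9) by linarith+
  moreover have "t1 = 5 - c - b" "t2 = 5 - c - a" "t3 = 5 - b - a" using assms(1-3) by linarith+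
  ultimately show ?thesis using assms(4-12) by (elim disjE) (simp; presburger)+
qed

text \<open>An edge with \<open>t e = 2\<close> has all other vertices on one level between its ends. The entries of the
  current matrix for the edges at \<open>u\<close> are then so small that all cases can be listed.\<close>

lemma t_not_2:
  assumes e: "e \<in> E"
  shows "t e \<noteq> 2"
proof
  assume t2: "t e = 2"
  obtain u v where uv: "d e = {u, v}" using ends_ex[OF e] by blast
  obtain l where L: "level l e u v" using level_exists[OF e uv] .
  note LD = levelD[OF L]
  have mid: "l y = 1" if "y \<in> V" "y \<noteq> u" "y \<noteq> v" for y using LD(11)[OF that] t2 by linarith
  define A where "A = {g \<in> E. d g = {u, v}}"
  define B where "B = star u - A"
  define B' where "B' = star v - A"
  have fin: "finite A" "finite B" "finite B'" using finE by (auto simp: A_def B_def B'_def)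
  have Au: "A \<subseteq> star u" "A \<subseteq> star v" by (auto simp: A_def star_def)
  have Bw: "\<exists>w\<in>V - {u, v}. d g = {u, w}" if "g \<in> B" for g
    using star_other[of g u] that by (auto simp: B_def A_def star_def)
  have Bw': "\<exists>w\<in>V - {u, v}. d g = {v, w}" if "g \<in> B'" for g
  proof -
    from that have "g \<in> star v" "g \<notin> A" by (auto simp: B'_def)
    from star_other[OF this(1)] obtain w where w: "w \<in> V" "d g = {v, w}" "w \<noteq> v" by auto
    then have "w \<noteq> u" using \<open>g \<notin> A\<close> star_E[OF \<open>g \<in> star v\<close>] by (auto simp: A_def insert_commute)
    then show ?thesis using w by auto
  qed
  have lA: "drop l u g = 2" "drop l v g = - 2" if "g \<in> A" for g
    using that drop_eq[of g u v l] drop_eq[of g v u l] LD t2 by (auto simp: A_def insert_commute)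
  have lB: "drop l u g = 1" if "g \<in> B" for g
  proof -
    from Bw[OF that] obtain w where "w \<in> V - {u, v}" "d g = {u, w}" by blast
    then show ?thesis using drop_eq[of g u w l] mid[of w] that LD t2 by (auto simp: B_def star_def)
  qed
  have lB': "drop l v g = - 1" if "g \<in> B'" for g
  proof -
    from Bw'[OF that] obtain w where "w \<in> V - {u, v}" "d g = {v, w}" by blast
    then show ?thesis using drop_eq[of g v w l] mid[of w] that LD t2 by (auto simp: B'_def star_def)
  qed
  have split: "(\<Sum>g\<in>star u. F g) = (\<Sum>g\<in>A. F g) + (\<Sum>g\<in>B. F g)" for F :: "'e \<Rightarrow> int"
    unfolding B_def using sum.subset_diff[OF Au(1) finite_star, of F] by simp
  have split': "(\<Sum>g\<in>star v. F g) = (\<Sum>g\<in>A. F g) + (\<Sum>g\<in>B'. F g)" for F :: "'e \<Rightarrow> int"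
    unfolding B'_def using sum.subset_diff[OF Au(2) finite_star, of F] by simp
  have flow: "2 * int (card A) + int (card B) = 7"
    using level_star[OF L, of u] LD(3) lA lB by (simp add: split p7)
  have flow': "2 * int (card A) + int (card B') = 7"
    using level_star[OF L, of v] LD(3) lA lB' by (simp add: split' p7)
  have disj: "A \<inter> B = {}" "A \<inter> B' = {}" by (auto simp: B_def B'_def)
  have "g \<notin> B'" if "g \<in> B" for g
  proof
    assume "g \<in> B'"
    then have "v \<in> d g" by (auto simp: B'_def star_def)
    moreover from Bw[OF \<open>g \<in> B\<close>] obtain w where "w \<in> V - {u, v}" "d g = {u, w}" by blast
    ultimately show False using LD(3) by auto
  qed
  then have BB': "B \<inter> B' = {}" by blast
  have AE: "A \<union> B \<union> B' \<subseteq> E" by (auto simp: A_def B_def B'_def star_def)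
  have cE: "int (card E) \<ge> int (card A) + 2 * int (card B)"
  proof -
    have "card (A \<union> B \<union> B') = card A + card B + card B'"
      using fin disj BB' by (subst card_Un_disjoint; auto simp: card_Un_disjoint)
    moreover have "card (A \<union> B \<union> B') \<le> card E" using AE finE by (rule card_mono[rotated])
    ultimately show ?thesis using flow flow' by linarith
  qed
  have eA: "e \<in> A" using e uv by (simp add: A_def)
  then have A1: "card A \<ge> 1" using fin by (metis One_nat_def Suc_leI card_gt_0_iff empty_iff)
  define n where "n f g = sg u f * sg u g * N f g" for f g
  have nsym: "n f g = n g f" if "f \<in> E" "g \<in> E" for f g
    using N_sym[OF that] by (simp add: n_def)
  have nn: "n f f = t f" for f by (simp add: n_def)
  have BE: "f \<in> E" if "f \<in> B" for f using that by (auto simp: B_def star_def)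
  have row: "(\<forall>g\<in>B. n f g \<ge> 1) \<and> int (card A) + (\<Sum>g\<in>B. n f g) = 7 \<and> n e f = 1 \<and> t f \<ge> 2"
    if f: "f \<in> B" for f
  proof -
    obtain w where w: "w \<in> V - {u, v}" "d f = {u, w}" using Bw[OF f] by blast
    obtain m where M: "level m f u w" using level_exists[OF BE[OF f] w(2)] .
    note MD = levelD[OF M]
    have dn: "drop m u g = n f g" if "g \<in> E" for g using MD(10)[OF that] by (simp add: n_def mult.commute)
    have "l u - l w = m u - m v" by (rule level_reciprocal[OF L M])
    then have mA: "drop m u g = 1" if "g \<in> A" for g
      using that drop_eq[of g u v m] mid[of w] w LD t2 by (auto simp: A_def)
    have "n f g \<ge> 1" if "g \<in> B" for g
      using level_drop_top[OF M, of g] dn[OF BE[OF that]] that by (simp add: B_def)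
    moreover have "int (card A) + (\<Sum>g\<in>B. n f g) = 7"
    proof -
      have "(\<Sum>g\<in>B. drop m u g) = (\<Sum>g\<in>B. n f g)" using dn BE by (intro sum.cong) auto
      then show ?thesis using level_star[OF M, of u] MD(3) mA by (simp add: split p7)
    qed
    moreover have "n e f = 1" using mA[OF eA] dn[OF e] nsym[OF e BE[OF f]] by simp
    moreover have "t f \<ge> 2" using t_pos[OF BE[OF f]] t_not_1[OF BE[OF f]] by linarith
    ultimately show ?thesis by blast
  qed
  have eB: "e \<notin> B" using eA disj by blast
  have minor: "7 * tc {e, f, g} = 2 * t f * t g - 2 * (n f g)\<^sup>2 - t f - t g + 2 * n f g"
    if fg: "f \<in> B" "g \<in> B" "f \<noteq> g" for f g
  proof -
    have ne: "e \<noteq> f" "g \<noteq> e" using eB fg by auto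
    have sq: "(N x y)\<^sup>2 = (n x y)\<^sup>2" for x y by (simp add: n_def power_mult_distrib)
    have nf: "n e f = 1" "n e g = 1" "t f \<ge> 2" using row fg by auto
    have "tc {e, f} = 2 * t f - 1" using two_N[OF e BE[OF fg(1)] ne(1)] t2 nf by (simp add: sq)
    then have "tc {e, f} \<noteq> 0" using nf by linarith
    note T = three_N[OF e BE[OF fg(1)] BE[OF fg(2)] ne fg(3)[symmetric] this]
    have "N e f * N f g * N e g = n e f * n f g * n e g"
      by (auto simp: n_def sg_def)
    then have prod: "N e f * N f g * N e g = n f g" using nf by simp
    have sqs: "(N f g)\<^sup>2 = (n f g)\<^sup>2" "(N e g)\<^sup>2 = 1" "(N e f)\<^sup>2 = 1"
      using sq nf by simp_all
    have "7 * tc {e, f, g} = p * tc {e, f, g}" by (simp only: p7)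
    also have "\<dots> = t e * t f * t g + 2 * (N e f * N f g * N e g)
        - t e * (N f g)\<^sup>2 - t f * (N e g)\<^sup>2 - t g * (N e f)\<^sup>2"
      using T by (simp only: mult.assoc)
    also have "\<dots> = 2 * t f * t g - 2 * (n f g)\<^sup>2 - t f - t g + 2 * n f g"
      unfolding sqs prod t2 by simp
    finally show ?thesis .
  qed
  have cA: "card A \<le> 3" using flow by linarith
  then consider "card A = 1" | "card A = 2" | "card A = 3" using A1 by linarith
  then show False
  proof cases
    case 1
    then have "card B = 5" using flow by simp
    then have "\<not> card B \<le> Suc 0" by simp
    then obtain f g where fg: "f \<in> B" "g \<in> B" "f \<noteq> g"
      using card_le_Suc0_iff_eq[OF fin(2)] by blast
    have *: "n f f = 2 \<and> (\<forall>g\<in>B - {f}. n f g = 1)" if f: "f \<in> B" for f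
    proof -
      have s: "n f f + (\<Sum>g\<in>B - {f}. n f g) = 6"
        using row[OF f] 1 sum.remove[OF fin(2) f, of "n f"] by simp
      have "(\<Sum>g\<in>B - {f}. n f g - 1) = (\<Sum>g\<in>B - {f}. n f g) - 4"
        using \<open>card B = 5\<close> f fin by (simp add: sum_subtractf)
      moreover have "(\<Sum>g\<in>B - {f}. n f g - 1) \<ge> 0" using row[OF f] by (intro sum_nonneg) auto
      ultimately have "n f f = 2" "(\<Sum>g\<in>B - {f}. n f g - 1) = 0" using s row[OF f] nn[of f] by auto
      moreover from this(2) have "\<forall>g\<in>B - {f}. n f g - 1 = 0"
        using row[OF f] fin by (subst (asm) sum_nonneg_eq_0_iff) auto
      ultimately show ?thesis by simp
    qed
    have "7 * tc {e, f, g} = 4" using minor[OF fg] *[OF fg(1)] *[OF fg(2)] fg nn by auto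
    then show False by presburger
  next
    case 2
    then have "card B = 3" using flow by simp
    then obtain f1 f2 f3 where B: "B = {f1, f2, f3}" "f1 \<noteq> f2" "f1 \<noteq> f3" "f2 \<noteq> f3"
      by (auto simp: card_3_iff)
    have i: "f1 \<in> B" "f2 \<in> B" "f3 \<in> B" using B by auto
    have r: "t f1 + n f1 f2 + n f1 f3 = 5" "t f2 + n f1 f2 + n f2 f3 = 5" "t f3 + n f1 f3 + n f2 f3 = 5"
      using row[OF i(1)] row[OF i(2)] row[OF i(3)] B 2 nn nsym[OF BE[OF i(1)] BE[OF i(2)]]
        nsym[OF BE[OF i(1)] BE[OF i(3)]] nsym[OF BE[OF i(2)] BE[OF i(3)]] by auto
    have ge: "n f1 f2 \<ge> 1" "n f1 f3 \<ge> 1" "n f2 f3 \<ge> 1" "t f1 \<ge> 2" "t f2 \<ge> 2" "t f3 \<ge> 2"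
      using row i by auto
    have one: "tc {e, f1, f2} = 1 \<or> tc {e, f1, f3} = 1 \<or> tc {e, f2, f3} = 1"
      using three_rows_5[OF r ge(3,2,1,4,5,6) minor[OF i(1,2) B(2)] minor[OF i(1,3) B(3)] minor[OF i(2,3) B(4)]]
      by blast
    have cV: "card V = 4" if "tc {e, f, g} = 1" "f \<in> B" "g \<in> B" "f \<noteq> g" for f g
    proof -
      have "e \<noteq> f" "e \<noteq> g" using that eB by blast+
      then have "card {e, f, g} = 3" using that(4) by simp
      then show ?thesis using unique_tree[OF that(1) tc_less] by simp
    qed
    then have "card V = 4" using one i B(2-4) by metis
    then have "card E = 6" using cardE by simp
    then show False using cE 2 \<open>card B = 3\<close> by simp
  next
    case 3
    then have "card B = 1" "card B' = 1" using flow flow' by auto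
    then obtain f f' where B: "B = {f}" "B' = {f'}" by (meson card_1_singletonE)
    then obtain w where w: "w \<in> V - {u, v}" "d f = {u, w}" using Bw by blast
    have "w \<in> d f'"
    proof (rule ccontr)
      assume wf': "w \<notin> d f'"
      have "drop l w g \<le> 0" if g: "g \<in> star w" for g
      proof -
        from star_other[OF g] obtain x where x: "x \<in> V" "d g = {w, x}" "x \<noteq> w" by auto
        have "x \<noteq> v"
        proof
          assume "x = v"
          then have "g \<in> B'" using x w g by (auto simp: B'_def A_def star_def)
          then show False using wf' B x by auto
        qed
        then have "l x \<ge> 1" using mid[of x] x LD t2 by (cases "x = u") auto
        then show ?thesis using drop_eq[OF star_E[OF g] x(2), of l] mid[of w] w by auto
      qed
      moreover have "(\<Sum>g\<in>star w. - drop l w g) = 0"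
        using level_star[OF L, of w] w by (auto simp: sum_negf)
      ultimately have "\<forall>g\<in>star w. - drop l w g = 0"
        using sum_nonneg_eq_0_iff[OF finite_star, of w "\<lambda>g. - drop l w g"] by auto
      moreover have "f \<in> star w" using BE[of f] B w by (auto simp: star_def)
      moreover have "drop l w f = - 1"
        using drop_eq[of f w u l] BE[of f] B w mid[of w] LD t2 by (auto simp: insert_commute)
      ultimately show False by force
    qed
    have "V = {u, v, w}"
    proof (rule ccontr)
      assume "V \<noteq> {u, v, w}"
      then obtain y where y: "y \<in> V - {u, v, w}" using LD w by blast
      have "reach d {g \<in> E. w \<notin> d g} y u" using no_cut[of w] y w LD by (auto simp: spans_def)
      then have "u \<in> V - {u, v, w}"
      proof (rule reach_closed[OF _ y])
        fix g a b assume g: "g \<in> {g \<in> E. w \<notin> d g}" "d g = {a, b}" and a: "a \<in> V - {u, v, w}"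
        have "b \<in> V" "b \<noteq> w" using g ends_subset[of g] by auto
        moreover have "b \<noteq> u"
        proof
          assume "b = u"
          then have "g \<in> B" using g a by (auto simp: B_def A_def star_def)
          then show False using B w g by auto
        qed
        moreover have "b \<noteq> v"
        proof
          assume "b = v"
          then have "g \<in> B'" using g a by (auto simp: B'_def A_def star_def)
          then show False using B \<open>w \<in> d f'\<close> g by auto
        qed
        ultimately show "b \<in> V - {u, v, w}" by blast
      qed
      then show False by blast
    qed
    then have "card V = 3" using LD(3) w by auto
    then have "card E = 4" using cardE by simp
    then show False using cE 3 \<open>card B = 1\<close> by simp
  qed
qed

lemma t_34: "e \<in> E \<Longrightarrow> t e = 3 \<or> t e = 4"
  using t_pos[of e] t_not_1[of e] t_not_2[of e] t_pos[of "\<sigma> e"] t_not_1[of "\<sigma> e"] t_not_2[of "\<sigma> e"]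
    t_\<sigma>[of e] \<sigma>E[of e] p7 by auto

text \<open>Two parallel edges carry at least \<open>2 * 3\<close> of the current 7 that flows between their ends. So
  there is just one further edge at \<open>u\<close>, with a current of 1, and
  \<open>t\<close> takes the value 5 at that edge.\<close>

lemma no_parallel:
  assumes e: "e \<in> E" "e' \<in> E" "d e = d e'"
  shows "e = e'"
proof (rule ccontr)
  assume ne: "e \<noteq> e'"
  obtain u v where uv: "d e = {u, v}" using ends_ex[OF e(1)] by blast
  obtain l where L: "level l e u v" using level_exists[OF e(1) uv] .
  note LD = levelD[OF L]
  have st: "{e, e'} \<subseteq> star u" using e uv by (auto simp: star_def)
  define R where "R = star u - {e, e'}"
  have d2: "drop l u e = t e" "drop l u e' = t e"
    using drop_eq[of _ u v l] e uv LD by auto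
  have "(\<Sum>g\<in>star u. drop l u g) = (\<Sum>g\<in>R. drop l u g) + 2 * t e"
    unfolding R_def using sum.subset_diff[OF st finite_star, of "drop l u"] ne d2 by simp
  then have s: "(\<Sum>g\<in>R. drop l u g) + 2 * t e = 7" using level_star[OF L, of u] LD p7 by simp
  have R1: "drop l u g \<ge> 1" if "g \<in> R" for g using level_drop_top[OF L, of g] that by (simp add: R_def)
  have finR: "finite R" by (simp add: R_def)
  have "(\<Sum>g\<in>R. drop l u g) \<ge> (\<Sum>g\<in>R. 1)" by (rule sum_mono) (use R1 in auto)
  then have "int (card R) + 2 * t e \<le> 7" using s by simp
  then have "t e = 3" "card R \<le> 1" using t_34[OF e(1)] by auto
  moreover have "R \<noteq> {}" using s \<open>t e = 3\<close> by auto
  ultimately have "card R = 1" using finR by (metis One_nat_def Suc_leI card_gt_0_iff le_antisym)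
  then obtain h where h: "R = {h}" by (rule card_1_singletonE)
  then have dh: "drop l u h = 1" using s \<open>t e = 3\<close> by simp
  have hs: "h \<in> star u" using h by (auto simp: R_def)
  from star_other[OF hs] obtain w where w: "w \<in> V" "d h = {u, w}" "w \<noteq> u" by auto
  obtain m where M: "level m h u w" using level_exists[OF star_E[OF hs] w(2)] .
  note MD = levelD[OF M]
  have "m u - m v = 1"
    using level_reciprocal[OF L M] dh drop_eq[OF star_E[OF hs] w(2), of l] by simp
  then have "drop m u e = 1" "drop m u e' = 1" using drop_eq[of _ u v m] e uv by auto
  moreover have "drop m u h = t h" using drop_eq[OF MD(1,2), of m] MD by simp
  moreover have "(\<Sum>g\<in>star u. drop m u g) = (\<Sum>g\<in>R. drop m u g) + (drop m u e + drop m u e')"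
    unfolding R_def using sum.subset_diff[OF st finite_star, of "drop m u"] ne by simp
  ultimately have "t h + 2 = 7" using level_star[OF M, of u] MD p7 h by simp
  then show False using t_34[OF star_E[OF hs]] by simp
qed

lemma few_between:
  assumes "a \<noteq> b" "X \<subseteq> star a \<inter> star b"
  shows "X = {} \<or> (\<exists>g. X = {g} \<and> g \<in> E \<and> d g = {a, b})"
proof -
  have "d g = {a, b}" if g: "g \<in> X" for g
  proof -
    have "g \<in> star a" "b \<in> d g" using g assms by (auto simp: star_def)
    from star_other[OF this(1)] obtain w where "d g = {a, w}" by auto
    then show ?thesis using \<open>b \<in> d g\<close> assms by auto
  qed
  moreover have "X \<subseteq> E" using assms by (auto simp: star_def)
  ultimately show ?thesis using no_parallel by (metis insertI1 is_singletonI' is_singleton_def subsetD)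
qed

text \<open>For integers, the node law thus bounds the energy from below; the energy of a level is known from
  \<open>level_norm\<close>.\<close>

lemma square_sums:
  fixes F :: "'e \<Rightarrow> int"
  shows "\<bar>\<Sum>g\<in>X. F g\<bar> \<le> (\<Sum>g\<in>X. (F g)\<^sup>2)"
proof -
  have "\<bar>x\<bar> \<le> x\<^sup>2" for x :: int
    using self_le_power[of "\<bar>x\<bar>" 2] by (cases "x = 0") auto
  then have "(\<Sum>g\<in>X. \<bar>F g\<bar>) \<le> (\<Sum>g\<in>X. (F g)\<^sup>2)" by (rule sum_mono)
  then show ?thesis using sum_abs[of F X] by linarith
qed

lemma no_degree_2:
  assumes "star y = {e, f}" "e \<noteq> f"
  shows False
proof -
  have es: "e \<in> star y" "f \<in> star y" using assms by auto
  from star_other[OF es(1)] obtain a where a: "a \<in> V" "d e = {y, a}" "a \<noteq> y" by auto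
  from star_other[OF es(2)] obtain b where b: "b \<in> V" "d f = {y, b}" "b \<noteq> y" by auto
  note E = star_E[OF es(1)] star_E[OF es(2)]
  have ab: "a \<noteq> b" using no_parallel[OF E] a b assms(2) by auto
  obtain l where L: "level l e y a" using level_exists[OF E(1) a(2)] .
  obtain m where M: "level m f y b" using level_exists[OF E(2) b(2)] .
  note LD = levelD[OF L] and MD = levelD[OF M]
  have "l y - l b = m y - m a" by (rule level_reciprocal[OF L M])
  moreover have "(l y - l a) + (l y - l b) = 7" "(m y - m a) + (m y - m b) = 7"
    using level_star[OF L, of y] level_star[OF M, of y] LD MD assms p7 a b
      drop_eq[OF E(1) a(2)] drop_eq[OF E(2) b(2)] by auto
  ultimately have n: "t f = t e" "l b = 2 * t e - 7" using LD MD by auto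
  have "0 < l b" using LD(11)[of b] a b ab by auto
  then have t4: "t e = 4" using n t_34[OF E(1)] by auto
  define Re where "Re = E - {e, f}"
  have "(\<Sum>g\<in>E. (diff l g)\<^sup>2) = (\<Sum>g\<in>Re. (diff l g)\<^sup>2) + ((diff l e)\<^sup>2 + (diff l f)\<^sup>2)"
    unfolding Re_def using sum.subset_diff[of "{e, f}" E] E finE assms(2) by simp
  moreover have "(diff l e)\<^sup>2 = 16" "(diff l f)\<^sup>2 = 9"
    using drop_square[of l y e] drop_square[of l y f] drop_eq[OF E(1) a(2), of l] drop_eq[OF E(2) b(2), of l]
      LD t4 n by auto
  ultimately have r3: "(\<Sum>g\<in>Re. (diff l g)\<^sup>2) = 3" using level_norm[OF L] t4 p7 by simp
  define A where "A = star a - {e}"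
  define B where "B = star b - {f}"
  have "f \<notin> star a" "e \<notin> star b" using a b ab by (auto simp: star_def)
  then have ABR: "A \<subseteq> Re" "B \<subseteq> Re" by (auto simp: A_def B_def Re_def star_def)
  have finAB: "finite A" "finite B" "finite Re" using finE by (auto simp: A_def B_def Re_def)
  have "e \<in> star a" "f \<in> star b" using E a b by (auto simp: star_def)
  then have "(\<Sum>g\<in>star a. drop l a g) = drop l a e + (\<Sum>g\<in>A. drop l a g)"
    "(\<Sum>g\<in>star b. drop l b g) = drop l b f + (\<Sum>g\<in>B. drop l b g)"
    unfolding A_def B_def by (simp_all add: sum.remove)
  moreover have "drop l a e = - 4" "drop l b f = - 3"
    using drop_eq[OF E(1), of a y l] drop_eq[OF E(2), of b y l] a b LD t4 n by (auto simp: insert_commute)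
  ultimately have sums: "(\<Sum>g\<in>A. drop l a g) = - 3" "(\<Sum>g\<in>B. drop l b g) = 3"
    using level_star[OF L, of a] level_star[OF L, of b] a b ab p7 by auto
  have sq: "(\<Sum>g\<in>A. (diff l g)\<^sup>2) \<ge> 3" "(\<Sum>g\<in>B. (diff l g)\<^sup>2) \<ge> 3"
    using square_sums[of "drop l a" A] square_sums[of "drop l b" B] sums by (auto simp: drop_square)
  have AB: "(\<Sum>g\<in>A \<inter> B. (diff l g)\<^sup>2) \<le> 1"
  proof -
    have "A \<inter> B \<subseteq> star a \<inter> star b" by (auto simp: A_def B_def)
    from few_between[OF ab this] show ?thesis
    proof
      assume "\<exists>g. A \<inter> B = {g} \<and> g \<in> E \<and> d g = {a, b}"
      then obtain g where g: "A \<inter> B = {g}" "g \<in> E" "d g = {a, b}" by blast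
      have "(diff l g)\<^sup>2 = 1" using drop_square[of l a g] drop_eq[OF g(2,3), of l] LD n t4 by simp
      then show ?thesis using g by simp
    qed simp
  qed
  have "(\<Sum>g\<in>A \<union> B. (diff l g)\<^sup>2) \<le> 3"
    using sum_mono2[of Re "A \<union> B" "\<lambda>g. (diff l g)\<^sup>2"] ABR finAB r3 by auto
  moreover have "(\<Sum>g\<in>A \<union> B. (diff l g)\<^sup>2) + (\<Sum>g\<in>A \<inter> B. (diff l g)\<^sup>2) =
      (\<Sum>g\<in>A. (diff l g)\<^sup>2) + (\<Sum>g\<in>B. (diff l g)\<^sup>2)"
    by (rule sum.union_inter[OF finAB(1,2)])
  ultimately show False using sq AB by linarith
qed

text \<open>The three edges at \<open>y\<close> use up \<open>9 + 4 + 4\<close> of the energy \<open>7 * 3\<close>. The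
  remaining 4 is needed for the edges that carry a current of 4 at \<open>a\<close>, so that all other edges
  carry nothing. But a current of 2 flows on from \<open>b\<close>, and at most one edge with difference 1
  joins \<open>a\<close> and \<open>b\<close>.\<close>

lemma no_degree_3_aux:
  assumes st: "star y = {e, f, g}" "e \<noteq> f" "e \<noteq> g" "f \<noteq> g" "d e = {y, a}" "d f = {y, b}"
    and L: "level l e y a" and te: "t e = 3" "drop l y f = 2" "drop l y g = 2"
  shows False
proof -
  have es: "e \<in> E" "f \<in> E" "g \<in> E" "f \<in> star y" "g \<in> star y" using st by (auto simp: star_def)
  note LD = levelD[OF L]
  obtain c where c: "d g = {y, c}" "c \<noteq> y" using star_other[OF es(5)] by auto
  have b: "b \<noteq> y" "b \<in> V" using star_other[OF es(4)] st(6) by (auto simp: doubleton_eq_iff)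
  have ab: "a \<noteq> b" using no_parallel[OF es(1,2)] st by auto
  have ac: "a \<noteq> c" using no_parallel[OF es(1,3)] st c by auto
  have bc: "b \<noteq> c" using no_parallel[OF es(2,3)] st c by auto
  have lb: "l b = 1" using drop_eq[OF es(2) st(6), of l] te LD by simp
  define Re where "Re = E - {e, f, g}"
  have "(\<Sum>h\<in>E. (diff l h)\<^sup>2) = (\<Sum>h\<in>Re. (diff l h)\<^sup>2) + ((diff l e)\<^sup>2 + (diff l f)\<^sup>2 + (diff l g)\<^sup>2)"
    unfolding Re_def using sum.subset_diff[of "{e, f, g}" E] es finE st by (simp add: add.assoc)
  moreover have "(diff l e)\<^sup>2 = 9" "(diff l f)\<^sup>2 = 4" "(diff l g)\<^sup>2 = 4"
    using drop_square[of l y e] drop_square[of l y f] drop_square[of l y g]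
      drop_eq[OF es(1) st(5), of l] LD te by auto
  ultimately have r4: "(\<Sum>h\<in>Re. (diff l h)\<^sup>2) = 4" using level_norm[OF L] te p7 by simp
  define A where "A = star a - {e}"
  define B where "B = star b - {f}"
  have "f \<notin> star a" "g \<notin> star a" "e \<notin> star b" "g \<notin> star b"
    using st c ab ac bc b LD by (auto simp: star_def)
  then have ABR: "A \<subseteq> Re" "B \<subseteq> Re" by (auto simp: A_def B_def Re_def star_def)
  have finAB: "finite A" "finite B" "finite Re" using finE by (auto simp: A_def B_def Re_def)
  have "e \<in> star a" "f \<in> star b" using es st by (auto simp: star_def)
  then have "(\<Sum>h\<in>star a. drop l a h) = drop l a e + (\<Sum>h\<in>A. drop l a h)"
    "(\<Sum>h\<in>star b. drop l b h) = drop l b f + (\<Sum>h\<in>B. drop l b h)"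
    unfolding A_def B_def by (simp_all add: sum.remove)
  moreover have "drop l a e = - 3" "drop l b f = - 2"
    using drop_eq[OF es(1), of a y l] drop_eq[OF es(2), of b y l] st LD te lb by (auto simp: insert_commute)
  ultimately have sums: "(\<Sum>h\<in>A. drop l a h) = - 4" "(\<Sum>h\<in>B. drop l b h) = 2"
    using level_star[OF L, of a] level_star[OF L, of b] LD b ab p7 by auto
  have "(\<Sum>h\<in>A. (diff l h)\<^sup>2) \<ge> 4" using square_sums[of "drop l a" A] sums by (auto simp: drop_square)
  moreover have "(\<Sum>h\<in>Re. (diff l h)\<^sup>2) = (\<Sum>h\<in>Re - A. (diff l h)\<^sup>2) + (\<Sum>h\<in>A. (diff l h)\<^sup>2)"
    by (rule sum.subset_diff[OF ABR(1) finAB(3)])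
  moreover have "(\<Sum>h\<in>Re - A. (diff l h)\<^sup>2) \<ge> 0" by (intro sum_nonneg) auto
  ultimately have "(\<Sum>h\<in>Re - A. (diff l h)\<^sup>2) = 0" using r4 by linarith
  then have zero: "\<forall>h\<in>Re - A. (diff l h)\<^sup>2 = 0" using finAB by (subst (asm) sum_nonneg_eq_0_iff) auto
  have "(\<Sum>h\<in>B. drop l b h) = (\<Sum>h\<in>A \<inter> B. drop l b h)"
    using zero ABR finAB by (intro sum.mono_neutral_right) (auto simp: drop_def)
  moreover have "(\<Sum>h\<in>A \<inter> B. drop l b h) \<le> 1"
  proof -
    have "A \<inter> B \<subseteq> star b \<inter> star a" by (auto simp: A_def B_def)
    from few_between[OF ab[symmetric] this] show ?thesis
    proof
      assume "\<exists>h. A \<inter> B = {h} \<and> h \<in> E \<and> d h = {b, a}"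
      then obtain h where h: "A \<inter> B = {h}" "h \<in> E" "d h = {b, a}" by blast
      then show ?thesis using drop_eq[OF h(2,3), of l] LD lb by simp
    qed simp
  qed
  ultimately show False using sums by simp
qed

lemma symmetric_rows_7:
  fixes t1 t2 t3 a b c :: int
  assumes "t1 + c + b = 7" "c + t2 + a = 7" "b + a + t3 = 7"
    and "t1 = 3 \<or> t1 = 4" "t2 = 3 \<or> t2 = 4" "t3 = 3 \<or> t3 = 4"
  shows "(t1 = 3 \<and> c = 2 \<and> b = 2) \<or> (t2 = 3 \<and> c = 2 \<and> a = 2) \<or> (t3 = 3 \<and> b = 2 \<and> a = 2)"
proof -
  have "b = 7 - t1 - c" "a = 7 - t2 - c" "2 * c = 7 - t1 - t2 + t3" using assms(1-3) by linarith+
  then show ?thesis using assms(4-6) by (elim disjE) (simp_all, presburger+)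
qed

lemma no_degree_3:
  assumes st: "star y = {e, f, g}" "e \<noteq> f" "e \<noteq> g" "f \<noteq> g"
  shows False
proof -
  have es: "e \<in> star y" "f \<in> star y" "g \<in> star y" using st by auto
  note E = star_E[OF es(1)] star_E[OF es(2)] star_E[OF es(3)]
  obtain a where a: "d e = {y, a}" using star_other[OF es(1)] by auto
  obtain b where b: "d f = {y, b}" using star_other[OF es(2)] by auto
  obtain c where c: "d g = {y, c}" using star_other[OF es(3)] by auto
  obtain l where L: "level l e y a" using level_exists[OF E(1) a] .
  obtain m where M: "level m f y b" using level_exists[OF E(2) b] .
  obtain k where K: "level k g y c" using level_exists[OF E(3) c] .
  note LD = levelD[OF L] and MD = levelD[OF M] and KD = levelD[OF K]
  have dr: "drop \<phi> y e = \<phi> y - \<phi> a" "drop \<phi> y f = \<phi> y - \<phi> b" "drop \<phi> y g = \<phi> y - \<phi> c" for \<phi>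
    using drop_eq E a b c by auto
  have rec: "l y - l b = m y - m a" "l y - l c = k y - k a" "m y - m c = k y - k b"
    using level_reciprocal[OF L M] level_reciprocal[OF L K] level_reciprocal[OF M K] by auto
  have rows: "(l y - l a) + (l y - l b) + (l y - l c) = 7"
    "(m y - m a) + (m y - m b) + (m y - m c) = 7" "(k y - k a) + (k y - k b) + (k y - k c) = 7"
    using level_star[OF L, of y] level_star[OF M, of y] level_star[OF K, of y] st LD MD KD p7
    by (auto simp: dr)
  have ts: "t e = 3 \<or> t e = 4" "t f = 3 \<or> t f = 4" "t g = 3 \<or> t g = 4" using t_34 E by auto
  have "(t e = 3 \<and> l y - l b = 2 \<and> l y - l c = 2) \<or> (t f = 3 \<and> m y - m a = 2 \<and> m y - m c = 2) \<or>
    (t g = 3 \<and> k y - k a = 2 \<and> k y - k b = 2)"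
    using symmetric_rows_7[of "t e" "l y - l b" "l y - l c" "t f" "m y - m c" "t g"] ts rows rec
      LD(4,5) MD(4,5) KD(4,5) by simp
  then show False
  proof (elim disjE conjE)
    assume "t e = 3" "l y - l b = 2" "l y - l c = 2"
    then show False using no_degree_3_aux[OF st a b L] dr by simp
  next
    assume "t f = 3" "m y - m a = 2" "m y - m c = 2"
    moreover have "star y = {f, e, g}" using st by auto
    ultimately show False using no_degree_3_aux[of y f e g b a m] st a b M dr by auto
  next
    assume "t g = 3" "k y - k a = 2" "k y - k b = 2"
    moreover have "star y = {g, e, f}" using st by auto
    ultimately show False using no_degree_3_aux[of y g e f c a k] st a c K dr by auto
  qed
qed

lemma handshake: "(\<Sum>y\<in>V. card (star y)) = 2 * card E"
proof -
  have "(\<Sum>y\<in>V. card (star y)) = (\<Sum>y\<in>V. \<Sum>g\<in>E. of_bool (y \<in> d g))"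
    using finE by (simp add: star_def sum.If_cases Int_def)
  also have "\<dots> = (\<Sum>g\<in>E. \<Sum>y\<in>V. of_bool (y \<in> d g))" by (rule sum.swap)
  also have "\<dots> = (\<Sum>g\<in>E. 2)"
  proof (rule sum.cong)
    fix g assume g: "g \<in> E"
    have "V \<inter> {y. y \<in> d g} = {src g, tgt g}" using ori[OF g] src_V[OF g] tgt_V[OF g] by auto
    then show "(\<Sum>y\<in>V. of_bool (y \<in> d g)) = (2 :: nat)" using finV loopless[OF g] by simp
  qed simp
  finally show ?thesis by simp
qed

text \<open>The average degree is less than 4, so that some vertex has degree at most 3.\<close>

theorem no_edges: "E = {}"
proof (rule ccontr)
  assume "E \<noteq> {}"
  then obtain e0 where e0: "e0 \<in> E" by blast
  have "\<exists>y\<in>V. card (star y) \<le> 3"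
  proof (rule ccontr)
    assume "\<not> (\<exists>y\<in>V. card (star y) \<le> 3)"
    then have "(\<Sum>y\<in>V. card (star y)) \<ge> (\<Sum>y\<in>V. 4)" by (intro sum_mono) force
    then show False using handshake cardE by simp
  qed
  then obtain y where y: "y \<in> V" "card (star y) \<le> 3" by blast
  then consider "card (star y) = 0" | "card (star y) = 1" | "card (star y) = 2" | "card (star y) = 3" by linarith
  then show False
  proof cases
    case 1
    then have "star y = {}" by simp
    have "x = y" if "x \<in> V" for x
    proof -
      have "reach d E y x" using spansE y that by (auto simp: spans_def)
      then have "x \<in> {y}"
      proof (rule reach_closed)
        show "b \<in> {y}" if "e \<in> E" "d e = {a, b}" "a \<in> {y}" for e a b
          using that \<open>star y = {}\<close> by (auto simp: star_def)
      qed simp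
      then show ?thesis by simp
    qed
    then show False using src_V[OF e0] tgt_V[OF e0] loopless[OF e0] by metis
  next
    case 2
    then obtain e where e: "star y = {e}" by (rule card_1_singletonE)
    then have es: "e \<in> star y" by simp
    obtain a where a: "d e = {y, a}" using star_other[OF es] by auto
    obtain l where L: "level l e y a" using level_exists[OF star_E[OF es] a] .
    have "t e = 7" using level_star[OF L, of y] levelD[OF L] e drop_eq[OF star_E[OF es] a, of l] p7 by simp
    then show False using t_34[OF star_E[OF es]] by simp
  next
    case 3
    then show False using no_degree_2 by (auto simp: card_2_iff)
  next
    case 4
    then show False using no_degree_3 by (auto simp: card_3_iff)
  qed
qed

end

section \<open>Weighted tree counts\<close>

definition wt :: "('e \<Rightarrow> nat) \<Rightarrow> ('e \<Rightarrow> nat) \<Rightarrow> 'e set \<Rightarrow> 'e set \<Rightarrow> nat" where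
  "wt x y I T = (\<Prod>i\<in>I. if i \<in> T then x i else y i)"

text \<open>Every edge has one weight for the trees that contain it and one for the trees that avoid it. So a single
  edge can stand for a network between its ends, whose two weights count the spanning trees of the network and
  the spanning forests that separate its ends. The condition on the trees is a factor, so that sums range over
  all subsets and split along one edge at a time.\<close>

definition tree_sum :: "'v set \<Rightarrow> ('e \<Rightarrow> 'v set) \<Rightarrow> 'e set \<Rightarrow> ('e \<Rightarrow> nat) \<Rightarrow> ('e \<Rightarrow> nat) \<Rightarrow> nat" where
  "tree_sum V d I x y = (\<Sum>T\<in>Pow I. of_bool (spans V d T \<and> card T + 1 = card V) * wt x y I T)"

lemma tree_sum_card:
  assumes "finite I" "\<And>i. i \<in> I \<Longrightarrow> x i = 1 \<and> y i = 1"
  shows "tree_sum V d I x y = card (trees V d I)"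
proof -
  have "wt x y I T = 1" for T unfolding wt_def using assms by (intro prod.neutral) auto
  then have "tree_sum V d I x y = (\<Sum>T\<in>Pow I. of_bool (spans V d T \<and> card T + 1 = card V))"
    unfolding tree_sum_def by simp
  also have "\<dots> = card (Pow I \<inter> {T. spans V d T \<and> card T + 1 = card V})" using assms by simp
  also have "Pow I \<inter> {T. spans V d T \<and> card T + 1 = card V} = trees V d I" by (auto simp: trees_def)
  finally show ?thesis .
qed

lemma tree_sum_cong:
  assumes "\<And>i. i \<in> I \<Longrightarrow> d i = d' i" "\<And>i. i \<in> I \<Longrightarrow> x i = x' i" "\<And>i. i \<in> I \<Longrightarrow> y i = y' i"
  shows "tree_sum V d I x y = tree_sum V d' I x' y'"
  unfolding tree_sum_def
proof (rule sum.cong)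
  fix T assume T: "T \<in> Pow I"
  have "reach d T = reach d' T" by (intro ext reach_cong) (use T assms(1) in auto)
  moreover have "wt x y I T = wt x' y' I T" unfolding wt_def using assms by (intro prod.cong) auto
  ultimately show "of_bool (spans V d T \<and> card T + 1 = card V) * wt x y I T =
      of_bool (spans V d' T \<and> card T + 1 = card V) * wt x' y' I T"
    by (simp add: spans_def)
qed simp

lemma sum_Pow_insert:
  assumes "finite A" "a \<notin> A"
  shows "(\<Sum>X\<in>Pow (insert a A). f X) = (\<Sum>X\<in>Pow A. f X + f (insert a X))"
proof -
  have "(\<Sum>X\<in>Pow (insert a A). f X) = (\<Sum>X\<in>Pow A. f X) + (\<Sum>X\<in>insert a ` Pow A. f X)"
    unfolding Pow_insert using assms by (intro sum.union_disjoint) auto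
  also have "(\<Sum>X\<in>insert a ` Pow A. f X) = (\<Sum>X\<in>Pow A. f (insert a X))"
    using assms by (subst sum.reindex) (auto simp: inj_on_def)
  finally show ?thesis by (simp add: sum.distrib)
qed

lemma wt_insert:
  assumes "finite J" "i \<notin> J"
  shows "wt x y (insert i J) T = (if i \<in> T then x i else y i) * wt x y J T"
  using assms by (simp add: wt_def)

lemma wt_insert_other: "i \<notin> J \<Longrightarrow> wt x y J (insert i T) = wt x y J T"
  unfolding wt_def by (intro prod.cong) auto

lemma wt_upd: "i \<notin> J \<Longrightarrow> wt (x(i := r)) (y(i := s)) J T = wt x y J T"
  unfolding wt_def by (intro prod.cong) auto

section \<open>Subdividing and doubling an edge\<close>

lemma reach_pendant:
  assumes X: "\<And>i. i \<in> X \<Longrightarrow> d' i = d i" "\<And>i. i \<in> X \<Longrightarrow> d i \<subseteq> V"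
    and a: "d' a = {w, v}" "w \<notin> V" and xy: "x \<in> V" "y \<in> V"
  shows "reach d' (insert a X) x y \<longleftrightarrow> reach d X x y" "reach d' (insert a X) x w \<longleftrightarrow> reach d X x v"
proof -
  have R: "reach d' X s t \<longleftrightarrow> reach d X s t" for s t using X(1) by (rule reach_cong)
  have no: "\<not> reach d X s w" if "s \<in> V" for s
  proof
    assume "reach d X s w"
    then have "w \<in> V"
    proof (rule reach_closed[OF _ that])
      show "j \<in> V" if "i \<in> X" "d i = {k, j}" "k \<in> V" for i k j using X(2)[OF that(1)] that(2) by simp
    qed
    then show False using a by simp
  qed
  note I = reach_insert[where d = d' and e = a and A = X, OF a(1), unfolded R]
  have no': "\<not> reach d X w s" if "s \<in> V" for s using no[OF that] reach_commute by metis
  show "reach d' (insert a X) x y \<longleftrightarrow> reach d X x y" unfolding I using no[OF xy(1)] no'[OF xy(2)] by blast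
  show "reach d' (insert a X) x w \<longleftrightarrow> reach d X x v" unfolding I using no[OF xy(1)] by blast
qed

lemma spans_pendant:
  assumes "\<And>i. i \<in> X \<Longrightarrow> d' i = d i" "\<And>i. i \<in> X \<Longrightarrow> d i \<subseteq> V"
    and "d' a = {w, v}" "w \<notin> V" "v \<in> V"
  shows "spans (insert w V) d' (insert a X) \<longleftrightarrow> spans V d X"
proof -
  have R: "reach d' (insert a X) x y \<longleftrightarrow> reach d X x y" "reach d' (insert a X) x w \<longleftrightarrow> reach d X x v"
    if "x \<in> V" "y \<in> V" for x y
    using reach_pendant[of X d' d V a w v x y] assms(1-4) that by auto
  show ?thesis
  proof
    assume "spans (insert w V) d' (insert a X)"
    then show "spans V d X" unfolding spans_def using R(1) by blast
  next
    assume s: "spans V d X"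
    show "spans (insert w V) d' (insert a X)"
    proof (rule spansI_root[of _ _ _ v])
      fix y assume "y \<in> insert w V"
      then show "reach d' (insert a X) v y"
        using s R(1)[OF assms(5)] R(2)[OF assms(5,5)] assms(5) unfolding spans_def by auto
    qed
  qed
qed

text \<open>The edge \<open>e\<close> keeps its name for the half at \<open>u\<close>, and \<open>a\<close> is the half
  at \<open>v\<close>.\<close>

locale subdivision = fin_graph V d I for V :: "'v set" and d :: "'e \<Rightarrow> 'v set" and I :: "'e set" +
  fixes e a :: 'e and u v w :: 'v and d' :: "'e \<Rightarrow> 'v set"
  assumes e: "e \<in> I" "d e = {u, v}" and a: "a \<notin> I" and w: "w \<notin> V"
    and d': "d' e = {u, w}" "d' a = {w, v}" "\<And>i. i \<in> I - {e} \<Longrightarrow> d' i = d i"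
begin

lemma ea: "e \<noteq> a" "u \<in> V" "v \<in> V"
  using e a ends_subset by auto

lemma spans_both:
  assumes X: "X \<subseteq> I - {e}" "\<And>i. i \<in> X \<Longrightarrow> d i \<subseteq> W" and W: "u \<in> W" "v \<in> W" "w \<notin> W"
  shows "spans (insert w W) d' (insert e (insert a X)) \<longleftrightarrow> spans W d (insert e X)"
proof -
  have c: "\<And>i. i \<in> X \<Longrightarrow> d' i = d i" using X(1) d'(3) by blast
  have R: "reach d' (insert a X) x y \<longleftrightarrow> reach d X x y" "reach d' (insert a X) x w \<longleftrightarrow> reach d X x v"
    if "x \<in> W" "y \<in> W" for x y
    using reach_pendant[of X d' d W a w v x y] c X(2) d'(2) W(3) that by auto
  have "reach d' (insert e (insert a X)) x y \<longleftrightarrow> reach d (insert e X) x y" if "x \<in> W" "y \<in> W" for x y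
    unfolding reach_insert[where d = d' and e = e, OF d'(1)] reach_insert[where d = d and e = e, OF e(2)]
    using R(1)[OF that] R(1)[OF that(1) W(1)] R(2)[OF that] R(1)[OF W(1) that(2)]
      R(2)[OF that(2,1)] reach_commute[where d = d and A = X and x = y and y = v]
      reach_commute[where d = d' and A = "insert a X" and x = w and y = y] by simp
  moreover have "reach d' (insert e (insert a X)) u w" using d'(1) by (intro reach_edge[of e]) auto
  moreover have "spans (insert w W) d' Z \<longleftrightarrow> spans W d' Z" if "reach d' Z u w" for Z
    unfolding spans_def using that W unfolding reach_part by auto
  ultimately show ?thesis unfolding spans_def by blast
qed

lemma spans_one:
  assumes X: "X \<subseteq> I - {e}" "\<And>i. i \<in> X \<Longrightarrow> d i \<subseteq> W" and W: "w \<notin> W"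
  shows "v \<in> W \<Longrightarrow> spans (insert w W) d' (insert a X) \<longleftrightarrow> spans W d X"
    "u \<in> W \<Longrightarrow> spans (insert w W) d' (insert e X) \<longleftrightarrow> spans W d X"
proof -
  have c: "\<And>i. i \<in> X \<Longrightarrow> d' i = d i" using X(1) d'(3) by blast
  show "v \<in> W \<Longrightarrow> spans (insert w W) d' (insert a X) \<longleftrightarrow> spans W d X"
    using spans_pendant[of X d' d W a w v] c X d' W by auto
  show "u \<in> W \<Longrightarrow> spans (insert w W) d' (insert e X) \<longleftrightarrow> spans W d X"
    using spans_pendant[of X d' d W e w u] c X d' W by (auto simp: insert_commute)
qed

lemma spans_neither:
  assumes X: "X \<subseteq> I - {e}"
  shows "\<not> spans (insert w V) d' X"
proof
  assume "spans (insert w V) d' X"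
  then have "reach d' X u w" using ea by (auto simp: spans_def)
  then have "w \<in> V"
  proof (rule reach_closed[OF _ ea(2)])
    show "j \<in> V" if "i \<in> X" "d' i = {k, j}" "k \<in> V" for i k j
      using ends_subset[of i] that X d'(3)[of i] by auto
  qed
  then show False using w by simp
qed

lemma sub_V: "i \<in> X \<Longrightarrow> X \<subseteq> I - {e} \<Longrightarrow> d i \<subseteq> V"
  using ends_subset by blast

text \<open>A tree contains both halves, and then stands for a tree through the old edge, or it avoids one of them; it
  cannot avoid both, since they are the only edges at \<open>w\<close>.\<close>

lemma tree_sum_subdivision:
  "tree_sum (insert w V) d' (insert a I) x y =
    tree_sum V d I (x(e := x e * x a)) (y(e := x e * y a + y e * x a))"
proof -
  define J where "J = I - {e}"
  have J: "finite J" "e \<notin> J" "a \<notin> J" "I = insert e J" using e a finE by (auto simp: J_def)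
  have cV: "card (insert w V) = Suc (card V)" using w finV by simp
  let ?t = "\<lambda>T. of_bool (spans V d T \<and> card T + 1 = card V) :: nat"
  let ?t' = "\<lambda>T. of_bool (spans (insert w V) d' T \<and> card T + 1 = card (insert w V)) :: nat"
  have pt: "?t' X = 0" "?t' (insert a X) = ?t X" "?t' (insert e X) = ?t X"
    "?t' (insert e (insert a X)) = ?t (insert e X)" if X: "X \<in> Pow J" for X
  proof -
    have XJ: "X \<subseteq> J" using X by simp
    have XI: "X \<subseteq> I - {e}" "finite X" "e \<notin> X" "a \<notin> X"
      using XJ J(2,3) finite_subset[OF XJ J(1)] by (auto simp: J_def)
    show "?t' X = 0" using spans_neither[OF XI(1)] by simp
    show "?t' (insert a X) = ?t X" using spans_one(1)[OF XI(1) sub_V[OF _ XI(1)] w ea(3)] XI cV by simp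
    show "?t' (insert e X) = ?t X" using spans_one(2)[OF XI(1) sub_V[OF _ XI(1)] w ea(2)] XI cV by simp
    show "?t' (insert e (insert a X)) = ?t (insert e X)"
      using spans_both[OF XI(1) sub_V[OF _ XI(1)] ea(2,3) w] XI cV ea(1) by simp
  qed
  have "tree_sum (insert w V) d' (insert a I) x y =
     (\<Sum>X\<in>Pow J. ?t X * (x a * y e * wt x y J X) + ?t X * (y a * x e * wt x y J X)
        + ?t (insert e X) * (x a * x e * wt x y J X))"
    unfolding tree_sum_def J(4)
  proof (subst sum_Pow_insert, use J ea in simp, use J ea in simp, subst sum_Pow_insert, use J in simp, use J in simp,
      rule sum.cong)
    fix X assume X: "X \<in> Pow J"
    then have nX: "e \<notin> X" "a \<notin> X" using J by auto
    show "?t' X * wt x y (insert a (insert e J)) X + ?t' (insert a X) * wt x y (insert a (insert e J)) (insert a X) +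
      (?t' (insert e X) * wt x y (insert a (insert e J)) (insert e X) +
       ?t' (insert a (insert e X)) * wt x y (insert a (insert e J)) (insert a (insert e X))) =
      ?t X * (x a * y e * wt x y J X) + ?t X * (y a * x e * wt x y J X) + ?t (insert e X) * (x a * x e * wt x y J X)"
      using pt[OF X] J ea nX
      by (simp add: wt_insert wt_insert_other insert_commute[of a e X] mult.assoc del: One_nat_def)
  qed simp
  also have "\<dots> = tree_sum V d I (x(e := x e * x a)) (y(e := x e * y a + y e * x a))"
    unfolding tree_sum_def J(4)
  proof (subst sum_Pow_insert, use J in simp, use J in simp, rule sum.cong)
    fix X assume X: "X \<in> Pow J"
    then have nX: "e \<notin> X" using J by auto
    show "?t X * (x a * y e * wt x y J X) + ?t X * (y a * x e * wt x y J X) + ?t (insert e X) * (x a * x e * wt x y J X) =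
      ?t X * wt (x(e := x e * x a)) (y(e := x e * y a + y e * x a)) (insert e J) X +
      ?t (insert e X) * wt (x(e := x e * x a)) (y(e := x e * y a + y e * x a)) (insert e J) (insert e X)"
      using J nX by (simp add: wt_insert wt_insert_other wt_upd algebra_simps del: of_bool_eq)
  qed simp
  finally show ?thesis .
qed

end

text \<open>The condition without bridges follows from the condition without cut vertices if there are at least three
  vertices. For two vertices it says that there is more than one edge, as subdividing needs.\<close>

definition block :: "'v set \<Rightarrow> ('e \<Rightarrow> 'v set) \<Rightarrow> 'e set \<Rightarrow> bool" where
  "block V d I \<longleftrightarrow> spans V d I \<and> (\<forall>e\<in>I. spans V d (I - {e})) \<and>
     (\<forall>v\<in>V. spans (V - {v}) d {e \<in> I. v \<notin> d e})"

lemma (in subdivision) block_subdivision: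
  assumes "block V d I" "u \<noteq> v"
  shows "block (insert w V) d' (insert a I)"
proof -
  have I: "insert a I = insert e (insert a (I - {e}))" using e by auto
  have B: "spans V d I" "\<And>g. g \<in> I \<Longrightarrow> spans V d (I - {g})"
    "\<And>z. z \<in> V \<Longrightarrow> spans (V - {z}) d {g \<in> I. z \<notin> d g}" using assms by (auto simp: block_def)
  have subV: "d i \<subseteq> V" if "i \<in> I - {e} - Z" for i Z using ends_subset that by blast
  have both: "spans (insert w V) d' (insert e (insert a (I - {e} - Z))) \<longleftrightarrow> spans V d (insert e (I - {e} - Z))" for Z
    by (rule spans_both) (use subV ea w in blast)+
  have 1: "spans (insert w V) d' (insert a I)"
    using both[of "{}"] B(1) e I by (simp add: insert_absorb)
  have 2: "spans (insert w V) d' (insert a I - {g})" if g: "g \<in> insert a I" for g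
  proof -
    consider "g = a" | "g = e" | "g \<in> I - {e}" using g by blast
    then show ?thesis
    proof cases
      case 1
      have "insert a I - {g} = insert e (I - {e})" using 1 a e by auto
      then show ?thesis using spans_one(2)[of "I - {e}" V] B(2)[OF e(1)] ea w subV[of _ "{}"] by simp
    next
      case 2
      have "insert a I - {g} = insert a (I - {e})" using 2 ea by auto
      then show ?thesis using spans_one(1)[of "I - {e}" V] B(2)[OF e(1)] ea w subV[of _ "{}"] by simp
    next
      case 3
      have "insert a I - {g} = insert e (insert a (I - {e} - {g}))" "insert e (I - {e} - {g}) = I - {g}"
        using 3 a e by auto
      then show ?thesis using both[of "{g}"] B(2)[of g] 3 by simp
    qed
  qed
  have 3: "spans (insert w V - {z}) d' {g \<in> insert a I. z \<notin> d' g}" if z: "z \<in> insert w V" for z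
  proof (cases "z = w")
    case True
    have "{g \<in> insert a I. w \<notin> d' g} = I - {e}"
      using d' e a ends_subset w by (auto simp: subset_iff)
    moreover have "insert w V - {w} = V" using w by auto
    moreover have "spans V d' (I - {e}) \<longleftrightarrow> spans V d (I - {e})"
      unfolding spans_def using reach_cong[of "I - {e}" d' d] d'(3) by metis
    ultimately show ?thesis using B(2)[OF e(1)] True by simp
  next
    case False
    then have zV: "z \<in> V" "insert w V - {z} = insert w (V - {z})" using z by auto
    define X where "X = {g \<in> I - {e}. z \<notin> d g}"
    have X: "X \<subseteq> I - {e}" "\<And>i. i \<in> X \<Longrightarrow> d i \<subseteq> V - {z}" "w \<notin> V - {z}"
      using ends_subset w by (auto simp: X_def)
    have oth: "z \<notin> d' g \<longleftrightarrow> z \<notin> d g" if "g \<in> I - {e}" for g using d'(3)[OF that] by simp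
    consider "z = u" | "z = v" | "z \<noteq> u" "z \<noteq> v" by blast
    then show ?thesis
    proof cases
      case 1
      have "{g \<in> insert a I. z \<notin> d' g} = insert a X" "{g \<in> I. z \<notin> d g} = X"
        using 1 d' e a w ea assms(2) zV oth by (auto simp: X_def)
      then show ?thesis using spans_one(1)[OF X] B(3)[OF zV(1)] ea assms(2) 1 zV by simp
    next
      case 2
      have "{g \<in> insert a I. z \<notin> d' g} = insert e X" "{g \<in> I. z \<notin> d g} = X"
        using 2 d' e a w ea assms(2) zV oth by (auto simp: X_def)
      then show ?thesis using spans_one(2)[OF X] B(3)[OF zV(1)] ea assms(2) 2 zV by simp
    next
      case 3
      have "{g \<in> insert a I. z \<notin> d' g} = insert e (insert a X)" "{g \<in> I. z \<notin> d g} = insert e X"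
        using 3 d' e a w ea zV oth False by (auto simp: X_def)
      then show ?thesis using spans_both[OF X(1,2) _ _ X(3)] B(3)[OF zV(1)] ea 3 zV by simp
    qed
  qed
  show ?thesis unfolding block_def using 1 2 3 by blast
qed

locale doubling = fin_graph V d I for V :: "'v set" and d :: "'e \<Rightarrow> 'v set" and I :: "'e set" +
  fixes f b :: 'e
  assumes f: "f \<in> I" and b: "b \<notin> I" and db: "d b = d f"
begin

lemma reach_double: "reach d (insert b (insert f X)) x y \<longleftrightarrow> reach d (insert f X) x y"
  "reach d (insert b X) x y \<longleftrightarrow> reach d (insert f X) x y"
proof -
  have 1: "reach d A x y" if "reach d B x y" "B \<subseteq> insert b A" "f \<in> A" for A B x y
  proof (rule reach_subst[OF that(1)])
    fix g s t assume g: "g \<in> B" "d g = {s, t}"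
    show "reach d A s t"
    proof (cases "g = b")
      case True
      then show ?thesis using g db that(3) by (intro reach_edge[of f]) auto
    qed (use g that in \<open>auto intro: reach_edge\<close>)
  qed
  have 2: "reach d A x y" if "reach d B x y" "B \<subseteq> insert f A" "b \<in> A" for A B x y
  proof (rule reach_subst[OF that(1)])
    fix g s t assume g: "g \<in> B" "d g = {s, t}"
    show "reach d A s t"
    proof (cases "g = f")
      case True
      then show ?thesis using g db that(3) by (intro reach_edge[of b]) auto
    qed (use g that in \<open>auto intro: reach_edge\<close>)
  qed
  show "reach d (insert b (insert f X)) x y \<longleftrightarrow> reach d (insert f X) x y"
    using 1[of "insert b (insert f X)" x y "insert f X"] reach_mono[of d "insert f X" x y "insert b (insert f X)"]
    by blast
  show "reach d (insert b X) x y \<longleftrightarrow> reach d (insert f X) x y"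
    using 1[of "insert b X" x y "insert f X"] 2[of "insert f X" x y "insert b X"] by blast
qed

text \<open>A tree contains at most one of the two parallel edges.\<close>

lemma tree_sum_doubling:
  "tree_sum V d (insert b I) x y =
    tree_sum V d I (x(f := x f * y b + y f * x b)) (y(f := y f * y b))"
proof -
  define J where "J = I - {f}"
  have bf: "b \<noteq> f" using f b by auto
  have J: "finite J" "f \<notin> J" "b \<notin> J" "I = insert f J" using f b finE by (auto simp: J_def)
  let ?t = "\<lambda>T. of_bool (spans V d T \<and> card T + 1 = card V) :: nat"
  have pt: "?t (insert b X) = ?t (insert f X)" "?t (insert f (insert b X)) = 0" if X: "X \<in> Pow J" for X
  proof -
    have XJ: "X \<subseteq> J" using X by simp
    have XI: "X \<subseteq> I" "insert f X \<subseteq> I" "finite X" "f \<notin> X" "b \<notin> X"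
      using XJ J(2,3,4) finite_subset[OF XJ J(1)] by auto
    show "?t (insert b X) = ?t (insert f X)"
      unfolding spans_def reach_double(2) using XI by simp
    have "\<not> (spans V d (insert f X) \<and> card X + 3 = card V)"
      using spans_card[OF XI(2)] XI by auto
    then show "?t (insert f (insert b X)) = 0"
      unfolding spans_def insert_commute[of f b] reach_double(1) using XI bf by auto
  qed
  have "tree_sum V d (insert b I) x y =
     (\<Sum>X\<in>Pow J. ?t X * (y b * y f * wt x y J X) + ?t (insert f X) * (x b * y f * wt x y J X)
        + ?t (insert f X) * (y b * x f * wt x y J X))"
    unfolding tree_sum_def J(4)
  proof (subst sum_Pow_insert, use J bf in simp, use J bf in simp, subst sum_Pow_insert, use J in simp, use J in simp,
      rule sum.cong)
    fix X assume X: "X \<in> Pow J"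
    then have nX: "f \<notin> X" "b \<notin> X" using J by auto
    show "?t X * wt x y (insert b (insert f J)) X + ?t (insert b X) * wt x y (insert b (insert f J)) (insert b X) +
      (?t (insert f X) * wt x y (insert b (insert f J)) (insert f X) +
       ?t (insert b (insert f X)) * wt x y (insert b (insert f J)) (insert b (insert f X))) =
      ?t X * (y b * y f * wt x y J X) + ?t (insert f X) * (x b * y f * wt x y J X)
        + ?t (insert f X) * (y b * x f * wt x y J X)"
      unfolding insert_commute[of b f X] pt[OF X]
      using J bf nX by (simp add: wt_insert wt_insert_other mult.assoc del: of_bool_eq)
  qed simp
  also have "\<dots> = tree_sum V d I (x(f := x f * y b + y f * x b)) (y(f := y f * y b))"
    unfolding tree_sum_def J(4)
  proof (subst sum_Pow_insert, use J in simp, use J in simp, rule sum.cong)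
    fix X assume X: "X \<in> Pow J"
    then have nX: "f \<notin> X" using J by auto
    show "?t X * (y b * y f * wt x y J X) + ?t (insert f X) * (x b * y f * wt x y J X)
        + ?t (insert f X) * (y b * x f * wt x y J X) =
      ?t X * wt (x(f := x f * y b + y f * x b)) (y(f := y f * y b)) (insert f J) X +
      ?t (insert f X) * wt (x(f := x f * y b + y f * x b)) (y(f := y f * y b)) (insert f J) (insert f X)"
      using J nX by (simp add: wt_insert wt_insert_other wt_upd algebra_simps del: of_bool_eq)
  qed simp
  finally show ?thesis .
qed

lemma block_doubling:
  assumes "block V d I"
  shows "block V d (insert b I)"
proof -
  have B: "spans V d I" "\<And>g. g \<in> I \<Longrightarrow> spans V d (I - {g})"
    "\<And>z. z \<in> V \<Longrightarrow> spans (V - {z}) d {g \<in> I. z \<notin> d g}" using assms by (auto simp: block_def)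
  have "spans V d (insert b I - {g})" if "g \<in> insert b I" for g
  proof -
    from that consider "g = b" | "g = f" | "g \<in> I - {f}" by blast
    then show ?thesis
    proof cases
      case 1
      then have "insert b I - {g} = I" using b by auto
      then show ?thesis using B(1) by simp
    next
      case 2
      then have "insert b I - {g} = insert b (I - {f})" "insert f (I - {f}) = I" using b f by auto
      then show ?thesis using B(1) reach_double(2)[of "I - {f}"] by (simp add: spans_def)
    next
      case 3
      then have "I - {g} \<subseteq> insert b I - {g}" by auto
      then show ?thesis using B(2)[of g] 3 spans_mono by blast
    qed
  qed
  moreover have "spans V d (insert b I)" by (rule spans_mono[OF B(1)]) auto
  moreover have "spans (V - {z}) d {g \<in> insert b I. z \<notin> d g}" if "z \<in> V" for z
    by (rule spans_mono[OF B(3)[OF that]]) auto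
  ultimately show ?thesis unfolding block_def by blast
qed

end

section \<open>Subdividing and doubling edges of a drawing\<close>

context plane_graph
begin

lemma sides_point:
  assumes "e \<in> E" "p \<in> e" "p \<notin> V" "F \<in> faces V E" "p \<in> closure F"
  shows "F \<in> sides V E e"
proof -
  obtain r where r: "r > 0" "\<And>U. U \<in> faces V E \<Longrightarrow> U \<inter> ball p r \<noteq> {} \<Longrightarrow> U \<in> sides V E e"
    using sides_near[OF assms(1-3)] by metis
  have "p \<in> ball p r" using r(1) by simp
  then have "ball p r \<inter> F \<noteq> {}" using open_Int_closure_eq_empty[of "ball p r" F] assms(5) open_ball by blast
  then show ?thesis using r(2)[OF assms(4)] by blast
qed

lemma edge_point: "e \<in> E \<Longrightarrow> \<exists>p. p \<in> e \<and> p \<notin> V"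
proof -
  assume "e \<in> E"
  then have "uncountable e" by (rule edge_uncountable)
  then have "\<not> e \<subseteq> V" using finV countable_finite countable_subset by blast
  then show ?thesis by blast
qed

text \<open>The set of drawn points is the same. A face that has one half of the edge on its frontier lies beside the
  edge.\<close>

lemma subdivision_faces:
  assumes "e \<in> E" "e1 \<union> e2 = e" "w \<in> e1"
    and new: "plane_graph (insert w V) (insert e1 (insert e2 (E - {e})))" (is "plane_graph ?V ?E")
  shows "faces ?V ?E = faces V E" "sides ?V ?E e1 = sides V E e" "sides ?V ?E e2 = sides V E e"
    "\<And>f. sides ?V ?E f = sides V E f"
proof -
  interpret N: plane_graph ?V ?E by fact
  have "?V \<union> \<Union>?E = V \<union> \<Union>E" using assms(1-3) by auto
  then show f: "faces ?V ?E = faces V E" by (simp add: faces_def)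
  then show "sides ?V ?E f = sides V E f" for f by (simp add: sides_def)
  have *: "sides ?V ?E x = sides V E e" if x: "x \<in> {e1, e2}" for x
  proof (intro equalityI subsetI)
    fix F assume F: "F \<in> sides ?V ?E x"
    obtain p where p: "p \<in> x" "p \<notin> ?V" using N.edge_point[of x] x by auto
    have "p \<in> closure F" using F p by (auto simp: sides_def frontier_def)
    moreover have "p \<in> e" using p x assms by auto
    ultimately show "F \<in> sides V E e"
      using sides_point[of e p F] assms(1) p F f by (auto simp: sides_def)
  next
    fix F assume "F \<in> sides V E e"
    then show "F \<in> sides ?V ?E x" using f x assms(2) by (auto simp: sides_def)
  qed
  show "sides ?V ?E e1 = sides V E e" "sides ?V ?E e2 = sides V E e" using *[of e1] *[of e2] by auto
qed

text \<open>A second arc beside an edge cuts off a face that is bounded by these two arcs alone, if some disc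
  around both arcs meets nothing else. In the dual graph the edge is subdivided.\<close>

lemma doubling_faces:
  assumes e: "e \<in> E" "e2 \<in> E" "e \<noteq> e2" "e \<inter> V = e2 \<inter> V" "e \<inter> V = {s, t}"
    and nb: "reach (drawn_ends V) (E - {e2} - {e}) s t"
    and K: "bounded K" "connected (- K)" "e \<union> e2 \<subseteq> K" "K \<inter> (V \<union> \<Union>(E - {e, e2})) \<subseteq> e"
  obtains F F2 D F' where "F \<noteq> F2" "sides V (E - {e2}) e = {F, F2}"
    "faces V E = (faces V (E - {e2}) - {F}) \<union> {D, F'}" "D \<noteq> F'"
    "D \<notin> faces V (E - {e2})" "F' \<notin> faces V (E - {e2}) - {F}"
    "sides V E e = {D, F2}" "sides V E e2 = {D, F'}"
    "\<forall>f\<in>E - {e, e2}. sides V E f = (\<lambda>H. if H = F then F' else H) ` sides V (E - {e2}) f"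
proof -
  define A where "A = E - {e2}"
  have A: "A \<subseteq> E" "e2 \<notin> A" "insert e2 A = E" "e \<in> A" using e by (auto simp: A_def)
  interpret A: plane_graph V A by (rule plane_graph_subset[OF A(1)])
  obtain p where p: "arc p" "path_image p = e" "e \<inter> V = {pathstart p, pathfinish p}"
    using arc_ex[OF e(1)] by blast
  have pA: "path_image p \<subseteq> V \<union> \<Union>A" using p A by blast
  have pe: "e2 \<inter> V = {pathstart p, pathfinish p}" using p e by simp
  obtain c F U1 U2 where c: "F \<in> faces V A" "U1 \<noteq> U2"
    "faces V (insert e2 A) = (faces V A - {F}) \<union> {U1, U2}" "sides V (insert e2 A) e2 = {U1, U2}"
    "U1 = F \<inter> inside (path_image c)" "U2 = F \<inter> outside (path_image c)"
    "simple_path c" "pathfinish c = pathstart c" "path_image c = e2 \<union> path_image p"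
    using insert_arc[OF e(2) A(1,2) p(1) pA pe] .
  define C where "C = e \<union> e2"
  have ic: "path_image c = C" using c p by (auto simp: C_def)
  note J = Jordan_inside_outside[OF c(7,8), unfolded ic]
  define D where "D = inside C"
  have CK: "C \<subseteq> K" using K by (simp add: C_def)
  have "D \<subseteq> K"
  proof -
    have "inside K = {}" using K by (intro inside_bounded_complement_connected_empty) auto
    then have "- K = outside K" using inside_Un_outside[of K] by simp
    then have "- K \<subseteq> outside C" using outside_mono[OF CK] by simp
    then show ?thesis unfolding D_def using inside_Int_outside[of C] by blast
  qed
  have Doff: "D \<inter> (V \<union> \<Union>E) = {}"
  proof -
    have "z \<notin> V \<union> \<Union>E" if z: "z \<in> D" for z
    proof
      assume zz: "z \<in> V \<union> \<Union>E"
      have zC: "z \<notin> C" using z inside_no_overlap[of C] unfolding D_def by blast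
      then have "z \<in> V \<union> \<Union>(E - {e, e2})" using zz by (auto simp: C_def)
      then have "z \<in> e" using K(4) \<open>D \<subseteq> K\<close> z by blast
      then show False using zC by (simp add: C_def)
    qed
    then show ?thesis by blast
  qed
  have U1: "U1 \<in> faces V E" "U2 \<in> faces V E" using c(3) A by auto
  have Fc: "F \<in> components (- (V \<union> \<Union>A))" using c(1) by (simp add: faces_def)
  have DF: "D \<subseteq> F"
  proof (rule components_maximal[OF Fc])
    show "connected D" using J by (simp add: D_def)
    show "D \<subseteq> - (V \<union> \<Union>A)" using Doff A by blast
    show "F \<inter> D \<noteq> {}" using faces_nonempty[OF U1(1)] c(5) ic by (simp add: D_def)
  qed
  then have U1D: "U1 = D" using c(5) ic by (auto simp: D_def)
  define F' where "F' = U2"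
  have frD: "frontier D = C" using J by (simp add: D_def)
  have clD: "closure D = D \<union> C" using closure_Un_frontier[of D] frD by simp
  have D_face: "D \<in> faces V E" and F'_face: "F' \<in> faces V E" using U1 U1D by (auto simp: F'_def)
  have F'F: "F' \<subseteq> F" using c(6) by (auto simp: F'_def)
  have facesE: "faces V E = (faces V A - {F}) \<union> {D, F'}" using c(3) A U1D by (simp add: F'_def)
  have DF': "D \<noteq> F'" using c(2) U1D by (simp add: F'_def)
  have sides2: "sides V E e2 = {D, F'}" using c(4) A U1D by (simp add: F'_def)
  have ne: "D \<noteq> {}" "F' \<noteq> {}" using faces_nonempty D_face F'_face by auto
  have Dn: "D \<notin> faces V A - {F}" "F' \<notin> faces V A - {F}"
    using subface_notin[OF c(1) DF ne(1)] subface_notin[OF c(1) F'F ne(2)] by auto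
  have "D \<noteq> F"
  proof
    assume "D = F"
    then have "F' = {}" using F'F faces_disjoint[OF D_face F'_face DF'] by blast
    then show False using ne by simp
  qed
  then have Dn': "D \<notin> faces V A" using Dn by blast
  obtain q where q: "q \<in> e" "q \<notin> V" using edge_point[OF e(1)] by blast
  have "q \<in> closure F" using q clD closure_mono[OF DF] by (auto simp: C_def)
  then have Fe: "F \<in> sides V A e" by (rule A.sides_point[OF A(4) q c(1)])
  have "reach (drawn_ends V) (A - {e}) s t" using nb by (simp add: A_def)
  then obtain X Y where XY: "X \<noteq> Y" "sides V A e = {X, Y}" using A.sides_nonbridge[OF A(4) e(5)] by metis
  define F2 where "F2 = (if X = F then Y else X)"
  have F2: "F \<noteq> F2" "sides V A e = {F, F2}" using XY Fe by (auto simp: F2_def)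
  have F2_side: "F2 \<in> sides V E e"
    using F2 facesE by (auto simp: sides_def)
  have "e \<subseteq> frontier D" using frD by (auto simp: C_def)
  then have "D \<in> sides V E e" using D_face by (simp add: sides_def)
  moreover have "D \<noteq> F2" using F2 Dn' by (auto simp: sides_def)
  ultimately have sides1: "sides V E e = {D, F2}" using sides_ex[OF e(1)] F2_side by auto
  have other: "sides V E f = (\<lambda>H. if H = F then F' else H) ` sides V A f" if f: "f \<in> E - {e, e2}" for f
  proof -
    have fA: "f \<in> A" "f \<in> E" using f by (auto simp: A_def)
    have fC: "f \<inter> C \<subseteq> V" using edges_meet[of f e] edges_meet[of f e2] f e by (auto simp: C_def)
    obtain z where z: "z \<in> f" "z \<notin> V" using edge_point[OF fA(2)] by blast
    have zC: "z \<notin> C" "z \<notin> D" using z fC Doff fA by blast+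
    have F_iff: "F' \<in> sides V E f \<longleftrightarrow> F \<in> sides V A f"
    proof
      assume "F' \<in> sides V E f"
      then have "z \<in> closure F'" using z by (auto simp: sides_def frontier_def)
      then have "z \<in> closure F" using closure_mono[OF F'F] by blast
      then show "F \<in> sides V A f" by (rule A.sides_point[OF fA(1) z c(1)])
    next
      assume "F \<in> sides V A f"
      then have zF: "z \<in> closure F" using z by (auto simp: sides_def frontier_def)
      have "F \<subseteq> closure D \<union> closure F'"
      proof
        fix y assume y: "y \<in> F"
        have "y \<notin> e" using y in_components_subset[OF Fc] A(4) by blast
        moreover have "e2 \<subseteq> closure F'" using sides2 by (auto simp: sides_def frontier_def)
        moreover have "F' = F \<inter> outside C" using c(6) ic by (simp add: F'_def)
        then have "y \<in> D \<or> y \<in> F' \<or> y \<in> C" using y inside_Un_outside[of C] unfolding D_def by blast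
        ultimately show "y \<in> closure D \<union> closure F'" using closure_subset by (auto simp: C_def)
      qed
      then have "closure F \<subseteq> closure D \<union> closure F'"
        by (rule closure_minimal) auto
      then have "z \<in> closure F'" using zF zC clD by blast
      then show "F' \<in> sides V E f" by (rule sides_point[OF fA(2) z F'_face])
    qed
    have "D \<notin> sides V E f"
      using z zC frD by (auto simp: sides_def)
    moreover have "H \<in> sides V E f \<longleftrightarrow> H \<in> sides V A f" if "H \<in> faces V A - {F}" for H
      using that facesE by (auto simp: sides_def)
    moreover have "sides V E f \<subseteq> (faces V A - {F}) \<union> {D, F'}" "sides V A f \<subseteq> faces V A"
      using facesE by (auto simp: sides_def)
    ultimately show ?thesis using F_iff Dn(2) by (auto simp: image_iff split: if_splits)
  qed
  show thesis
    by (rule that[of F F2 D F', folded A_def])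
      (use F2 facesE DF' Dn' Dn(2) sides1 sides2 other in \<open>simp_all\<close>)
qed

end

section \<open>Edges with room beside them\<close>

text \<open>A square with the unit interval as a diagonal. An edge that is drawn as the image of the diagonal under an
  embedding of the whole square has room for parallel edges beside it, so that all drawings can be modified
  without further topology.\<close>

definition lens :: "complex set" where
  "lens = {z. \<bar>Im z\<bar> \<le> Re z \<and> \<bar>Im z\<bar> \<le> 1 - Re z}"

definition seg :: "(complex \<Rightarrow> complex) \<Rightarrow> complex set" where
  "seg M = (\<lambda>t. M (of_real t)) ` {0..1}"

definition lens_ends :: "('i \<Rightarrow> complex \<Rightarrow> complex) \<Rightarrow> 'i \<Rightarrow> complex set" where
  "lens_ends L i = {L i 0, L i 1}"

definition lens_drawing :: "complex set \<Rightarrow> 'i set \<Rightarrow> ('i \<Rightarrow> complex \<Rightarrow> complex) \<Rightarrow> bool" where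
  "lens_drawing V I L \<longleftrightarrow> finite V \<and> V \<noteq> {} \<and> finite I \<and>
     (\<forall>i\<in>I. continuous_on lens (L i) \<and> inj_on (L i) lens \<and> L i ` lens \<inter> V = lens_ends L i) \<and>
     (\<forall>i\<in>I. \<forall>j\<in>I. i \<noteq> j \<longrightarrow> L i ` lens \<inter> L j ` lens \<subseteq> V)"

lemma real_in_lens [simp]: "0 \<le> t \<Longrightarrow> t \<le> 1 \<Longrightarrow> of_real t \<in> lens"
  by (simp add: lens_def)

lemma ends_in_lens [simp]: "0 \<in> lens" "1 \<in> lens" "1 / 2 \<in> lens"
  by (simp_all add: lens_def)

lemma seg_subset: "seg M \<subseteq> M ` lens"
  by (auto simp: seg_def)

lemma compact_lens: "compact lens"
proof -
  have "lens \<subseteq> cball 0 2"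
  proof
    fix z assume z: "z \<in> lens"
    have "norm z \<le> \<bar>Re z\<bar> + \<bar>Im z\<bar>" by (rule cmod_le)
    then show "z \<in> cball 0 2" using z by (auto simp: lens_def)
  qed
  moreover have "closed lens"
    unfolding lens_def by (intro closed_Collect_conj closed_Collect_le continuous_intros)
  ultimately show ?thesis using compact_cball closed_Int_compact[of lens "cball 0 2"]
    by (simp add: Int_absorb2)
qed

lemma convex_lens: "convex lens"
proof -
  have H: "convex {z. a * Re z + b * Im z \<le> c}" for a b c :: real
    using convex_halfspace_le[of "Complex a b" c] by (simp add: inner_complex_def mult.commute)
  have eq: "lens = {z. (- 1) * Re z + 1 * Im z \<le> 0} \<inter> {z. (- 1) * Re z + (- 1) * Im z \<le> 0} \<inter>
      {z. 1 * Re z + 1 * Im z \<le> 1} \<inter> {z. 1 * Re z + (- 1) * Im z \<le> 1}"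
    unfolding lens_def by (auto simp: abs_le_iff)
  show ?thesis unfolding eq by (intro convex_Int H)
qed

lemma arc_seg:
  assumes "continuous_on lens M" "inj_on M lens"
  shows "arc (\<lambda>t. M (of_real t))" "path_image (\<lambda>t. M (of_real t)) = seg M"
proof -
  have "continuous_on {0..1} (\<lambda>t::real. M (of_real t))"
    by (rule continuous_on_compose2[OF assms(1)]) (auto intro: continuous_intros)
  moreover have "inj_on (\<lambda>t::real. M (of_real t)) {0..1}"
  proof (rule inj_onI)
    fix x y :: real assume xy: "x \<in> {0..1}" "y \<in> {0..1}" "M (of_real x) = M (of_real y)"
    have "of_real x \<in> lens" "of_real y \<in> lens" using xy by simp_all
    then have "(of_real x :: complex) = of_real y" by (rule inj_onD[OF assms(2) xy(3)])
    then show "x = y" by simp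
  qed
  ultimately show "arc (\<lambda>t. M (of_real t))" by (simp add: arc_def path_def)
  show "path_image (\<lambda>t. M (of_real t)) = seg M" by (simp add: path_image_def seg_def)
qed

lemma lens_image_disc:
  fixes M :: "complex \<Rightarrow> complex"
  assumes "continuous_on lens M" "inj_on M lens"
  shows "bounded (M ` lens)" "connected (- (M ` lens))"
proof -
  show "bounded (M ` lens)" using compact_continuous_image[OF assms(1) compact_lens] compact_imp_bounded by blast
  obtain N where "homeomorphism lens (M ` lens) M N"
    using homeomorphism_compact[OF compact_lens assms(1) refl assms(2)] by blast
  then have "M ` lens homeomorphic lens" using homeomorphic_def homeomorphic_sym by blast
  then have "path_connected (- (M ` lens))"
    using path_connected_complement_homeomorphic_convex_compact[of "M ` lens" lens] convex_lens compact_lens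
    by simp
  then show "connected (- (M ` lens))" by (rule path_connected_imp_connected)
qed

lemma lens_drawingD:
  assumes "lens_drawing V I L" "i \<in> I"
  shows "continuous_on lens (L i)" "inj_on (L i) lens" "L i ` lens \<inter> V = lens_ends L i"
    "arc (\<lambda>t. L i (of_real t))" "seg (L i) \<inter> V = lens_ends L i" "L i 0 \<noteq> L i 1" "L i 0 \<in> V" "L i 1 \<in> V"
proof -
  show 1: "continuous_on lens (L i)" "inj_on (L i) lens" "L i ` lens \<inter> V = lens_ends L i"
    using assms by (auto simp: lens_drawing_def)
  show "arc (\<lambda>t. L i (of_real t))" by (rule arc_seg[OF 1(1,2)])
  have "(\<lambda>t. L i (of_real t)) 0 \<in> seg (L i)" "(\<lambda>t. L i (of_real t)) 1 \<in> seg (L i)"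
    unfolding seg_def by (rule imageI, simp)+
  then have "L i 0 \<in> seg (L i)" "L i 1 \<in> seg (L i)" by simp_all
  then show "seg (L i) \<inter> V = lens_ends L i" using 1(3) seg_subset[of "L i"] by (auto simp: lens_ends_def)
  show "L i 0 \<noteq> L i 1" using inj_onD[OF 1(2), of 0 1] by auto
  show "L i 0 \<in> V" "L i 1 \<in> V" using 1(3) by (auto simp: lens_ends_def)
qed

abbreviation lens_edges :: "'i set \<Rightarrow> ('i \<Rightarrow> complex \<Rightarrow> complex) \<Rightarrow> complex set set" where
  "lens_edges I L \<equiv> (\<lambda>i. seg (L i)) ` I"

lemma lens_plane_graph:
  assumes "lens_drawing V I L"
  shows "plane_graph V (lens_edges I L)"
proof
  have "seg (L i) \<inter> seg (L j) \<subseteq> V" if "i \<in> I" "j \<in> I" "seg (L i) \<noteq> seg (L j)" for i j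
  proof -
    have "i \<noteq> j" using that by auto
    then have "L i ` lens \<inter> L j ` lens \<subseteq> V" using assms that unfolding lens_drawing_def by simp
    then show ?thesis using seg_subset[of "L i"] seg_subset[of "L j"] by blast
  qed
  moreover have "\<exists>g. arc g \<and> path_image g = seg (L i) \<and> seg (L i) \<inter> V = {pathstart g, pathfinish g}"
    if "i \<in> I" for i
    using lens_drawingD[OF assms that] arc_seg[of "L i"]
    by (intro exI[of _ "\<lambda>t. L i (of_real t)"]) (auto simp: pathstart_def pathfinish_def lens_ends_def)
  ultimately show "plane_drawing V (lens_edges I L)"
    using assms unfolding plane_drawing_def by (auto simp: lens_drawing_def)
qed

lemma lens_inj:
  assumes "lens_drawing V I L"
  shows "inj_on (\<lambda>i. seg (L i)) I"
proof (rule inj_onI, rule ccontr)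
  fix i j assume ij: "i \<in> I" "j \<in> I" "seg (L i) = seg (L j)" "i \<noteq> j"
  interpret plane_graph V "lens_edges I L" by (rule lens_plane_graph[OF assms])
  obtain p where "p \<in> seg (L i)" "p \<notin> V" using edge_point[of "seg (L i)"] ij by blast
  moreover have "L i ` lens \<inter> L j ` lens \<subseteq> V" using assms ij unfolding lens_drawing_def by simp
  ultimately show False using ij(3) seg_subset[of "L i"] seg_subset[of "L j"] by blast
qed

lemma lens_fin_graph:
  assumes "lens_drawing V I L"
  shows "fin_graph V (lens_ends L) I"
proof
  show "\<exists>u\<in>V. \<exists>v\<in>V. lens_ends L i = {u, v}" if "i \<in> I" for i
    using lens_drawingD(7,8)[OF assms that] by (auto simp: lens_ends_def)
qed (use assms in \<open>auto simp: lens_drawing_def\<close>)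

definition lens_left :: "complex \<Rightarrow> complex" where "lens_left z = z / 2"
definition lens_right :: "complex \<Rightarrow> complex" where "lens_right z = (z + 1) / 2"
text \<open>Two thin copies of the square along the diagonal and above it, which meet in the common end points only.\<close>

definition lens_middle :: "complex \<Rightarrow> complex" where "lens_middle z = Complex (Re z) (Im z / 8)"
definition lens_upper :: "complex \<Rightarrow> complex" where
  "lens_upper z = Complex (Re z) (Im z / 4 + min (Re z) (1 - Re z) / 2)"

lemma sublenses:
  "lens_left ` lens \<subseteq> lens" "lens_right ` lens \<subseteq> lens" "lens_middle ` lens \<subseteq> lens" "lens_upper ` lens \<subseteq> lens"
  "inj lens_left" "inj lens_right" "inj lens_middle" "inj lens_upper"
  "continuous_on S lens_left" "continuous_on S lens_right" "continuous_on S lens_middle" "continuous_on S lens_upper"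
proof -
  show "lens_left ` lens \<subseteq> lens" "lens_right ` lens \<subseteq> lens" "lens_middle ` lens \<subseteq> lens" "lens_upper ` lens \<subseteq> lens"
    unfolding lens_def lens_left_def lens_right_def lens_middle_def lens_upper_def image_subset_iff
    by (auto simp: min_def abs_le_iff field_simps)
  show "inj lens_left" "inj lens_right" "inj lens_middle" "inj lens_upper"
    by (auto simp: inj_def lens_left_def lens_right_def lens_middle_def lens_upper_def complex_eq_iff)
  show "continuous_on S lens_left" "continuous_on S lens_right" "continuous_on S lens_middle" "continuous_on S lens_upper"
    unfolding lens_left_def lens_right_def lens_middle_def lens_upper_def
    by (intro continuous_intros; simp)+
qed

lemma sublens_ends [simp]:
  "lens_left 0 = 0" "lens_left 1 = 1 / 2" "lens_right 0 = 1 / 2" "lens_right 1 = 1"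
  "lens_middle 0 = 0" "lens_middle 1 = 1" "lens_upper 0 = 0" "lens_upper 1 = 1"
  by (simp_all add: lens_left_def lens_right_def lens_middle_def lens_upper_def complex_eq_iff)

lemma sublens_meet:
  assumes "z \<in> lens" "z' \<in> lens"
  shows "lens_left z = lens_right z' \<Longrightarrow> z = 1" "lens_middle z = lens_upper z' \<Longrightarrow> z = 0 \<or> z = 1"
    "lens_left z = 0 \<Longrightarrow> z = 0" "lens_left z \<noteq> 1" "lens_right z \<noteq> 0" "lens_right z = 1 \<Longrightarrow> z = 1"
    "lens_middle z = 0 \<Longrightarrow> z = 0" "lens_middle z = 1 \<Longrightarrow> z = 1" "lens_upper z = 0 \<Longrightarrow> z = 0" "lens_upper z = 1 \<Longrightarrow> z = 1"
proof -
  show "lens_left z = lens_right z' \<Longrightarrow> z = 1"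
    using assms by (auto simp: lens_def lens_left_def lens_right_def complex_eq_iff)
  show "lens_middle z = lens_upper z' \<Longrightarrow> z = 0 \<or> z = 1"
    using assms by (auto simp: lens_def lens_middle_def lens_upper_def complex_eq_iff min_def split: if_splits)
qed (use assms in \<open>auto simp: lens_def lens_left_def lens_right_def lens_middle_def lens_upper_def complex_eq_iff min_def split: if_splits\<close>)

lemma sublens_part:
  assumes "continuous_on lens M" "inj_on M lens" "S ` lens \<subseteq> lens" "inj S" "continuous_on lens S"
  shows "continuous_on lens (M \<circ> S)" "inj_on (M \<circ> S) lens" "(M \<circ> S) ` lens \<subseteq> M ` lens"
proof -
  show "continuous_on lens (M \<circ> S)"
    by (rule continuous_on_compose[OF assms(5) continuous_on_subset[OF assms(1,3)]])
  show "inj_on (M \<circ> S) lens"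
    by (rule comp_inj_on[OF inj_on_subset[OF assms(4)] inj_on_subset[OF assms(2,3)]]) simp
  show "(M \<circ> S) ` lens \<subseteq> M ` lens" using assms(3) by auto
qed

lemma lens_midpoint:
  assumes "lens_drawing V I L" "e \<in> I"
  shows "L e (1 / 2) \<notin> V"
proof
  note D = lens_drawingD[OF assms]
  assume "L e (1 / 2) \<in> V"
  then have "L e (1 / 2) \<in> lens_ends L e" using D(3) by auto
  then show False using inj_onD[OF D(2), of "1 / 2" 0] inj_onD[OF D(2), of "1 / 2" 1] by (auto simp: lens_ends_def)
qed

lemma lens_subdivide:
  assumes L: "lens_drawing V I L" and e: "e \<in> I" "a \<notin> I"
  defines "L' \<equiv> L(e := L e \<circ> lens_left, a := L e \<circ> lens_right)"
  shows "lens_drawing (insert (L e (1 / 2)) V) (insert a I) L'"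
proof -
  define M where "M = L e"
  define w where "w = M (1 / 2)"
  note D = lens_drawingD[OF L e(1), folded M_def]
  have ea: "e \<noteq> a" using e by auto
  have w: "w \<notin> V" using lens_midpoint[OF L e(1)] by (simp add: w_def M_def)
  have L': "L' e = M \<circ> lens_left" "L' a = M \<circ> lens_right" "\<And>i. i \<in> I - {e} \<Longrightarrow> L' i = L i"
    using ea e by (auto simp: L'_def M_def)
  note pl = sublens_part[OF D(1,2) sublenses(1,5,9)] and pr = sublens_part[OF D(1,2) sublenses(2,6,10)]
  have MV: "M z \<in> V \<Longrightarrow> z \<in> lens \<Longrightarrow> z = 0 \<or> z = 1" for z
    using D(3) inj_onD[OF D(2), of z 0] inj_onD[OF D(2), of z 1] by (auto simp: lens_ends_def M_def)
  have lin: "lens_left z \<in> lens" "lens_right z \<in> lens" if "z \<in> lens" for z using sublenses(1,2) that by auto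
  have el: "(M \<circ> lens_left) ` lens \<inter> insert w V = lens_ends L' e"
  proof (intro equalityI subsetI)
    fix x assume x: "x \<in> (M \<circ> lens_left) ` lens \<inter> insert w V"
    then obtain z where z: "z \<in> lens" "x = M (lens_left z)" by auto
    show "x \<in> lens_ends L' e"
    proof (cases "x = w")
      case False
      then have "M (lens_left z) \<in> V" using x z by auto
      then have "lens_left z = 0" using MV[OF _ lin(1)[OF z(1)]] sublens_meet(4)[OF z(1) z(1)] by auto
      then show ?thesis using z by (simp add: lens_ends_def L')
    qed (simp add: lens_ends_def L' w_def)
  next
    fix x assume "x \<in> lens_ends L' e"
    then have "x = (M \<circ> lens_left) 0 \<or> x = (M \<circ> lens_left) 1" by (simp add: lens_ends_def L')
    moreover from this have "x \<in> (M \<circ> lens_left) ` lens" using ends_in_lens(1,2) by (metis imageI)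
    ultimately show "x \<in> (M \<circ> lens_left) ` lens \<inter> insert w V" using D(7) by (auto simp: w_def)
  qed
  have er: "(M \<circ> lens_right) ` lens \<inter> insert w V = lens_ends L' a"
  proof (intro equalityI subsetI)
    fix x assume x: "x \<in> (M \<circ> lens_right) ` lens \<inter> insert w V"
    then obtain z where z: "z \<in> lens" "x = M (lens_right z)" by auto
    show "x \<in> lens_ends L' a"
    proof (cases "x = w")
      case False
      then have "M (lens_right z) \<in> V" using x z by auto
      then have "lens_right z = 1" using MV[OF _ lin(2)[OF z(1)]] sublens_meet(5)[OF z(1) z(1)] by auto
      then show ?thesis using z by (simp add: lens_ends_def L')
    qed (simp add: lens_ends_def L' w_def)
  next
    fix x assume "x \<in> lens_ends L' a"
    then have "x = (M \<circ> lens_right) 0 \<or> x = (M \<circ> lens_right) 1" by (simp add: lens_ends_def L')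
    moreover from this have "x \<in> (M \<circ> lens_right) ` lens" using ends_in_lens(1,2) by (metis imageI)
    ultimately show "x \<in> (M \<circ> lens_right) ` lens \<inter> insert w V" using D(8) by (auto simp: w_def)
  qed
  have old: "L i ` lens \<inter> M ` lens \<subseteq> V" if "i \<in> I - {e}" for i
    using L e that unfolding lens_drawing_def M_def by auto
  have wM: "w \<in> M ` lens" by (simp add: w_def)
  have eo: "L' i ` lens \<inter> insert w V = lens_ends L' i" if i: "i \<in> I - {e}" for i
  proof -
    have "w \<notin> L i ` lens" using old[OF i] w wM by blast
    then show ?thesis using lens_drawingD(3)[OF L, of i] i L'(3)[OF i] by (auto simp: lens_ends_def)
  qed
  have ends: "L' i ` lens \<inter> insert w V = lens_ends L' i" if i: "i \<in> insert a I" for i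
  proof -
    from i consider "i = e" | "i = a" | "i \<in> I - {e}" by blast
    then show ?thesis using el er eo by cases (simp_all add: L')
  qed
  have lr: "(M \<circ> lens_left) ` lens \<inter> (M \<circ> lens_right) ` lens \<subseteq> insert w V"
  proof
    fix x assume "x \<in> (M \<circ> lens_left) ` lens \<inter> (M \<circ> lens_right) ` lens"
    then obtain z z' where z: "z \<in> lens" "z' \<in> lens" "x = M (lens_left z)" "M (lens_left z) = M (lens_right z')" by auto
    then have "lens_left z = lens_right z'" using inj_onD[OF D(2) z(4)] lin by blast
    then have "z = 1" using sublens_meet(1)[OF z(1,2)] by blast
    then show "x \<in> insert w V" using z by (simp add: w_def)
  qed
  have inM: "L' i ` lens \<subseteq> M ` lens" if "i \<in> {e, a}" for i using that pl pr L' by auto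
  have meet: "L' i ` lens \<inter> L' j ` lens \<subseteq> insert w V" if ij: "i \<in> insert a I" "j \<in> insert a I" "i \<noteq> j" for i j
  proof -
    consider "i \<in> {e, a}" "j \<in> {e, a}" | "i \<in> {e, a}" "j \<in> I - {e}" | "i \<in> I - {e}" "j \<in> {e, a}" |
      "i \<in> I - {e}" "j \<in> I - {e}" using ij(1,2) by blast
    then show ?thesis
    proof cases
      case 1
      then have "(i = e \<and> j = a) \<or> (i = a \<and> j = e)" using ij(3) by auto
      then show ?thesis using lr L'(1,2) by (metis Int_commute)
    next
      case 2
      then show ?thesis using inM[OF 2(1)] old[OF 2(2)] L'(3)[OF 2(2)] by auto
    next
      case 3
      then show ?thesis using inM[OF 3(2)] old[OF 3(1)] L'(3)[OF 3(1)] by auto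
    next
      case 4
      then have "L i ` lens \<inter> L j ` lens \<subseteq> V" using L ij(3) by (simp add: lens_drawing_def)
      then show ?thesis using L'(3) 4 by auto
    qed
  qed
  have "continuous_on lens (L' i) \<and> inj_on (L' i) lens" if i: "i \<in> insert a I" for i
  proof -
    from i consider "i = e" | "i = a" | "i \<in> I - {e}" by blast
    then show ?thesis using pl pr lens_drawingD(1,2)[OF L, of i] by cases (simp_all add: L')
  qed
  moreover have "finite (insert w V)" "insert w V \<noteq> {}" "finite (insert a I)"
    using L by (auto simp: lens_drawing_def)
  ultimately have "lens_drawing (insert w V) (insert a I) L'"
    unfolding lens_drawing_def using ends meet by simp
  then show ?thesis by (simp add: w_def M_def)
qed

lemma lens_double:
  assumes L: "lens_drawing V I L" and f: "f \<in> I" "b \<notin> I"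
  defines "L' \<equiv> L(f := L f \<circ> lens_middle, b := L f \<circ> lens_upper)"
  shows "lens_drawing V (insert b I) L'"
proof -
  define M where "M = L f"
  note D = lens_drawingD[OF L f(1), folded M_def]
  have fb: "f \<noteq> b" using f by auto
  have L': "L' f = M \<circ> lens_middle" "L' b = M \<circ> lens_upper" "\<And>i. i \<in> I - {f} \<Longrightarrow> L' i = L i"
    using fb f by (auto simp: L'_def M_def)
  note pm = sublens_part[OF D(1,2) sublenses(3,7,11)] and pu = sublens_part[OF D(1,2) sublenses(4,8,12)]
  have lin: "lens_middle z \<in> lens" "lens_upper z \<in> lens" if "z \<in> lens" for z using sublenses(3,4) that by auto
  have Mends: "M ` lens \<inter> V = {M 0, M 1}" using D(3) by (simp add: lens_ends_def M_def)
  have ends2: "(M \<circ> S) ` lens \<inter> V = {M 0, M 1}" if S: "S 0 = 0" "S 1 = 1" "(M \<circ> S) ` lens \<subseteq> M ` lens" for S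
  proof -
    have "M 0 = (M \<circ> S) 0" "M 1 = (M \<circ> S) 1" using S by simp_all
    then have "M 0 \<in> (M \<circ> S) ` lens" "M 1 \<in> (M \<circ> S) ` lens" using ends_in_lens by (metis imageI)+
    then show ?thesis using S(3) Mends by blast
  qed
  have old: "L i ` lens \<inter> M ` lens \<subseteq> V" if "i \<in> I - {f}" for i
    using L f that unfolding lens_drawing_def M_def by auto
  have inM: "L' i ` lens \<subseteq> M ` lens" if "i \<in> {f, b}" for i using that pm pu L' by auto
  have mu: "(M \<circ> lens_middle) ` lens \<inter> (M \<circ> lens_upper) ` lens \<subseteq> V"
  proof
    fix x assume "x \<in> (M \<circ> lens_middle) ` lens \<inter> (M \<circ> lens_upper) ` lens"
    then obtain z z' where z: "z \<in> lens" "z' \<in> lens" "x = M (lens_middle z)" "M (lens_middle z) = M (lens_upper z')" by auto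
    then have "lens_middle z = lens_upper z'" using inj_onD[OF D(2) z(4)] lin by blast
    then have "z = 0 \<or> z = 1" using sublens_meet(2)[OF z(1,2)] by blast
    then show "x \<in> V" using z D(7,8) by auto
  qed
  have meet: "L' i ` lens \<inter> L' j ` lens \<subseteq> V" if ij: "i \<in> insert b I" "j \<in> insert b I" "i \<noteq> j" for i j
  proof -
    consider "i \<in> {f, b}" "j \<in> {f, b}" | "i \<in> {f, b}" "j \<in> I - {f}" | "i \<in> I - {f}" "j \<in> {f, b}" |
      "i \<in> I - {f}" "j \<in> I - {f}" using ij(1,2) by blast
    then show ?thesis
    proof cases
      case 1
      then have "(i = f \<and> j = b) \<or> (i = b \<and> j = f)" using ij(3) by auto
      then show ?thesis using mu L'(1,2) by (metis Int_commute)
    next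
      case 2
      then show ?thesis using inM[OF 2(1)] old[OF 2(2)] L'(3)[OF 2(2)] by auto
    next
      case 3
      then show ?thesis using inM[OF 3(2)] old[OF 3(1)] L'(3)[OF 3(1)] by auto
    next
      case 4
      then have "L i ` lens \<inter> L j ` lens \<subseteq> V" using L ij(3) by (simp add: lens_drawing_def)
      then show ?thesis using L'(3) 4 by auto
    qed
  qed
  have "continuous_on lens (L' i) \<and> inj_on (L' i) lens \<and> L' i ` lens \<inter> V = lens_ends L' i" if i: "i \<in> insert b I" for i
  proof -
    from i consider "i = f" | "i = b" | "i \<in> I - {f}" by blast
    then show ?thesis
    proof cases
      case 1
      then show ?thesis using pm ends2[OF _ _ pm(3)] by (simp add: L' lens_ends_def)
    next
      case 2
      then show ?thesis using pu ends2[OF _ _ pu(3)] by (simp add: L' lens_ends_def)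
    next
      case 3
      then show ?thesis using lens_drawingD(1,2,3)[OF L, of i] L'(3)[OF 3] by (auto simp: lens_ends_def)
    qed
  qed
  moreover have "finite V" "V \<noteq> {}" "finite (insert b I)"
    using L by (auto simp: lens_drawing_def)
  ultimately show ?thesis
    unfolding lens_drawing_def using meet by simp
qed

lemma seg_parts:
  "seg (M \<circ> lens_left) \<union> seg (M \<circ> lens_right) = seg M" "M (1 / 2) \<in> seg (M \<circ> lens_left)"
  "seg (M \<circ> lens_middle) = seg M"
proof -
  have l: "lens_left (of_real t) = of_real (t / 2)" and r: "lens_right (of_real t) = of_real ((t + 1) / 2)"
    and m: "lens_middle (of_real t) = of_real t" for t
    by (simp_all add: lens_left_def lens_right_def lens_middle_def complex_eq_iff)
  show "seg (M \<circ> lens_middle) = seg M" by (simp add: seg_def m)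
  have "(\<lambda>t::real. t / 2) ` {0..1} = {0..1/2}" "(\<lambda>t::real. (t + 1) / 2) ` {0..1} = {1/2..1}"
  proof -
    show "(\<lambda>t::real. t / 2) ` {0..1} = {0..1/2}"
    proof (intro equalityI subsetI)
      fix x :: real assume "x \<in> {0..1/2}"
      then show "x \<in> (\<lambda>t. t / 2) ` {0..1}" by (intro image_eqI[of _ _ "2 * x"]) auto
    qed auto
    show "(\<lambda>t::real. (t + 1) / 2) ` {0..1} = {1/2..1}"
    proof (intro equalityI subsetI)
      fix x :: real assume "x \<in> {1/2..1}"
      then show "x \<in> (\<lambda>t. (t + 1) / 2) ` {0..1}" by (intro image_eqI[of _ _ "2 * x - 1"]) auto
    qed auto
  qed
  moreover have "seg (M \<circ> lens_left) = (\<lambda>t::real. M (of_real t)) ` (\<lambda>t. t / 2) ` {0..1}"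
    "seg (M \<circ> lens_right) = (\<lambda>t::real. M (of_real t)) ` (\<lambda>t. (t + 1) / 2) ` {0..1}"
    unfolding seg_def image_image comp_def l r by simp_all
  ultimately have s: "seg (M \<circ> lens_left) = (\<lambda>t::real. M (of_real t)) ` {0..1/2}"
    "seg (M \<circ> lens_right) = (\<lambda>t::real. M (of_real t)) ` {1/2..1}" by simp_all
  have un: "{0..1/2} \<union> {1/2..1} = {0..1::real}" by auto
  show "seg (M \<circ> lens_left) \<union> seg (M \<circ> lens_right) = seg M"
    unfolding s unfolding seg_def image_Un[symmetric] un ..
  have "(\<lambda>t::real. M (of_real t)) (1/2) \<in> seg (M \<circ> lens_left)" unfolding s by (rule imageI) simp
  then show "M (1 / 2) \<in> seg (M \<circ> lens_left)" by simp
qed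

lemma reach_edge_image: "reach d (A ` T) x y \<longleftrightarrow> reach (\<lambda>i. d (A i)) T x y"
  by (simp add: reach_def)

lemma spans_edge_image: "spans V d (A ` T) \<longleftrightarrow> spans V (\<lambda>i. d (A i)) T"
  by (simp add: spans_def reach_edge_image)

section \<open>Polarities\<close>

text \<open>A self-dual drawing with the isomorphism \<open>\<phi>\<close> on vertices and \<open>\<sigma>\<close> on
  edges. The fixed point free involution lets an edge and its image be changed independently.\<close>

definition polar :: "complex set \<Rightarrow> 'i set \<Rightarrow> ('i \<Rightarrow> complex \<Rightarrow> complex) \<Rightarrow> ('i \<Rightarrow> 'i) \<Rightarrow> (complex \<Rightarrow> complex set) \<Rightarrow> bool" where
  "polar V I L \<sigma> \<phi> \<longleftrightarrow> lens_drawing V I L \<and> block V (lens_ends L) I \<and>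
     bij_betw \<phi> V (faces V (lens_edges I L)) \<and> (\<forall>i\<in>I. \<sigma> i \<in> I \<and> \<sigma> (\<sigma> i) = i \<and> \<sigma> i \<noteq> i) \<and>
     (\<forall>i\<in>I. sides V (lens_edges I L) (seg (L (\<sigma> i))) = \<phi> ` lens_ends L i)"

text \<open>The edge \<open>e\<close> is subdivided by a vertex \<open>w\<close> and \<open>\<sigma> e\<close> is
  doubled. The thin face \<open>D\<close> between the two copies of \<open>\<sigma> e\<close> becomes the
  image of \<open>w\<close>, and the halves of \<open>e\<close> are matched with the copies according to the
  faces beside them.\<close>

lemma polar_step:
  assumes P: "polar V I L \<sigma> \<phi>" and e: "e \<in> I" and ab: "a \<notin> I" "b \<notin> I" "a \<noteq> b"
  obtains V' L' \<sigma>' \<phi>' where "polar V' (insert a (insert b I)) L' \<sigma>' \<phi>'"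
    "\<And>i. i \<in> I - {e, \<sigma> e} \<Longrightarrow> \<sigma>' i = \<sigma> i" "\<sigma>' e = \<sigma> e \<or> \<sigma>' e = b"
    "\<And>x y. tree_sum V' (lens_ends L') (insert a (insert b I)) x y = tree_sum V (lens_ends L) I
      (x(e := x e * x a, \<sigma> e := x (\<sigma> e) * y b + y (\<sigma> e) * x b))
      (y(e := x e * y a + y e * x a, \<sigma> e := y (\<sigma> e) * y b))"
proof -
  define f where "f = \<sigma> e"
  have L: "lens_drawing V I L" and B: "block V (lens_ends L) I"
    and bij: "bij_betw \<phi> V (faces V (lens_edges I L))"
    and \<sigma>: "\<And>i. i \<in> I \<Longrightarrow> \<sigma> i \<in> I \<and> \<sigma> (\<sigma> i) = i \<and> \<sigma> i \<noteq> i"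
    and sd: "\<And>i. i \<in> I \<Longrightarrow> sides V (lens_edges I L) (seg (L (\<sigma> i))) = \<phi> ` lens_ends L i"
    using P by (auto simp: polar_def)
  have f: "f \<in> I" "f \<noteq> e" "\<sigma> f = e" using \<sigma>[OF e] by (auto simp: f_def)
  define w where "w = L e (1 / 2)"
  define V1 where "V1 = insert w V"
  define I1 where "I1 = insert a I"
  define L1 where "L1 = L(e := L e \<circ> lens_left, a := L e \<circ> lens_right)"
  define I2 where "I2 = insert b I1"
  define L2 where "L2 = L1(f := L1 f \<circ> lens_middle, b := L1 f \<circ> lens_upper)"
  have ne: "e \<noteq> a" "e \<noteq> b" "f \<noteq> a" "f \<noteq> b" using e f ab by auto
  have w: "w \<notin> V" unfolding w_def by (rule lens_midpoint[OF L e])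
  have D1: "lens_drawing V1 I1 L1" unfolding V1_def I1_def L1_def w_def by (rule lens_subdivide[OF L e ab(1)])
  have f1: "f \<in> I1" "b \<notin> I1" "L1 f = L f" using f ab ne by (auto simp: I1_def L1_def)
  have D2: "lens_drawing V1 I2 L2" unfolding I2_def L2_def by (rule lens_double[OF D1 f1(1,2)])
  have L2: "L2 e = L e \<circ> lens_left" "L2 a = L e \<circ> lens_right" "L2 f = L f \<circ> lens_middle" "L2 b = L f \<circ> lens_upper"
    "\<And>i. i \<in> I - {e, f} \<Longrightarrow> L2 i = L i"
    using ne f ab by (auto simp: L2_def L1_def)
  define u v where "u = L e 0" and "v = L e 1"
  have E2: "lens_ends L2 e = {u, w}" "lens_ends L2 a = {w, v}" "lens_ends L2 b = lens_ends L2 f"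
    "\<And>i. i \<in> I - {e} \<Longrightarrow> lens_ends L2 i = lens_ends L i" "lens_ends L e = {u, v}"
  proof -
    show "lens_ends L2 i = lens_ends L i" if "i \<in> I - {e}" for i
      using L2(3) L2(5)[of i] that by (cases "i = f") (auto simp: lens_ends_def)
  qed (simp_all add: lens_ends_def L2 u_def v_def w_def)
  have uv: "u \<noteq> v" "u \<in> V" "v \<in> V" using lens_drawingD(6-8)[OF L e] by (auto simp: u_def v_def)
  interpret S: subdivision V "lens_ends L" I e a u v w "lens_ends L2"
  proof -
    interpret fin_graph V "lens_ends L" I by (rule lens_fin_graph[OF L])
    show "subdivision V (lens_ends L) I e a u v w (lens_ends L2)"
      by unfold_locales (use e ab w E2 in auto)
  qed
  have B1: "block V1 (lens_ends L2) I1"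
    unfolding V1_def I1_def by (rule S.block_subdivision[OF B uv(1)])
  have fg2: "fin_graph V1 (lens_ends L2) I2" by (rule lens_fin_graph[OF D2])
  interpret Db: doubling V1 "lens_ends L2" I1 f b
  proof -
    interpret X: fin_graph V1 "lens_ends L2" I1 by (rule fin_graph.fin_graph_subset[OF fg2]) (auto simp: I2_def)
    show "doubling V1 (lens_ends L2) I1 f b" by unfold_locales (use f1 E2 in auto)
  qed
  have B2: "block V1 (lens_ends L2) I2" unfolding I2_def by (rule Db.block_doubling[OF B1])
  have ts: "tree_sum V1 (lens_ends L2) I2 x y = tree_sum V (lens_ends L) I
      (x(e := x e * x a, f := x f * y b + y f * x b)) (y(e := x e * y a + y e * x a, f := y f * y b))" for x y
  proof -
    let ?x = "x(f := x f * y b + y f * x b)" and ?y = "y(f := y f * y b)"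
    have "tree_sum V1 (lens_ends L2) I2 x y = tree_sum V1 (lens_ends L2) I1 ?x ?y"
      unfolding I2_def by (rule Db.tree_sum_doubling)
    also have "\<dots> = tree_sum V (lens_ends L) I (?x(e := ?x e * ?x a)) (?y(e := ?x e * ?y a + ?y e * ?x a))"
      unfolding V1_def I1_def by (rule S.tree_sum_subdivision)
    also have "?x(e := ?x e * ?x a) = x(e := x e * x a, f := x f * y b + y f * x b)"
      using f ne by (simp add: fun_upd_twist)
    also have "?y(e := ?x e * ?y a + ?y e * ?x a) = y(e := x e * y a + y e * x a, f := y f * y b)"
      using f ne by (simp add: fun_upd_twist)
    finally show ?thesis .
  qed
  define Ed where "Ed = lens_edges I L"
  define E1 where "E1 = lens_edges I1 L1"
  define Ed2 where "Ed2 = lens_edges I2 L2"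
  interpret G: plane_graph V Ed unfolding Ed_def by (rule lens_plane_graph[OF L])
  interpret G1: plane_graph V1 E1 unfolding E1_def by (rule lens_plane_graph[OF D1])
  interpret G2: plane_graph V1 Ed2 unfolding Ed2_def by (rule lens_plane_graph[OF D2])
  have L1: "L1 e = L e \<circ> lens_left" "L1 a = L e \<circ> lens_right" "\<And>i. i \<in> I - {e} \<Longrightarrow> L1 i = L i"
    using ne ab by (auto simp: L1_def)
  have im1: "(\<lambda>i. seg (L1 i)) ` (I - {e}) = Ed - {seg (L e)}"
  proof -
    have "(\<lambda>i. seg (L1 i)) ` (I - {e}) = (\<lambda>i. seg (L i)) ` (I - {e})" using L1(3) by (intro image_cong) auto
    also have "\<dots> = (\<lambda>i. seg (L i)) ` I - (\<lambda>i. seg (L i)) ` {e}"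
      by (rule inj_on_image_set_diff[OF lens_inj[OF L]]) (use e in auto)
    finally show ?thesis by (simp add: Ed_def)
  qed
  have I1e: "I1 = insert e (insert a (I - {e}))" using e by (auto simp: I1_def)
  have E1: "E1 = insert (seg (L1 e)) (insert (seg (L1 a)) (Ed - {seg (L e)}))"
    unfolding E1_def I1e image_insert im1 ..
  have eEd: "seg (L e) \<in> Ed" using e by (simp add: Ed_def)
  have PG1: "plane_graph (insert w V) (insert (seg (L1 e)) (insert (seg (L1 a)) (Ed - {seg (L e)})))"
    using G1.plane_graph_axioms unfolding V1_def E1 .
  have parts: "seg (L1 e) \<union> seg (L1 a) = seg (L e)" "w \<in> seg (L1 e)"
    unfolding L1(1,2) w_def by (rule seg_parts)+
  note F1 = G.subdivision_faces[OF eEd parts PG1, folded V1_def E1]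
  have sides1: "sides V1 E1 (seg (L1 i)) = sides V Ed (seg (L i))" if "i \<in> I" for i
    using F1(2,4) L1(3)[of i] that by (cases "i = e") auto
  have sides1a: "sides V1 E1 (seg (L1 a)) = sides V Ed (seg (L e))" by (rule F1(3))
  define g where "g = seg (L f)"
  define h where "h = seg (L2 b)"
  have gf: "g = seg (L2 f)" "g = seg (L1 f)" unfolding g_def L2(3) f1(3) by (simp_all add: seg_parts)
  have L2L1: "seg (L2 i) = seg (L1 i)" if "i \<in> I1" for i
  proof (cases "i = f")
    case False
    then have "L2 i = L1 i" using that f1 by (auto simp: L2_def)
    then show ?thesis by simp
  qed (use gf in simp)
  have imE: "Ed2 = insert h E1"
    unfolding Ed2_def E1_def I2_def image_insert h_def using L2L1 by (simp cong: image_cong)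
  have inj2: "inj_on (\<lambda>i. seg (L2 i)) I2" by (rule lens_inj[OF D2])
  have hE1: "h \<notin> E1"
  proof
    assume "h \<in> E1"
    then obtain i where "i \<in> I1" "seg (L2 b) = seg (L2 i)" using L2L1 by (auto simp: E1_def h_def)
    then have "b = i" using inj_onD[OF inj2] by (auto simp: I2_def)
    then show False using \<open>i \<in> I1\<close> f1 by simp
  qed
  have E1': "Ed2 - {h} = E1" using imE hE1 by auto
  have gE: "g \<in> Ed2" "h \<in> Ed2" "g \<noteq> h" "g \<in> E1"
    using hE1 f1(1) gf imE by (auto simp: E1_def)
  have seg_ends: "seg (L2 i) \<inter> V1 = lens_ends L2 i" if "i \<in> I2" for i by (rule lens_drawingD(5)[OF D2 that])
  have gV: "g \<inter> V1 = lens_ends L2 f" "h \<inter> V1 = lens_ends L2 f"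
    using seg_ends[of f] seg_ends[of b] gf E2(3) f1 by (auto simp: I2_def h_def)
  obtain s t where st: "lens_ends L2 f = {s, t}" by (auto simp: lens_ends_def)
  have K1: "bounded (L1 f ` lens)" "connected (- (L1 f ` lens))"
    using lens_image_disc[OF lens_drawingD(1,2)[OF D1 f1(1)]] by auto
  have K2: "g \<union> h \<subseteq> L1 f ` lens"
  proof -
    have "h \<subseteq> (L f \<circ> lens_upper) ` lens" unfolding h_def L2(4) by (rule seg_subset)
    also have "\<dots> \<subseteq> L1 f ` lens" unfolding f1(3) using sublenses(4) by auto
    finally show ?thesis using seg_subset[of "L1 f"] gf by blast
  qed
  have K3: "L1 f ` lens \<inter> (V1 \<union> \<Union>(Ed2 - {g, h})) \<subseteq> g"
  proof -
    have 1: "L1 f ` lens \<inter> V1 \<subseteq> g"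
      using lens_drawingD(3,5)[OF D1 f1(1)] gf(2) by blast
    have "L1 f ` lens \<inter> X \<subseteq> V1" if X: "X \<in> Ed2 - {g, h}" for X
    proof -
      obtain i where i: "i \<in> I1" "X = seg (L1 i)" using X imE by (auto simp: E1_def)
      then have "i \<noteq> f" using X gf by auto
      then have "L1 f ` lens \<inter> L1 i ` lens \<subseteq> V1" using D1 i f1(1) unfolding lens_drawing_def by simp
      then show ?thesis using seg_subset[of "L1 i"] i by blast
    qed
    then show ?thesis using 1 by blast
  qed
  have nb: "reach (drawn_ends V1) (Ed2 - {h} - {g}) s t"
  proof -
    have "E1 - {g} = (\<lambda>i. seg (L1 i)) ` (I1 - {f})"
      unfolding E1_def gf(2) using inj_on_image_set_diff[OF lens_inj[OF D1], of I1 "{f}"] f1(1) by simp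
    moreover have "reach (\<lambda>i. drawn_ends V1 (seg (L1 i))) (I1 - {f}) s t"
    proof -
      have "reach (lens_ends L2) (I1 - {f}) s t"
      proof -
        have "lens_ends L2 f \<subseteq> V1" using gV by blast
        then show ?thesis using B1 f1(1) st by (auto simp: block_def spans_def)
      qed
      then show ?thesis
      proof (subst reach_cong[where d' = "lens_ends L2"])
        show "drawn_ends V1 (seg (L1 i)) = lens_ends L2 i" if "i \<in> I1 - {f}" for i
          using seg_ends[of i] L2L1[of i] that by (simp add: I2_def)
      qed
    qed
    ultimately show ?thesis using E1' by (simp add: reach_edge_image)
  qed
  have gh: "g \<inter> V1 = h \<inter> V1" "g \<inter> V1 = {s, t}" using gV st by simp_all
  obtain F F2 D F' where Fc: "F \<noteq> F2" "sides V1 E1 g = {F, F2}"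
    "faces V1 Ed2 = (faces V1 E1 - {F}) \<union> {D, F'}" "D \<noteq> F'" "D \<notin> faces V1 E1" "F' \<notin> faces V1 E1 - {F}"
    "sides V1 Ed2 g = {D, F2}" "sides V1 Ed2 h = {D, F'}"
    "\<forall>X\<in>Ed2 - {g, h}. sides V1 Ed2 X = (\<lambda>H. if H = F then F' else H) ` sides V1 E1 X"
    by (rule G2.doubling_faces[OF gE(1-3) gh nb K1 K2 K3, unfolded E1'])
  define \<rho> where "\<rho> H = (if H = F then F' else H)" for H
  have sidesE: "sides V1 Ed2 (seg (L2 i)) = \<rho> ` sides V1 E1 (seg (L1 i))" if "i \<in> I1 - {f}" for i
  proof -
    have "seg (L2 i) \<in> Ed2 - {g, h}"
      using that inj_onD[OF inj2, of i f] inj_onD[OF inj2, of i b] f1 gf by (auto simp: Ed2_def I2_def h_def)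
    then show ?thesis using Fc(9) L2L1[of i] that unfolding \<rho>_def by simp
  qed
  have sg: "{F, F2} = {\<phi> u, \<phi> v}"
    using sd[OF e] sides1[OF f(1)] Fc(2) gf(2) E2(5) by (simp add: f_def[symmetric] Ed_def)
  have fE1: "faces V1 E1 = faces V Ed" by (rule F1(1))
  have inj\<phi>: "inj_on \<phi> V" and im\<phi>: "\<phi> ` V = faces V Ed" using bij by (auto simp: bij_betw_def Ed_def)
  define \<phi>' where "\<phi>' x = (if x = w then D else \<rho> (\<phi> x))" for x
  have \<phi>'V: "\<phi>' x = \<rho> (\<phi> x)" if "x \<in> V" for x using that w by (auto simp: \<phi>'_def)
  have Ff: "F \<in> faces V Ed" using Fc(2) fE1 by (auto simp: sides_def)
  have inj\<rho>: "inj_on \<rho> (faces V Ed)" using Fc(6) fE1 by (auto simp: inj_on_def \<rho>_def)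
  have im\<rho>: "\<rho> ` faces V Ed = (faces V Ed - {F}) \<union> {F'}" using Ff by (auto simp: \<rho>_def)
  have D\<rho>: "D \<notin> \<rho> ` faces V Ed" unfolding im\<rho> using Fc(4,5) fE1 by auto
  have im\<phi>': "\<phi>' ` V = \<rho> ` faces V Ed" unfolding im\<phi>[symmetric] image_image using \<phi>'V by (intro image_cong) auto
  have bij': "bij_betw \<phi>' V1 (faces V1 Ed2)"
  proof -
    have "inj_on \<phi>' V"
    proof (rule inj_onI)
      fix x y assume xy: "x \<in> V" "y \<in> V" "\<phi>' x = \<phi>' y"
      have "\<phi> x \<in> faces V Ed" "\<phi> y \<in> faces V Ed" using im\<phi> xy by auto
      then have "\<phi> x = \<phi> y" using inj_onD[OF inj\<rho>] xy(3) unfolding \<phi>'V[OF xy(1)] \<phi>'V[OF xy(2)] by blast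
      then show "x = y" using inj_onD[OF inj\<phi>] xy by blast
    qed
    moreover have "\<phi>' w = D" by (simp add: \<phi>'_def)
    ultimately have "inj_on \<phi>' V1" unfolding V1_def using D\<rho> im\<phi>' w by auto
    moreover have "\<phi>' ` V1 = faces V1 Ed2"
      unfolding V1_def image_insert im\<phi>' im\<rho> \<open>\<phi>' w = D\<close> Fc(3)[unfolded V1_def fE1[unfolded V1_def]] by auto
    ultimately show ?thesis by (simp add: bij_betw_def)
  qed
  have \<phi>'i: "\<phi>' ` lens_ends L i = \<rho> ` \<phi> ` lens_ends L i" if "i \<in> I" for i
    unfolding image_image using \<phi>'V lens_drawingD(7,8)[OF L that] by (intro image_cong) (auto simp: lens_ends_def)
  \<comment> \<open>the half of the subdivided edge at \<open>u\<close> goes with the arc between \<open>D\<close> and the new face of \<open>u\<close>\<close>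
  define k where "k = (if F = \<phi> u then b else f)"
  define k' where "k' = (if F = \<phi> u then f else b)"
  have \<phi>uv: "\<phi>' u = \<rho> (\<phi> u)" "\<phi>' v = \<rho> (\<phi> v)" using \<phi>'V uv by auto
  have kk: "sides V1 Ed2 (seg (L2 k)) = {\<phi>' u, D}" "sides V1 Ed2 (seg (L2 k')) = {D, \<phi>' v}"
  proof -
    have "\<phi> u \<noteq> \<phi> v" using Fc(1) sg by auto
    then have "(F = \<phi> u \<and> F2 = \<phi> v) \<or> (F = \<phi> v \<and> F2 = \<phi> u)" using sg by (auto simp: doubleton_eq_iff)
    then have "sides V1 Ed2 (seg (L2 k)) = {\<phi>' u, D} \<and> sides V1 Ed2 (seg (L2 k')) = {D, \<phi>' v}"
    proof (elim disjE conjE)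
      assume F: "F = \<phi> u" "F2 = \<phi> v"
      then have "k = b" "k' = f" "\<phi>' u = F'" "\<phi>' v = F2"
        using Fc(1) by (simp_all add: k_def k'_def \<phi>uv \<rho>_def)
      then show ?thesis using Fc(7,8) by (simp add: gf(1) h_def insert_commute)
    next
      assume F: "F = \<phi> v" "F2 = \<phi> u"
      then have "k = f" "k' = b" "\<phi>' u = F2" "\<phi>' v = F'"
        using Fc(1) by (simp_all add: k_def k'_def \<phi>uv \<rho>_def)
      then show ?thesis using Fc(7,8) by (simp add: gf(1) h_def insert_commute)
    qed
    then show "sides V1 Ed2 (seg (L2 k)) = {\<phi>' u, D}" "sides V1 Ed2 (seg (L2 k')) = {D, \<phi>' v}" by auto
  qed
  have kf: "(k = f \<and> k' = b) \<or> (k = b \<and> k' = f)" by (auto simp: k_def k'_def)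
  define \<sigma>' where "\<sigma>' = \<sigma>(e := k, k := e, a := k', k' := a)"
  have \<sigma>': "\<sigma>' e = k" "\<sigma>' k = e" "\<sigma>' a = k'" "\<sigma>' k' = a" "\<And>i. i \<in> I - {e, f} \<Longrightarrow> \<sigma>' i = \<sigma> i"
    using kf ne f ab by (auto simp: \<sigma>'_def)
  have inv: "\<sigma>' i \<in> I2 \<and> \<sigma>' (\<sigma>' i) = i \<and> \<sigma>' i \<noteq> i \<and>
      sides V1 Ed2 (seg (L2 (\<sigma>' i))) = \<phi>' ` lens_ends L2 i" if i: "i \<in> I2" for i
  proof -
    have kends: "lens_ends L2 k = lens_ends L f" "lens_ends L2 k' = lens_ends L f"
      using kf E2(3) E2(4)[of f] f by auto
    have sf: "\<phi>' ` lens_ends L f = \<rho> ` sides V Ed (seg (L e))"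
      using \<phi>'i[OF f(1)] sd[OF f(1)] f(3) by (simp add: Ed_def)
    have ee: "e \<in> I1 - {f}" "a \<in> I1 - {f}" using e f ne by (auto simp: I1_def)
    have base: "e \<in> I2" "a \<in> I2" "f \<in> I2" "b \<in> I2" using e f(1) by (simp_all add: I2_def I1_def)
    have "k \<in> I2 \<and> k \<noteq> e \<and> k' \<in> I2 \<and> k' \<noteq> a" using kf base f(2) ne ab(3) by metis
    then have kI: "k \<in> I2" "k \<noteq> e" "k' \<in> I2" "k' \<noteq> a" "e \<in> I2" "a \<in> I2" using base by blast+
    have \<phi>'w: "\<phi>' w = D" by (simp add: \<phi>'_def)
    from i kf consider "i = e" | "i = a" | "i = k" | "i = k'" | "i \<in> I - {e, f}"
      by (auto simp: I2_def I1_def)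
    then show ?thesis
    proof cases
      case 1
      have "sides V1 Ed2 (seg (L2 k)) = \<phi>' ` lens_ends L2 e" unfolding kk(1) E2(1) by (simp add: \<phi>'w)
      then show ?thesis using 1 \<sigma>'(1,2) kI by simp
    next
      case 2
      have "sides V1 Ed2 (seg (L2 k')) = \<phi>' ` lens_ends L2 a" unfolding kk(2) E2(2) by (simp add: \<phi>'w)
      then show ?thesis using 2 \<sigma>'(3,4) kI by simp
    next
      case 3
      have "sides V1 Ed2 (seg (L2 e)) = \<phi>' ` lens_ends L2 k"
        unfolding kends sf using sidesE[OF ee(1)] sides1[OF e] by simp
      then show ?thesis using 3 \<sigma>'(1,2) kI by simp
    next
      case 4
      have "sides V1 Ed2 (seg (L2 a)) = \<phi>' ` lens_ends L2 k'"
        unfolding kends sf using sidesE[OF ee(2)] sides1a by simp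
      then show ?thesis using 4 \<sigma>'(3,4) kI by simp
    next
      case 5
      then have iI: "i \<in> I" and s: "\<sigma> i \<in> I - {e, f}" using \<sigma>[of i] \<sigma>[of e] \<sigma>[of f] f f_def by auto
      have "sides V1 Ed2 (seg (L2 (\<sigma> i))) = \<rho> ` sides V1 E1 (seg (L1 (\<sigma> i)))"
        by (rule sidesE) (use s in \<open>auto simp: I1_def\<close>)
      also have "\<dots> = \<rho> ` \<phi> ` lens_ends L i" using sides1[of "\<sigma> i"] s sd[OF iI] by (simp add: Ed_def)
      also have "\<dots> = \<phi>' ` lens_ends L2 i" using \<phi>'i[OF iI] E2(4)[of i] 5 by simp
      finally show ?thesis using \<sigma>'(5)[OF 5] \<sigma>'(5)[OF s] \<sigma>[OF iI] s by (auto simp: I2_def I1_def)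
    qed
  qed
  have I2: "I2 = insert a (insert b I)" by (auto simp: I2_def I1_def)
  have "polar V1 (insert a (insert b I)) L2 \<sigma>' \<phi>'"
    unfolding polar_def I2[symmetric] using D2 B2 bij' inv by (auto simp: Ed2_def)
  then show thesis
  proof (rule that)
    show "\<sigma>' i = \<sigma> i" if "i \<in> I - {e, \<sigma> e}" for i using \<sigma>'(5) that by (simp add: f_def)
    show "\<sigma>' e = \<sigma> e \<or> \<sigma>' e = b" using \<sigma>'(1) kf by (auto simp: f_def)
    show "tree_sum V1 (lens_ends L2) (insert a (insert b I)) x y = tree_sum V (lens_ends L) I
      (x(e := x e * x a, \<sigma> e := x (\<sigma> e) * y b + y (\<sigma> e) * x b))
      (y(e := x e * y a + y e * x a, \<sigma> e := y (\<sigma> e) * y b))" for x y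
      using ts[of x y] unfolding I2 f_def .
  qed
qed

lemma card_trees_edge_image:
  assumes "inj_on A I"
  shows "card (trees V d (A ` I)) = card (trees V (\<lambda>i. d (A i)) I)"
proof -
  have "trees V d (A ` I) = (`) A ` trees V (\<lambda>i. d (A i)) I"
  proof (intro equalityI subsetI)
    fix T assume T: "T \<in> trees V d (A ` I)"
    define X where "X = {i \<in> I. A i \<in> T}"
    have TX: "T = A ` X" using T by (auto simp: X_def trees_def)
    have "inj_on A X" by (rule inj_on_subset[OF assms]) (auto simp: X_def)
    then have "card T = card X" unfolding TX by (rule card_image)
    moreover have "spans V d T" "card T + 1 = card V" using T by (simp_all add: trees_def)
    moreover from this(1) have "spans V (\<lambda>i. d (A i)) X" unfolding TX spans_edge_image .
    moreover have "X \<subseteq> I" by (auto simp: X_def)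
    ultimately have "X \<in> trees V (\<lambda>i. d (A i)) I" by (simp add: trees_def)
    then show "T \<in> (`) A ` trees V (\<lambda>i. d (A i)) I" using TX by blast
  next
    fix T assume "T \<in> (`) A ` trees V (\<lambda>i. d (A i)) I"
    then obtain X where X: "X \<in> trees V (\<lambda>i. d (A i)) I" "T = A ` X" by blast
    have "inj_on A X" by (rule inj_on_subset[OF assms]) (use X in \<open>auto simp: trees_def\<close>)
    then have "card T = card X" unfolding X(2) by (rule card_image)
    then show "T \<in> trees V d (A ` I)" using X spans_edge_image[of V d A X] by (auto simp: trees_def)
  qed
  moreover have "inj_on ((`) A) (trees V (\<lambda>i. d (A i)) I)"
    by (rule inj_on_subset[OF inj_on_image_Pow[OF assms]]) (auto simp: trees_def)
  ultimately show ?thesis by (simp add: card_image)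
qed

lemma (in plane_graph) spanning_trees_drawn:
  "spanning_trees (drawn_graph V E) = trees V (drawn_ends V) E"
proof -
  have "fin_graph V (drawn_ends V) E" by unfold_locales
  then show ?thesis using spanning_trees_eq_trees[of "drawn_graph V E"] by (simp add: drawn_graph_def)
qed

lemma polar_realizes:
  assumes P: "polar V I L \<sigma> \<phi>" and ne: "I \<noteq> {}"
  defines "E \<equiv> lens_edges I L"
  shows "plane_drawing V E" "E \<noteq> {}" "self_dual V E" "\<not> (\<exists>v. cut_vertex (drawn_graph V E) v)"
    "card (spanning_trees (drawn_graph V E)) = tree_sum V (lens_ends L) I (\<lambda>_. 1) (\<lambda>_. 1)"
proof -
  have L: "lens_drawing V I L" and B: "block V (lens_ends L) I"
    and bij: "bij_betw \<phi> V (faces V E)"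
    and \<sigma>: "\<And>i. i \<in> I \<Longrightarrow> \<sigma> i \<in> I \<and> \<sigma> (\<sigma> i) = i"
    and sd: "\<And>i. i \<in> I \<Longrightarrow> sides V E (seg (L (\<sigma> i))) = \<phi> ` lens_ends L i"
    using P by (auto simp: polar_def E_def)
  interpret plane_graph V E unfolding E_def by (rule lens_plane_graph[OF L])
  show "plane_drawing V E" by (rule drawing)
  show "E \<noteq> {}" using ne by (simp add: E_def)
  define A where "A i = seg (L i)" for i
  have inj: "inj_on A I" unfolding A_def by (rule lens_inj[OF L])
  have EA: "E = A ` I" by (simp add: E_def A_def)
  have dA: "drawn_ends V (A i) = lens_ends L i" if "i \<in> I" for i
    using lens_drawingD(5)[OF L that] by (simp add: A_def)
  have inv: "bij_betw (the_inv_into I A) E I" unfolding EA by (rule bij_betw_the_inv_into) (simp add: bij_betw_def inj)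
  have b\<sigma>: "bij_betw \<sigma> I I" by (rule bij_betwI[where g = \<sigma>]) (use \<sigma> in auto)
  have bA: "bij_betw A I E" by (simp add: bij_betw_def inj EA)
  define g where "g = A \<circ> \<sigma> \<circ> the_inv_into I A"
  have "bij_betw g E E" unfolding g_def by (intro bij_betw_trans[OF inv] bij_betw_trans[OF b\<sigma>] bA)
  moreover have "sides V E (g x) = \<phi> ` (drawn_ends V x)" if "x \<in> E" for x
  proof -
    from that obtain i where i: "i \<in> I" "x = A i" using EA by blast
    have "g x = A (\<sigma> i)" using i by (simp add: g_def the_inv_into_f_f[OF inj])
    then show ?thesis using sd[OF i(1)] dA[OF i(1)] i by (simp add: A_def)
  qed
  ultimately show "self_dual V E"
    unfolding self_dual_def isomorphic_def using bij
    by (intro exI[of _ \<phi>] exI[of _ g]) (auto simp: drawn_graph_def dual_graph_def sides_def)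
  show "\<not> (\<exists>v. cut_vertex (drawn_graph V E) v)"
  proof
    assume "\<exists>v. cut_vertex (drawn_graph V E) v"
    then obtain v where "cut_vertex (drawn_graph V E) v" by blast
    moreover from this have vV: "v \<in> V" by (simp add: cut_vertex_def drawn_graph_def)
    ultimately have "\<exists>u\<in>V - {v}. \<exists>w\<in>V - {v}. reach (drawn_ends V) E u w \<and>
        \<not> reach (drawn_ends V) {e \<in> E. v \<notin> e \<inter> V} u w"
      by (simp add: cut_vertex_def reachable_reach drawn_graph_def delete_vertex_def)
    then obtain u w where v: "v \<in> V" "u \<in> V - {v}" "w \<in> V - {v}"
      "\<not> reach (drawn_ends V) {e \<in> E. v \<notin> e \<inter> V} u w" using vV by blast
    have "{e \<in> E. v \<notin> e \<inter> V} = A ` {i \<in> I. v \<notin> lens_ends L i}" using dA EA by auto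
    moreover have "reach (lens_ends L) {i \<in> I. v \<notin> lens_ends L i} u w"
      using B v by (auto simp: block_def spans_def)
    then have "reach (\<lambda>i. drawn_ends V (A i)) {i \<in> I. v \<notin> lens_ends L i} u w"
      by (subst reach_cong[where d' = "lens_ends L"]) (use dA in auto)
    ultimately show False using v(4) by (simp add: reach_edge_image)
  qed
  have "finite I" using L by (simp add: lens_drawing_def)
  have "card (spanning_trees (drawn_graph V E)) = card (trees V (drawn_ends V) (A ` I))"
    by (simp only: spanning_trees_drawn EA[symmetric])
  also have "\<dots> = card (trees V (\<lambda>i. drawn_ends V (A i)) I)"
    by (rule card_trees_edge_image[OF inj])
  also have "\<dots> = tree_sum V (\<lambda>i. drawn_ends V (A i)) I (\<lambda>_. 1) (\<lambda>_. 1)"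
    by (rule tree_sum_card[symmetric]) (use \<open>finite I\<close> in auto)
  also have "\<dots> = tree_sum V (lens_ends L) I (\<lambda>_. 1) (\<lambda>_. 1)"
    by (rule tree_sum_cong) (use dA in auto)
  finally show "card (spanning_trees (drawn_graph V E)) = tree_sum V (lens_ends L) I (\<lambda>_. 1) (\<lambda>_. 1)" .
qed

text \<open>The rules for subdividing and doubling are the steps of the Euclidean algorithm on the pair of weights.\<close>

definition refines :: "complex set \<Rightarrow> nat set \<Rightarrow> (nat \<Rightarrow> complex \<Rightarrow> complex) \<Rightarrow> (nat \<Rightarrow> nat) \<Rightarrow> nat \<Rightarrow> nat \<Rightarrow> nat \<Rightarrow>
    complex set \<Rightarrow> nat set \<Rightarrow> (nat \<Rightarrow> complex \<Rightarrow> complex) \<Rightarrow> (nat \<Rightarrow> nat) \<Rightarrow> bool" where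
  "refines V I L \<sigma> e p q V' I' L' \<sigma>' \<longleftrightarrow> I \<subseteq> I' \<and> (\<forall>i\<in>I - {e, \<sigma> e}. \<sigma>' i = \<sigma> i) \<and>
     (\<forall>x y. (\<forall>i\<in>I' - (I - {e, \<sigma> e}). x i = 1 \<and> y i = 1) \<longrightarrow>
        tree_sum V' (lens_ends L') I' x y =
        tree_sum V (lens_ends L) I (x(e := p, \<sigma> e := q)) (y(e := q, \<sigma> e := p)))"

lemma refines_swap:
  assumes "\<sigma> (\<sigma> e) = e" "\<sigma> e \<noteq> e"
  shows "refines V I L \<sigma> (\<sigma> e) q p V' I' L' \<sigma>' \<longleftrightarrow> refines V I L \<sigma> e p q V' I' L' \<sigma>'"
proof -
  have "x(\<sigma> e := q, e := p) = x(e := p, \<sigma> e := q)" for x :: "nat \<Rightarrow> nat" and p q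
    using assms by (simp add: fun_upd_twist)
  then show ?thesis unfolding refines_def by (simp add: assms insert_commute)
qed

text \<open>If \<open>p < q\<close>, then one step of subdividing and doubling produces the weights \<open>(p,
  q)\<close> from \<open>(p, q - p)\<close> on \<open>e\<close>; if \<open>q < p\<close>, the roles of
  \<open>e\<close> and \<open>\<sigma> e\<close> are exchanged.\<close>

lemma network:
  assumes "polar V I L \<sigma> \<phi>" "e \<in> I" "coprime p q" "p > 0" "q > 0"
  shows "\<exists>V' I' L' \<sigma>' \<phi>'. polar V' I' L' \<sigma>' \<phi>' \<and> refines V I L \<sigma> e p q V' I' L' \<sigma>'"
  using assms
proof (induction "p + q" arbitrary: V I L \<sigma> \<phi> e p q rule: less_induct)
  case less
  have less_case: "\<exists>V' I' L' \<sigma>' \<phi>'. polar V' I' L' \<sigma>' \<phi>' \<and> refines V I L \<sigma> e p' q' V' I' L' \<sigma>'"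
    if e: "e \<in> I" and pq: "p' + q' = p + q" "coprime p' q'" "0 < p'" "p' < q'" for e p' q'
  proof -
    define f where "f = \<sigma> e"
    have P: "polar V I L \<sigma> \<phi>" by fact
    have f: "f \<in> I" "f \<noteq> e" using P e by (auto simp: polar_def f_def)
    have "finite I" using P by (simp add: polar_def lens_drawing_def)
    then obtain a where a: "a \<notin> I" using ex_new_if_finite infinite_UNIV_nat by blast
    obtain b where b: "b \<notin> insert a I" using ex_new_if_finite[OF infinite_UNIV_nat, of "insert a I"] \<open>finite I\<close> by auto
    obtain V1 L1 \<sigma>1 \<phi>1 where S1: "polar V1 (insert a (insert b I)) L1 \<sigma>1 \<phi>1"
      "\<And>i. i \<in> I - {e, f} \<Longrightarrow> \<sigma>1 i = \<sigma> i" "\<sigma>1 e = f \<or> \<sigma>1 e = b"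
      "\<And>x y. tree_sum V1 (lens_ends L1) (insert a (insert b I)) x y = tree_sum V (lens_ends L) I
        (x(e := x e * x a, f := x f * y b + y f * x b)) (y(e := x e * y a + y e * x a, f := y f * y b))"
      using polar_step[OF P e a, of b] b unfolding f_def by blast
    define I1 where "I1 = insert a (insert b I)"
    define g where "g = \<sigma>1 e"
    have "gcd (q' - p') p' = gcd q' p'" using pq by (simp add: gcd_diff1_nat)
    then have cop: "coprime p' (q' - p')" using pq by (simp add: coprime_iff_gcd_eq_1 gcd.commute)
    have "\<exists>V' I' L' \<sigma>' \<phi>'. polar V' I' L' \<sigma>' \<phi>' \<and> refines V1 I1 L1 \<sigma>1 e p' (q' - p') V' I' L' \<sigma>'"
      using less.hyps[of p' "q' - p'" V1 I1 L1 \<sigma>1 \<phi>1 e] S1(1) e pq cop by (simp add: I1_def)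
    then obtain V' I' L' \<sigma>' \<phi>' where S': "polar V' I' L' \<sigma>' \<phi>'" "refines V1 I1 L1 \<sigma>1 e p' (q' - p') V' I' L' \<sigma>'"
      by blast
    have ne: "e \<noteq> a" "e \<noteq> b" "f \<noteq> a" "f \<noteq> b" "a \<noteq> b" using e f a b by auto
    have g: "g = f \<or> g = b" "g \<noteq> e" "g \<noteq> a" using S1(3) f ne by (auto simp: g_def)
    have R: "I1 \<subseteq> I'" "\<And>i. i \<in> I1 - {e, g} \<Longrightarrow> \<sigma>' i = \<sigma>1 i"
      "\<And>x y. (\<forall>i\<in>I' - (I1 - {e, g}). x i = 1 \<and> y i = 1) \<Longrightarrow> tree_sum V' (lens_ends L') I' x y =
        tree_sum V1 (lens_ends L1) I1 (x(e := p', g := q' - p')) (y(e := q' - p', g := p'))"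
      using S'(2) by (auto simp: refines_def g_def)
    have "tree_sum V' (lens_ends L') I' x y = tree_sum V (lens_ends L) I (x(e := p', f := q')) (y(e := q', f := p'))"
      if xy: "\<forall>i\<in>I' - (I - {e, f}). x i = 1 \<and> y i = 1" for x y
    proof -
      have I1I: "e \<in> I'" "f \<in> I'" "a \<in> I'" "b \<in> I'" using R(1) e f by (auto simp: I1_def)
      have one: "x i = 1 \<and> y i = 1" if "i \<in> {e, f, a, b}" for i
        using xy I1I that a b by auto
      define X where "X = x(e := p', g := q' - p')"
      define Y where "Y = y(e := q' - p', g := p')"
      have "I' - (I1 - {e, g}) \<subseteq> I' - (I - {e, f})" using g(1) ne a b by (auto simp: I1_def)
      then have "tree_sum V' (lens_ends L') I' x y = tree_sum V1 (lens_ends L1) I1 X Y"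
        unfolding X_def Y_def using xy by (intro R(3)) auto
      also have "\<dots> = tree_sum V (lens_ends L) I (X(e := X e * X a, f := X f * Y b + Y f * X b))
          (Y(e := X e * Y a + Y e * X a, f := Y f * Y b))"
        unfolding I1_def by (rule S1(4))
      also have "\<dots> = tree_sum V (lens_ends L) I (x(e := p', f := q')) (y(e := q', f := p'))"
      proof (rule tree_sum_cong)
        have E: "X e = p'" "Y e = q' - p'" "X a = 1" "Y a = 1" using g ne one by (auto simp: X_def Y_def)
        have F: "X f * Y b + Y f * X b = q'" "Y f * Y b = p'"
          using g(1)
        proof (atomize(full), elim disjE)
          assume "g = f"
          then show "X f * Y b + Y f * X b = q' \<and> Y f * Y b = p'"
            using one ne f pq by (simp add: X_def Y_def)
        next
          assume "g = b"
          then show "X f * Y b + Y f * X b = q' \<and> Y f * Y b = p'"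
            using one ne f pq by (simp add: X_def Y_def)
        qed
        fix i assume i: "i \<in> I"
        have ib: "i \<noteq> b" using i b by auto
        show "(X(e := X e * X a, f := X f * Y b + Y f * X b)) i = (x(e := p', f := q')) i"
          unfolding F E using g(1) ib by (auto simp: X_def)
        show "(Y(e := X e * Y a + Y e * X a, f := Y f * Y b)) i = (y(e := q', f := p')) i"
          unfolding F E using g(1) ib pq by (auto simp: Y_def)
      qed simp
      finally show ?thesis .
    qed
    moreover have "I \<subseteq> I'" using R(1) by (auto simp: I1_def)
    moreover have "\<sigma>' i = \<sigma> i" if "i \<in> I - {e, f}" for i
      using that R(2)[of i] S1(2)[of i] g(1) b by (auto simp: I1_def)
    ultimately have "refines V I L \<sigma> e p' q' V' I' L' \<sigma>'" unfolding refines_def f_def[symmetric] by blast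
    then show ?thesis using S'(1) by blast
  qed
  have \<sigma>: "\<sigma> e \<in> I" "\<sigma> (\<sigma> e) = e" "\<sigma> e \<noteq> e" using less.prems by (auto simp: polar_def)
  consider "p = q" | "p < q" | "q < p" by linarith
  then show ?case
  proof cases
    case 1
    then have pq: "p = 1" "q = 1" using less.prems by auto
    have "refines V I L \<sigma> e p q V I L \<sigma>"
      unfolding refines_def pq
    proof (intro conjI allI impI)
      fix x y :: "nat \<Rightarrow> nat" assume "\<forall>i\<in>I - (I - {e, \<sigma> e}). x i = 1 \<and> y i = 1"
      then have "x e = 1" "x (\<sigma> e) = 1" "y e = 1" "y (\<sigma> e) = 1" using \<sigma> less.prems by auto
      then have "x(e := 1, \<sigma> e := 1) = x" "y(e := 1, \<sigma> e := 1) = y" by auto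
      then show "tree_sum V (lens_ends L) I x y =
        tree_sum V (lens_ends L) I (x(e := 1, \<sigma> e := 1)) (y(e := 1, \<sigma> e := 1))" by simp
    qed auto
    then show ?thesis using less.prems by blast
  next
    case 2
    then show ?thesis using less_case[OF less.prems(2), of p q] less.prems by simp
  next
    case 3
    have "coprime q p" using less.prems by (simp add: coprime_commute)
    then show ?thesis
      using less_case[OF \<sigma>(1), of q p] less.prems 3 refines_swap[OF \<sigma>(2,3)] by (simp add: add.commute)
  qed
qed

section \<open>Deletion and contraction\<close>

lemma spans_vertex_image:
  assumes "inj_on h V" "\<And>i. i \<in> T \<Longrightarrow> \<exists>s\<in>V. \<exists>t\<in>V. d i = {s, t}"
  shows "spans (h ` V) (\<lambda>i. h ` d i) T \<longleftrightarrow> spans V d T"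
proof -
  have "reach (\<lambda>i. h ` d i) T (h a) (h b) \<longleftrightarrow> reach d T a b" if ab: "a \<in> V" "b \<in> V" for a b
  proof
    assume r: "reach (\<lambda>i. h ` d i) T (h a) (h b)"
    have "h b \<in> h ` {z \<in> V. reach d T a z}"
    proof (rule reach_closed[OF r])
      fix e p q assume e: "e \<in> T" "h ` d e = {p, q}" "p \<in> h ` {z \<in> V. reach d T a z}"
      then obtain z where z: "z \<in> V" "reach d T a z" "p = h z" by blast
      obtain s t where st: "s \<in> V" "t \<in> V" "d e = {s, t}" using assms(2)[OF e(1)] by blast
      have "(h s = p \<and> h t = q) \<or> (h s = q \<and> h t = p)" using e(2) st by (auto simp: doubleton_eq_iff)
      then have "(s = z \<and> h t = q) \<or> (h s = q \<and> t = z)"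
        using z st inj_onD[OF assms(1)] by auto
      moreover have "reach d T s t" "reach d T t s" using e(1) st(3) by (auto intro: reach_edge reach_sym)
      ultimately show "q \<in> h ` {z \<in> V. reach d T a z}" using z st by (auto intro: reach_trans)
    qed (use ab in auto)
    then show "reach d T a b" using inj_onD[OF assms(1)] ab by auto
  next
    assume "reach d T a b"
    then show "reach (\<lambda>i. h ` d i) T (h a) (h b)"
    proof (induction rule: reach_induct)
      case (step y z e)
      have "reach (\<lambda>i. h ` d i) T (h y) (h z)" using step by (intro reach_edge[of e]) auto
      then show ?case using step.IH reach_trans by metis
    qed simp
  qed
  then show ?thesis by (auto simp: spans_def)
qed

lemma tree_sum_vertex_image:
  assumes "inj_on h V" "\<And>i. i \<in> I \<Longrightarrow> \<exists>s\<in>V. \<exists>t\<in>V. d i = {s, t}"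
  shows "tree_sum (h ` V) (\<lambda>i. h ` d i) I x y = tree_sum V d I x y"
  unfolding tree_sum_def
proof (rule sum.cong)
  fix T assume T: "T \<in> Pow I"
  have "spans (h ` V) (\<lambda>i. h ` d i) T \<longleftrightarrow> spans V d T"
    by (rule spans_vertex_image[OF assms(1)]) (use assms(2) T in blast)
  moreover have "card (h ` V) = card V" by (rule card_image[OF assms(1)])
  ultimately show "of_bool (spans (h ` V) (\<lambda>i. h ` d i) T \<and> card T + 1 = card (h ` V)) * wt x y I T =
      of_bool (spans V d T \<and> card T + 1 = card V) * wt x y I T" by simp
qed simp

definition merge :: "'v \<Rightarrow> 'v \<Rightarrow> 'v \<Rightarrow> 'v" where
  "merge u v z = (if z = v then u else z)"

text \<open>Merging the ends of an edge has the effect of adding the edge.\<close>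

lemma reach_contract:
  assumes i: "d i = {u, v}" and T: "\<And>j. j \<in> T \<Longrightarrow> \<exists>s t. d j = {s, t}"
  shows "reach d (insert i T) x y \<longleftrightarrow> reach (\<lambda>j. merge u v ` d j) T (merge u v x) (merge u v y)"
proof -
  let ?m = "merge u v"
  have "reach d (insert i T) u v" using i by (auto intro: reach_edge)
  then have m: "part d (insert i T) (?m z) = part d (insert i T) z" for z
    unfolding reach_part by (simp add: merge_def)
  have bwd: "reach d (insert i T) a b" if "reach (\<lambda>j. ?m ` d j) T a b" for a b
  proof (rule reach_subst[OF that])
    fix e p q assume e: "e \<in> T" "?m ` d e = {p, q}"
    from T[OF e(1)] obtain s t where st: "d e = {s, t}" by blast
    have "part d (insert i T) s = part d (insert i T) t"
      using e(1) st reach_edge[of e "insert i T" d s t] unfolding reach_part by auto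
    moreover have "(?m s = p \<and> ?m t = q) \<or> (?m s = q \<and> ?m t = p)"
      using e(2) st by (auto simp: doubleton_eq_iff)
    ultimately show "reach d (insert i T) p q" unfolding reach_part using m by metis
  qed
  show ?thesis
  proof
    assume "reach d (insert i T) x y"
    then show "reach (\<lambda>j. ?m ` d j) T (?m x) (?m y)"
    proof (induction rule: reach_induct)
      case (step y z e)
      show ?case
      proof (cases "e = i")
        case True
        then have "?m y = ?m z" using step i by (auto simp: merge_def doubleton_eq_iff)
        then show ?thesis using step.IH by simp
      next
        case False
        then have "reach (\<lambda>j. ?m ` d j) T (?m y) (?m z)" using step by (intro reach_edge[of e]) auto
        then show ?thesis using step.IH reach_trans by metis
      qed
    qed simp
  next
    assume "reach (\<lambda>j. ?m ` d j) T (?m x) (?m y)"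
    then show "reach d (insert i T) x y" using bwd m unfolding reach_part by metis
  qed
qed

lemma tree_sum_delcon:
  assumes G: "fin_graph V d (insert i I)" and i: "i \<notin> I" "d i = {u, v}"
  shows "tree_sum V d (insert i I) x y = y i * tree_sum V d I x y +
    (if u = v then 0 else x i * tree_sum (V - {v}) (\<lambda>j. merge u v ` d j) I x y)"
proof -
  interpret fin_graph V d "insert i I" by fact
  have finI: "finite I" using finE by simp
  have uv: "u \<in> V" "v \<in> V" using ends_subset[of i] i by auto
  let ?t = "\<lambda>T. of_bool (spans V d T \<and> card T + 1 = card V) :: nat"
  let ?c = "\<lambda>T. of_bool (spans (V - {v}) (\<lambda>j. merge u v ` d j) T \<and> card T + 1 = card (V - {v})) :: nat"
  have t: "?t (insert i X) = (if u = v then 0 else ?c X)" if X: "X \<in> Pow I" for X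
  proof -
    have XI: "finite X" "i \<notin> X" "X \<subseteq> insert i I" using X i finI finite_subset[of X I] by auto
    have T: "\<exists>s t. d j = {s, t}" if "j \<in> X" for j using ends_ex[of j] that X by blast
    show ?thesis
    proof (cases "u = v")
      case True
      have "reach d (insert i X) a b \<longleftrightarrow> reach d X a b" for a b
        using reach_insert[where d = d and e = i and A = X, OF i(2)] True reach_trans by metis
      then have "spans V d (insert i X) \<longleftrightarrow> spans V d X" by (simp add: spans_def)
      moreover have "spans V d X \<Longrightarrow> card V \<le> card X + 1" by (rule spans_card[OF XI(3)])
      ultimately show ?thesis using True XI by auto
    next
      case False
      have R: "reach d (insert i X) a b \<longleftrightarrow> reach (\<lambda>j. merge u v ` d j) X (merge u v a) (merge u v b)" for a b
        using reach_contract[of d i u v X a b] i(2) T by blast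
      have "merge u v ` V = V - {v}" using False uv by (auto simp: merge_def image_def)
      then have "spans V d (insert i X) \<longleftrightarrow> spans (V - {v}) (\<lambda>j. merge u v ` d j) X"
        unfolding spans_def R \<open>merge u v ` V = V - {v}\<close>[symmetric] by blast
      moreover have "card V = Suc (card (V - {v}))" by (rule card_Suc_Diff1[OF finV uv(2), symmetric])
      ultimately show ?thesis using False XI by simp
    qed
  qed
  have "tree_sum V d (insert i I) x y =
      (\<Sum>X\<in>Pow I. ?t X * wt x y (insert i I) X + ?t (insert i X) * wt x y (insert i I) (insert i X))"
    unfolding tree_sum_def by (rule sum_Pow_insert[OF finI i(1)])
  also have "\<dots> = (\<Sum>X\<in>Pow I. y i * (?t X * wt x y I X) + (if u = v then 0 else x i * (?c X * wt x y I X)))"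
  proof (rule sum.cong)
    fix X assume X: "X \<in> Pow I"
    then have nX: "i \<notin> X" using i by auto
    show "?t X * wt x y (insert i I) X + ?t (insert i X) * wt x y (insert i I) (insert i X) =
      y i * (?t X * wt x y I X) + (if u = v then 0 else x i * (?c X * wt x y I X))"
      unfolding t[OF X] using i nX finI
      by (simp add: wt_insert wt_insert_other mult.left_commute del: of_bool_eq)
  qed simp
  finally show ?thesis
    unfolding tree_sum_def by (simp add: sum.distrib sum_distrib_left del: of_bool_eq)
qed

text \<open>Deletion and contraction on a list of edges, given by their ends and weights, so that tree counts of
  concrete graphs can be computed by rewriting. The first argument is the number of vertices.\<close>

fun delcon :: "nat \<Rightarrow> ('v \<times> 'v \<times> nat \<times> nat) list \<Rightarrow> nat" where
  "delcon n [] = (if n = 1 then 1 else 0)"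
| "delcon n ((u, v, a, b) # es) = b * delcon n es +
    (if u = v \<or> a = 0 then 0 else a * delcon (n - 1) (map (\<lambda>(s, t, r). (if s = v then u else s, if t = v then u else t, r)) es))"

lemma delcon_tree_sum:
  assumes "finite V" "V \<noteq> {}" "distinct is" "\<And>i. i \<in> set is \<Longrightarrow> s i \<in> V \<and> t i \<in> V \<and> d i = {s i, t i}"
  shows "tree_sum V d (set is) x y = delcon (card V) (map (\<lambda>i. (s i, t i, x i, y i)) is)"
  using assms
proof (induction "is" arbitrary: V d s t)
  case Nil
  have "spans V d {} \<and> 1 = card V \<longleftrightarrow> card V = 1"
  proof
    assume "card V = 1"
    then obtain x where "V = {x}" by (rule card_1_singletonE)
    then show "spans V d {} \<and> 1 = card V" by (simp add: spans_def)
  qed simp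
  then show ?case by (simp add: tree_sum_def wt_def)
next
  case (Cons i "is")
  have G: "fin_graph V d (insert i (set is))"
    by unfold_locales (use Cons.prems in auto)
  have i: "i \<notin> set is" "d i = {s i, t i}" using Cons.prems by auto
  have 1: "tree_sum V d (set is) x y = delcon (card V) (map (\<lambda>i. (s i, t i, x i, y i)) is)"
    by (rule Cons.IH) (use Cons.prems in auto)
  have 2: "tree_sum (V - {t i}) (\<lambda>j. merge (s i) (t i) ` d j) (set is) x y =
      delcon (card V - 1) (map (\<lambda>j. (merge (s i) (t i) (s j), merge (s i) (t i) (t j), x j, y j)) is)"
    if "s i \<noteq> t i"
  proof -
    have "tree_sum (V - {t i}) (\<lambda>j. merge (s i) (t i) ` d j) (set is) x y =
        delcon (card (V - {t i})) (map (\<lambda>j. (merge (s i) (t i) (s j), merge (s i) (t i) (t j), x j, y j)) is)"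
      by (rule Cons.IH) (use Cons.prems that in \<open>auto simp: merge_def\<close>)
    then show ?thesis using Cons.prems by simp
  qed
  have "(\<lambda>(s', t', r). (if s' = t i then s i else s', if t' = t i then s i else t', r)) \<circ> (\<lambda>i. (s i, t i, x i, y i)) =
      (\<lambda>j. (merge (s i) (t i) (s j), merge (s i) (t i) (t j), x j, y j))"
    by (auto simp: merge_def)
  then show ?case using tree_sum_delcon[OF G i, of x y] 1 2 by auto
qed

section \<open>Straight drawings of triangulated polygons\<close>

text \<open>Twice the signed area of the triangle with the corners \<open>a\<close>, \<open>b\<close> and
  \<open>z\<close>.\<close>

definition cross :: "complex \<Rightarrow> complex \<Rightarrow> complex \<Rightarrow> real" where
  "cross a b z = (Re b - Re a) * (Im z - Im a) - (Im b - Im a) * (Re z - Re a)"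

definition triangle :: "complex \<Rightarrow> complex \<Rightarrow> complex \<Rightarrow> complex set" where
  "triangle a b c = {z. 0 < cross a b z \<and> 0 < cross b c z \<and> 0 < cross c a z}"

lemma cross_affine: "cross a b ((1 - s) *\<^sub>R z + s *\<^sub>R z') = (1 - s) * cross a b z + s * cross a b z'"
  by (simp add: cross_def algebra_simps)

lemma continuous_cross: "continuous_on S (cross a b)"
  unfolding cross_def by (intro continuous_intros)

lemma triangle_open: "open (triangle a b c)"
  unfolding triangle_def
  by (intro open_Collect_conj open_Collect_less continuous_cross continuous_intros)

lemma triangle_convex: "convex (triangle a b c)"
  unfolding convex_alt triangle_def
proof (intro ballI allI impI, clarsimp simp: cross_affine)
  fix x y and u :: real
  assume *: "0 < cross a b x" "0 < cross b c x" "0 < cross c a x" "0 < cross a b y" "0 < cross b c y" "0 < cross c a y"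
    "0 \<le> u" "u \<le> 1"
  have "0 < (1 - u) * r + u * s" if "0 < r" "0 < s" for r s :: real
    using that *(7,8) by (cases "u = 0") (auto intro: add_nonneg_pos)
  then show "0 < (1 - u) * cross a b x + u * cross a b y \<and> 0 < (1 - u) * cross b c x + u * cross b c y \<and>
      0 < (1 - u) * cross c a x + u * cross c a y" using * by blast
qed

lemma triangle_point:
  assumes "0 < cross a b c"
  shows "\<exists>g. g \<in> triangle a b c"
proof -
  define g where "g = Complex ((Re a + Re b + Re c) / 3) ((Im a + Im b + Im c) / 3)"
  have "cross a b g = cross a b c / 3" "cross b c g = cross a b c / 3" "cross c a g = cross a b c / 3"
    by (simp_all add: g_def cross_def field_simps)
  then have "g \<in> triangle a b c" unfolding triangle_def using assms by simp
  then show ?thesis by blast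
qed

lemma triangle_closure:
  assumes "0 < cross a b c" "0 \<le> cross a b z" "0 \<le> cross b c z" "0 \<le> cross c a z"
  shows "z \<in> closure (triangle a b c)"
proof -
  obtain g where g: "g \<in> triangle a b c" using triangle_point[OF assms(1)] by blast
  define h where "h n = (1 - 1 / real (Suc n)) *\<^sub>R z + (1 / real (Suc n)) *\<^sub>R g" for n
  have "h n \<in> triangle a b c" for n
  proof -
    have s: "0 < 1 / real (Suc n)" "0 \<le> 1 - 1 / real (Suc n)" by simp_all
    have "0 < (1 - 1 / real (Suc n)) * r + (1 / real (Suc n)) * t" if "0 \<le> r" "0 < t" for r t :: real
      using mult_nonneg_nonneg[OF s(2) that(1)] mult_pos_pos[OF s(1) that(2)] by linarith
    then show ?thesis using g assms(2-4) unfolding h_def triangle_def by (simp only: mem_Collect_eq cross_affine)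
  qed
  moreover have "h \<longlonglongrightarrow> (1 - 0) *\<^sub>R z + 0 *\<^sub>R g"
    unfolding h_def by (intro tendsto_intros LIMSEQ_Suc[OF lim_1_over_n])
  ultimately show ?thesis unfolding closure_sequential by (intro exI[of _ h]) simp
qed

lemma triangle_frontier:
  assumes D: "0 < cross a b c"
  shows "frontier (triangle a b c) \<subseteq> closed_segment a b \<union> closed_segment b c \<union> closed_segment c a"
    "closed_segment a b \<subseteq> frontier (triangle a b c)" "closed_segment b c \<subseteq> frontier (triangle a b c)"
    "closed_segment c a \<subseteq> frontier (triangle a b c)"
proof -
  have fr: "frontier (triangle a b c) = closure (triangle a b c) - triangle a b c"
    by (simp add: frontier_def interior_open triangle_open)
  have cyc: "triangle a b c = triangle b c a" "triangle a b c = triangle c a b" "cross b c a = cross a b c" "cross c a b = cross a b c"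
    by (auto simp: triangle_def cross_def algebra_simps)
  have side: "closed_segment p q \<subseteq> frontier (triangle p q r)" if d: "0 < cross p q r" for p q r
  proof
    fix z assume "z \<in> closed_segment p q"
    then obtain u where u: "z = (1 - u) *\<^sub>R p + u *\<^sub>R q" "0 \<le> u" "u \<le> 1" by (auto simp: in_segment)
    have e: "cross p q p = 0" "cross p q q = 0" "cross q r p = cross p q r" "cross q r q = 0" "cross r p p = 0"
      "cross r p q = cross p q r" by (simp_all add: cross_def algebra_simps)
    have "cross p q z = 0" "0 \<le> cross q r z" "0 \<le> cross r p z"
      unfolding u(1) cross_affine e using u d by auto
    then have "z \<in> closure (triangle p q r)" "z \<notin> triangle p q r"
      using triangle_closure[OF d] by (auto simp: triangle_def)
    then show "z \<in> frontier (triangle p q r)" by (simp add: frontier_def interior_open triangle_open)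
  qed
  show "closed_segment a b \<subseteq> frontier (triangle a b c)" by (rule side[OF D])
  show "closed_segment b c \<subseteq> frontier (triangle a b c)" unfolding cyc(1) by (rule side) (simp add: cyc D)
  show "closed_segment c a \<subseteq> frontier (triangle a b c)" unfolding cyc(2) by (rule side) (simp add: cyc D)
  have seg: "z \<in> closed_segment p q"
    if d: "0 < cross p q r" and z: "cross p q z = 0" "0 \<le> cross q r z" "0 \<le> cross r p z" for p q r z
  proof -
    define u where "u = cross r p z / cross p q r"
    have sum: "cross p q z + cross q r z + cross r p z = cross p q r" by (simp add: cross_def algebra_simps)
    then have u01: "0 \<le> u" "u \<le> 1" "1 - u = cross q r z / cross p q r"
      using z d by (auto simp: u_def field_simps)
    have id: "cross p q r * Re z = cross q r z * Re p + cross r p z * Re q + cross p q z * Re r"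
      "cross p q r * Im z = cross q r z * Im p + cross r p z * Im q + cross p q z * Im r"
      by (simp_all add: cross_def algebra_simps)
    have "Re z = (1 - u) * Re p + u * Re q" "Im z = (1 - u) * Im p + u * Im q"
      unfolding u01(3) unfolding u_def using id z d by (simp_all add: field_simps)
    then have "z = (1 - u) *\<^sub>R p + u *\<^sub>R q" by (simp add: complex_eq_iff)
    then show ?thesis using u01 by (auto simp: in_segment)
  qed
  show "frontier (triangle a b c) \<subseteq> closed_segment a b \<union> closed_segment b c \<union> closed_segment c a"
  proof
    fix z assume "z \<in> frontier (triangle a b c)"
    then have z: "z \<in> closure (triangle a b c)" "z \<notin> triangle a b c" using fr by auto
    have "closure (triangle a b c) \<subseteq> {z. 0 \<le> cross a b z} \<inter> {z. 0 \<le> cross b c z} \<inter> {z. 0 \<le> cross c a z}"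
      by (rule closure_minimal)
        (auto simp: triangle_def intro!: closed_Int closed_Collect_le continuous_cross continuous_intros)
    then have ge: "0 \<le> cross a b z" "0 \<le> cross b c z" "0 \<le> cross c a z" using z by auto
    then consider "cross a b z = 0" | "cross b c z = 0" | "cross c a z = 0"
      using z(2) by (force simp: triangle_def)
    then show "z \<in> closed_segment a b \<union> closed_segment b c \<union> closed_segment c a"
    proof cases
      case 1 then show ?thesis using seg[OF D] ge by blast
    next
      case 2 then show ?thesis using seg[of b c a z] ge D cyc by auto
    next
      case 3 then show ?thesis using seg[of c a b z] ge D cyc by auto
    qed
  qed
qed

text \<open>A straight edge with a flat rhombus around it. The factor 10 keeps edges that meet in a vertex apart.\<close>

definition straight :: "complex \<Rightarrow> complex \<Rightarrow> complex \<Rightarrow> complex" where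
  "straight a b z = a + (b - a) * Complex (Re z) (Im z / 10)"

lemma straight_ends [simp]: "straight a b 0 = a" "straight a b 1 = b"
  by (simp_all add: straight_def complex_eq_iff)

lemma seg_straight: "seg (straight a b) = closed_segment a b"
proof -
  have "straight a b (of_real t) = (1 - t) *\<^sub>R a + t *\<^sub>R b" for t
    by (simp add: straight_def complex_eq_iff algebra_simps)
  then show ?thesis by (auto simp: seg_def closed_segment_def)
qed

lemma lens_cases: "z \<in> lens \<Longrightarrow> z = 0 \<or> z = 1 \<or> (0 < Re z \<and> Re z < 1)"
  by (auto simp: lens_def complex_eq_iff)

text \<open>A drawing with straight edges all of whose faces but one are triangles. The edges \<open>ea f\<close>,
  \<open>eb f\<close> and \<open>ec f\<close> are the sides of the triangle \<open>f\<close>, the number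
  \<open>r\<close> stands for the unbounded face, and \<open>\<psi>\<close> and \<open>\<sigma>\<close>
  describe the isomorphism with the dual graph by numbers.\<close>

locale straight_polygon =
  fixes n m r :: nat and pos :: "nat \<Rightarrow> complex" and s t :: "nat \<Rightarrow> nat"
    and A B C :: "nat \<Rightarrow> nat" and ea eb ec :: "nat \<Rightarrow> nat" and \<sigma> :: "nat \<Rightarrow> nat" and \<psi> :: "nat \<Rightarrow> nat"
  assumes pos: "inj_on pos {..<n}" and st: "i < m \<Longrightarrow> s i < n \<and> t i < n \<and> s i \<noteq> t i" and n: "0 < n"
    and meet: "i < m \<Longrightarrow> j < m \<Longrightarrow> i < j \<Longrightarrow> z \<in> lens \<Longrightarrow> z' \<in> lens \<Longrightarrow> 0 < Re z \<Longrightarrow> Re z < 1 \<Longrightarrow>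
      straight (pos (s i)) (pos (t i)) z \<noteq> straight (pos (s j)) (pos (t j)) z'"
    and avoid: "i < m \<Longrightarrow> k < n \<Longrightarrow> z \<in> lens \<Longrightarrow> 0 < Re z \<Longrightarrow> Re z < 1 \<Longrightarrow>
      straight (pos (s i)) (pos (t i)) z \<noteq> pos k"
    and corners: "f < r \<Longrightarrow> A f < n \<and> B f < n \<and> C f < n"
    and orient: "f < r \<Longrightarrow> 0 < cross (pos (A f)) (pos (B f)) (pos (C f))"
    and tri_edges: "f < r \<Longrightarrow> ea f < m \<and> eb f < m \<and> ec f < m \<and> {s (ea f), t (ea f)} = {A f, B f} \<and>
      {s (eb f), t (eb f)} = {B f, C f} \<and> {s (ec f), t (ec f)} = {C f, A f}"
    and empty: "f < r \<Longrightarrow> i < m \<Longrightarrow> 0 \<le> u \<Longrightarrow> u \<le> 1 \<Longrightarrow>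
      (1 - u) *\<^sub>R pos (s i) + u *\<^sub>R pos (t i) \<notin> triangle (pos (A f)) (pos (B f)) (pos (C f))"
    and distinct_faces: "f < r \<Longrightarrow> f' < r \<Longrightarrow> {ea f, eb f, ec f} = {ea f', eb f', ec f'} \<Longrightarrow> f = f'"
    and ends_all: "k < n \<Longrightarrow> \<exists>i<m. k = s i \<or> k = t i"
    and euler_count: "r + 1 + n = m + 2"
    and block: "block {..<n} (\<lambda>i. {s i, t i}) {..<m}"
    and \<sigma>: "i < m \<Longrightarrow> \<sigma> i < m \<and> \<sigma> (\<sigma> i) = i \<and> \<sigma> i \<noteq> i"
    and \<psi>: "bij_betw \<psi> {..<n} {..r}"
    and polarity: "i < m \<Longrightarrow>
      (let X = {f \<in> {..<r}. \<sigma> i \<in> {ea f, eb f, ec f}} in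
        \<psi> ` {s i, t i} = (if card X = 1 then insert r X else X) \<and> X \<noteq> {})"
begin

definition "V = pos ` {..<n}"
definition "L i = straight (pos (s i)) (pos (t i))"
definition "tri f = triangle (pos (A f)) (pos (B f)) (pos (C f))"
definition "Ed = lens_edges {..<m} L"

lemma ends: "i < m \<Longrightarrow> lens_ends L i = pos ` {s i, t i}"
  by (simp add: lens_ends_def L_def)

lemma st_pos: "i < m \<Longrightarrow> pos (s i) \<noteq> pos (t i)"
  using st[of i] inj_onD[OF pos, of "s i" "t i"] by auto

lemma drawing: "lens_drawing V {..<m} L"
  unfolding lens_drawing_def
proof (intro conjI ballI impI)
  show "finite V" "V \<noteq> {}" "finite {..<m}" using n by (auto simp: V_def)
  show "continuous_on lens (L i)" for i
    unfolding L_def straight_def by (intro continuous_intros) auto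
  show "inj_on (L i) lens" if "i \<in> {..<m}" for i
  proof (rule inj_onI)
    fix x y assume "L i x = L i y"
    then have "(pos (t i) - pos (s i)) * Complex (Re x) (Im x / 10) = (pos (t i) - pos (s i)) * Complex (Re y) (Im y / 10)"
      by (simp only: L_def straight_def add_left_cancel)
    then have "Complex (Re x) (Im x / 10) = Complex (Re y) (Im y / 10)"
      using st_pos[of i] that unfolding mult_cancel_left by simp
    then show "x = y" by (simp add: complex_eq_iff)
  qed
  show "L i ` lens \<inter> V = lens_ends L i" if i: "i \<in> {..<m}" for i
  proof (intro equalityI subsetI)
    fix x assume x: "x \<in> L i ` lens \<inter> V"
    then obtain z k where z: "z \<in> lens" "x = L i z" "k < n" "x = pos k" by (auto simp: V_def)
    then have "z = 0 \<or> z = 1" using lens_cases[OF z(1)] avoid[of i k z] i by (auto simp: L_def)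
    then show "x \<in> lens_ends L i" using z by (auto simp: lens_ends_def)
  next
    fix x assume "x \<in> lens_ends L i"
    then have "x = L i 0 \<or> x = L i 1" by (simp add: lens_ends_def)
    moreover have "L i 0 \<in> V" "L i 1 \<in> V" using st[of i] i by (auto simp: L_def V_def)
    ultimately show "x \<in> L i ` lens \<inter> V" by auto
  qed
  have 1: "L i ` lens \<inter> L j ` lens \<subseteq> V" if ij: "i < m" "j < m" "i < j" for i j
  proof
    fix x assume "x \<in> L i ` lens \<inter> L j ` lens"
    then obtain z z' where z: "z \<in> lens" "z' \<in> lens" "x = L i z" "L i z = L j z'" by auto
    then have "z = 0 \<or> z = 1" using lens_cases[OF z(1)] meet[OF ij z(1,2)] by (auto simp: L_def)
    then have "x = pos (s i) \<or> x = pos (t i)" unfolding z(3) by (auto simp: L_def)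
    then show "x \<in> V" using st[OF ij(1)] by (auto simp: V_def)
  qed
  show "L i ` lens \<inter> L j ` lens \<subseteq> V" if "i \<in> {..<m}" "j \<in> {..<m}" "i \<noteq> j" for i j
    using 1[of i j] 1[of j i] that by (cases "i < j") auto
qed

sublocale G: plane_graph V Ed
  unfolding Ed_def by (rule lens_plane_graph[OF drawing])

lemma segs: "i < m \<Longrightarrow> seg (L i) = closed_segment (pos (s i)) (pos (t i))"
  by (simp add: L_def seg_straight)

lemma tri_sides:
  assumes "f < r"
  shows "seg (L (ea f)) = closed_segment (pos (A f)) (pos (B f))" "seg (L (eb f)) = closed_segment (pos (B f)) (pos (C f))"
    "seg (L (ec f)) = closed_segment (pos (C f)) (pos (A f))"
  using tri_edges[OF assms] by (auto simp: segs doubleton_eq_iff closed_segment_commute)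

lemma tri_frontier:
  assumes "f < r"
  shows "frontier (tri f) \<subseteq> seg (L (ea f)) \<union> seg (L (eb f)) \<union> seg (L (ec f))"
    "\<And>i. i \<in> {ea f, eb f, ec f} \<Longrightarrow> seg (L i) \<subseteq> frontier (tri f)"
  using triangle_frontier[OF orient[OF assms]] tri_sides[OF assms] unfolding tri_def by auto

lemma skeleton: "V \<union> \<Union>Ed = (\<Union>i<m. seg (L i))"
proof -
  have "pos k \<in> (\<Union>i<m. seg (L i))" if "k < n" for k
  proof -
    obtain i where "i < m" "k = s i \<or> k = t i" using ends_all \<open>k < n\<close> by blast
    then show ?thesis using segs by auto
  qed
  then show ?thesis by (auto simp: V_def Ed_def)
qed

text \<open>The triangle is connected and avoids the drawing, while its frontier is part of the drawing.\<close>

lemma tri_face: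
  assumes f: "f < r"
  shows "tri f \<in> faces V Ed"
proof -
  have off: "tri f \<inter> (V \<union> \<Union>Ed) = {}"
  proof -
    have "z \<notin> tri f" if "i < m" "z \<in> seg (L i)" for i z
      using empty[OF f that(1)] that(2) unfolding segs[OF that(1)] tri_def closed_segment_def by blast
    then show ?thesis unfolding skeleton by blast
  qed
  have fr: "frontier (tri f) \<subseteq> V \<union> \<Union>Ed"
  proof -
    have "seg (L i) \<subseteq> V \<union> \<Union>Ed" if "i < m" for i unfolding skeleton using that by blast
    then have "seg (L (ea f)) \<subseteq> V \<union> \<Union>Ed" "seg (L (eb f)) \<subseteq> V \<union> \<Union>Ed" "seg (L (ec f)) \<subseteq> V \<union> \<Union>Ed"
      using tri_edges[OF f] by simp_all
    then show ?thesis using tri_frontier(1)[OF f] by (meson le_supI subset_trans)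
  qed
  obtain x where x: "x \<in> tri f" using triangle_point[OF orient[OF f]] by (auto simp: tri_def)
  then have "x \<in> \<Union>(faces V Ed)" using off unfolding faces_def Union_components by blast
  then obtain U where U: "U \<in> faces V Ed" "x \<in> U" by blast
  have conn: "connected (tri f)" unfolding tri_def by (rule convex_connected[OF triangle_convex])
  have Uc: "U \<in> components (- (V \<union> \<Union>Ed))" using U by (simp add: faces_def)
  have "tri f \<subseteq> U" using components_maximal[OF Uc conn] off U x by blast
  moreover have "U \<subseteq> tri f"
  proof (rule ccontr)
    assume "\<not> U \<subseteq> tri f"
    then have "U \<inter> frontier (tri f) \<noteq> {}"
      using connected_Int_frontier[OF in_components_connected[OF Uc], of "tri f"] x U by blast
    then show False using fr in_components_subset[OF Uc] by blast
  qed
  ultimately show ?thesis using U by auto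
qed

lemma tri_side_iff:
  assumes f: "f < r" and i: "i < m"
  shows "tri f \<in> sides V Ed (seg (L i)) \<longleftrightarrow> i \<in> {ea f, eb f, ec f}"
proof
  assume "i \<in> {ea f, eb f, ec f}"
  then show "tri f \<in> sides V Ed (seg (L i))" using tri_face[OF f] tri_frontier(2)[OF f] by (simp add: sides_def)
next
  assume "tri f \<in> sides V Ed (seg (L i))"
  then have fr: "seg (L i) \<subseteq> seg (L (ea f)) \<union> seg (L (eb f)) \<union> seg (L (ec f))"
    using tri_frontier(1)[OF f] by (auto simp: sides_def)
  have iE: "seg (L i) \<in> Ed" using i by (auto simp: Ed_def)
  obtain p where p: "p \<in> seg (L i)" "p \<notin> V" using G.edge_point[OF iE] by blast
  obtain j where j: "j \<in> {ea f, eb f, ec f}" "p \<in> seg (L j)" using fr p by blast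
  then have jm: "j < m" using tri_edges[OF f] by auto
  have "seg (L i) = seg (L j)"
    using G.edges_meet[OF iE, of "seg (L j)"] p j jm by (auto simp: Ed_def)
  then have "i = j" using inj_onD[OF lens_inj[OF drawing]] i jm by blast
  then show "i \<in> {ea f, eb f, ec f}" using j by simp
qed

lemma tri_inj: "inj_on tri {..<r}"
proof (rule inj_onI)
  fix f f' assume f: "f \<in> {..<r}" "f' \<in> {..<r}" "tri f = tri f'"
  have "i \<in> {ea f, eb f, ec f} \<longleftrightarrow> i \<in> {ea f', eb f', ec f'}" for i
    using tri_side_iff[of f i] tri_side_iff[of f' i] f tri_edges[of f] tri_edges[of f'] by (cases "i < m") auto
  then have "{ea f, eb f, ec f} = {ea f', eb f', ec f'}" by (intro set_eqI)
  then show "f = f'" using distinct_faces[of f f'] f by simp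
qed

lemma block_V: "block V (lens_ends L) {..<m}"
proof -
  have R: "spans (pos ` W) (lens_ends L) X" if "spans W (\<lambda>i. {s i, t i}) X" "X \<subseteq> {..<m}" for W X
  proof -
    have "reach (lens_ends L) X (pos a) (pos b)" if "reach (\<lambda>i. {s i, t i}) X a b" for a b
      using that
    proof (induction rule: reach_induct)
      case (step y z e)
      have "lens_ends L e = {pos y, pos z}" using ends[of e] step \<open>X \<subseteq> {..<m}\<close> by auto
      then have "reach (lens_ends L) X (pos y) (pos z)" using step by (intro reach_edge[of e]) auto
      then show ?case using step.IH reach_trans by metis
    qed simp
    then show ?thesis using that by (auto simp: spans_def)
  qed
  have B: "spans {..<n} (\<lambda>i. {s i, t i}) {..<m}" "\<And>e. e < m \<Longrightarrow> spans {..<n} (\<lambda>i. {s i, t i}) ({..<m} - {e})"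
    "\<And>v. v < n \<Longrightarrow> spans ({..<n} - {v}) (\<lambda>i. {s i, t i}) {e \<in> {..<m}. v \<notin> {s e, t e}}"
    using block by (auto simp: block_def)
  have "spans (V - {pos v}) (lens_ends L) {e \<in> {..<m}. pos v \<notin> lens_ends L e}" if v: "v < n" for v
  proof -
    have "V - {pos v} = pos ` ({..<n} - {v})"
      unfolding V_def using inj_on_image_set_diff[OF pos, of "{..<n}" "{v}"] v by auto
    moreover have "{e \<in> {..<m}. pos v \<notin> lens_ends L e} = {e \<in> {..<m}. v \<notin> {s e, t e}}"
      using ends st v inj_onD[OF pos] by (auto simp: lens_ends_def L_def)
    ultimately show ?thesis using R[OF B(3)[OF v]] by auto
  qed
  then show ?thesis
    unfolding block_def using R[OF B(1)] R[OF B(2)] by (auto simp: V_def)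
qed

text \<open>By Euler's formula, the triangles and one more face are all faces. As every edge has exactly two
  sides, the last face is the second side of the edges on one triangle.\<close>

theorem polar: "\<exists>\<phi>. polar V {..<m} L \<sigma> \<phi>"
proof -
  have spansG: "spans V (drawn_ends V) Ed"
  proof -
    have "spans V (lens_ends L) {..<m}" using block_V by (simp add: block_def)
    moreover have "reach (\<lambda>i. drawn_ends V (seg (L i))) {..<m} x y \<longleftrightarrow> reach (lens_ends L) {..<m} x y" for x y
      by (rule reach_cong) (use lens_drawingD(5)[OF drawing] in auto)
    ultimately show ?thesis unfolding Ed_def spans_edge_image by (simp add: spans_def)
  qed
  have cV: "card V = n" unfolding V_def using card_image[OF pos] by simp
  have cE: "card Ed = m" unfolding Ed_def using card_image[OF lens_inj[OF drawing]] by simp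
  have cF: "finite (faces V Ed)" "card (faces V Ed) = r + 1"
    using G.euler[OF spansG] cV cE euler_count by auto
  have sub: "tri ` {..<r} \<subseteq> faces V Ed" using tri_face by auto
  have "card (faces V Ed - tri ` {..<r}) = 1"
    using card_Diff_subset[OF _ sub] card_image[OF tri_inj] cF by simp
  then obtain Out where Out: "faces V Ed - tri ` {..<r} = {Out}" by (rule card_1_singletonE)
  define fc where "fc f = (if f < r then tri f else Out)" for f
  have fc_bij: "bij_betw fc {..r} (faces V Ed)"
  proof -
    have "{..r} = insert r {..<r}" by auto
    moreover have "fc ` {..<r} = tri ` {..<r}" by (simp add: fc_def)
    moreover have "inj_on fc {..<r}" using tri_inj by (simp add: inj_on_def fc_def)
    moreover have "fc r = Out" by (simp add: fc_def)
    moreover have "Out \<notin> tri ` {..<r}" "faces V Ed = insert Out (tri ` {..<r})" using Out sub by blast+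
    ultimately show ?thesis by (simp add: bij_betw_def)
  qed
  define \<phi> where "\<phi> = fc \<circ> \<psi> \<circ> the_inv_into {..<n} pos"
  have \<phi>_pos: "\<phi> (pos k) = fc (\<psi> k)" if "k < n" for k
    using the_inv_into_f_f[OF pos, of k] that by (simp add: \<phi>_def)
  have \<phi>_bij: "bij_betw \<phi> V (faces V Ed)"
  proof -
    have "bij_betw (the_inv_into {..<n} pos) V {..<n}"
      unfolding V_def by (rule bij_betw_the_inv_into) (simp add: bij_betw_def pos)
    then show ?thesis unfolding \<phi>_def by (intro bij_betw_trans[OF _ bij_betw_trans[OF \<psi> fc_bij]])
  qed
  have "sides V Ed (seg (L (\<sigma> i))) = \<phi> ` lens_ends L i" if i: "i < m" for i
  proof -
    define j where "j = \<sigma> i"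
    have j: "j < m" using \<sigma>[OF i] by (simp add: j_def)
    have jE: "seg (L j) \<in> Ed" using j by (auto simp: Ed_def)
    obtain a b where ab: "seg (L j) \<inter> V = {a, b}" "a \<in> V" "b \<in> V"
      using G.ends_ex[OF jE] by blast
    have "reach (drawn_ends V) (Ed - {seg (L j)}) a b"
    proof -
      have 1: "Ed - {seg (L j)} = (\<lambda>i. seg (L i)) ` ({..<m} - {j})"
        unfolding Ed_def using inj_on_image_set_diff[OF lens_inj[OF drawing], of "{..<m}" "{j}"] j by auto
      have "reach (lens_ends L) ({..<m} - {j}) a b" using block_V j ab by (auto simp: block_def spans_def)
      then have "reach (\<lambda>i. drawn_ends V (seg (L i))) ({..<m} - {j}) a b"
        by (subst reach_cong[where d' = "lens_ends L"]) (use lens_drawingD(5)[OF drawing] in auto)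
      then show ?thesis unfolding 1 reach_edge_image .
    qed
    then obtain U1 U2 where U: "U1 \<noteq> U2" "sides V Ed (seg (L j)) = {U1, U2}"
      using G.sides_nonbridge[OF jE ab(1)] by metis
    then have c2: "card (sides V Ed (seg (L j))) = 2" by simp
    define X where "X = {f \<in> {..<r}. j \<in> {ea f, eb f, ec f}}"
    have X: "\<psi> ` {s i, t i} = (if card X = 1 then insert r X else X)" "X \<noteq> {}"
      using polarity[OF i] unfolding j_def[symmetric] X_def[symmetric] Let_def by auto
    have finX: "finite X" "X \<subseteq> {..<r}" by (auto simp: X_def)
    have inter: "sides V Ed (seg (L j)) \<inter> tri ` {..<r} = tri ` X"
      using tri_side_iff[OF _ j] by (auto simp: X_def)
    have upper: "sides V Ed (seg (L j)) \<subseteq> insert Out (tri ` {..<r})"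
      using Out by (auto simp: sides_def)
    have sd: "sides V Ed (seg (L j)) = tri ` X \<or> sides V Ed (seg (L j)) = insert Out (tri ` X)"
    proof -
      have "S = B \<or> S = insert q B" if "S \<inter> A = B" "S \<subseteq> insert q A" for S A B and q :: "complex set"
        using that by blast
      from this[OF inter upper] show ?thesis .
    qed
    have cX: "card (tri ` X) = card X" by (rule card_image[OF inj_on_subset[OF tri_inj finX(2)]])
    have Outn: "Out \<notin> tri ` X" using Out finX by blast
    have "sides V Ed (seg (L j)) = fc ` (if card X = 1 then insert r X else X)"
    proof -
      have fcX: "fc ` X = tri ` X" using finX by (intro image_cong) (auto simp: fc_def)
      have fcr: "fc r = Out" by (simp add: fc_def)
      have card_psi: "card (\<psi> ` {s i, t i}) = 2"
      proof -
        have "\<psi> (s i) \<noteq> \<psi> (t i)" using \<psi> st[OF i] unfolding bij_betw_def by (metis inj_onD lessThan_iff)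
        then show ?thesis by simp
      qed
      show ?thesis
      proof (cases "card X = 1")
        case True
        then have "sides V Ed (seg (L j)) = insert Out (tri ` X)" using sd c2 cX by auto
        then show ?thesis using True fcX fcr by simp
      next
        case False
        then have "card X = 2" using X(1) card_psi by simp
        then have "sides V Ed (seg (L j)) = tri ` X" using sd c2 cX Outn finX by auto
        then show ?thesis using False fcX by simp
      qed
    qed
    also have "\<dots> = fc ` \<psi> ` {s i, t i}" using X(1) by simp
    also have "\<dots> = \<phi> ` lens_ends L i"
      unfolding ends[OF i] using \<phi>_pos st[OF i] by auto
    finally show ?thesis by (simp add: j_def)
  qed
  then have "polar V {..<m} L \<sigma> \<phi>"
    unfolding polar_def using drawing block_V \<phi>_bij \<sigma> by (auto simp: Ed_def)
  then show ?thesis by blast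
qed

lemma tree_sum_list:
  "tree_sum V (lens_ends L) {..<m} x y = delcon n (map (\<lambda>i. (s i, t i, x i, y i)) [0..<m])"
proof -
  have "tree_sum V (lens_ends L) {..<m} x y = tree_sum (pos ` {..<n}) (\<lambda>i. pos ` {s i, t i}) {..<m} x y"
    unfolding V_def by (rule tree_sum_cong) (use ends in auto)
  also have "\<dots> = tree_sum {..<n} (\<lambda>i. {s i, t i}) {..<m} x y"
    by (rule tree_sum_vertex_image[OF pos]) (use st in auto)
  also have "\<dots> = tree_sum {..<n} (\<lambda>i. {s i, t i}) (set [0..<m]) x y" by (simp add: lessThan_atLeast0)
  also have "\<dots> = delcon (card {..<n}) (map (\<lambda>i. (s i, t i, x i, y i)) [0..<m])"
    by (rule delcon_tree_sum) (use n st in auto)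
  finally show ?thesis by simp
qed

end

text \<open>Connectedness can be read off from the number of trees.\<close>

lemma spans_delcon:
  assumes "finite V" "V \<noteq> {}" "distinct is" "\<And>i. i \<in> set is \<Longrightarrow> s i \<in> V \<and> t i \<in> V"
    "delcon (card V) (map (\<lambda>i. (s i, t i, 1, 1)) is) \<noteq> 0"
  shows "spans V (\<lambda>i. {s i, t i}) (set is)"
proof -
  have "tree_sum V (\<lambda>i. {s i, t i}) (set is) (\<lambda>_. 1) (\<lambda>_. 1) \<noteq> 0"
    using delcon_tree_sum[OF assms(1-3), of s t "\<lambda>i. {s i, t i}" "\<lambda>_. 1" "\<lambda>_. 1"] assms(4,5) by simp
  then have "trees V (\<lambda>i. {s i, t i}) (set is) \<noteq> {}"
    using tree_sum_card[of "set is" "\<lambda>_. 1" "\<lambda>_. 1" V "\<lambda>i. {s i, t i}"] by auto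
  then obtain T where "T \<subseteq> set is" "spans V (\<lambda>i. {s i, t i}) T" by (auto simp: trees_def)
  then show ?thesis using spans_mono by blast
qed

lemma block_delcon:
  assumes n: "2 \<le> n" and st: "\<And>i. i < m \<Longrightarrow> s i < n \<and> t i < n"
    and edges: "\<forall>e\<in>set [0..<m]. delcon n (map (\<lambda>i. (s i, t i, 1, 1)) (filter (\<lambda>i. i \<noteq> e) [0..<m])) \<noteq> 0"
    and verts: "\<forall>v\<in>set [0..<n]. delcon (n - 1) (map (\<lambda>i. (s i, t i, 1, 1)) (filter (\<lambda>i. v \<noteq> s i \<and> v \<noteq> t i) [0..<m])) \<noteq> 0"
    and m: "0 < m"
  shows "block {..<n} (\<lambda>i. {s i, t i}) {..<m}"
proof -
  have E: "spans {..<n} (\<lambda>i. {s i, t i}) ({..<m} - {e})" if "e < m" for e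
  proof -
    have "spans {..<n} (\<lambda>i. {s i, t i}) (set (filter (\<lambda>i. i \<noteq> e) [0..<m]))"
      by (rule spans_delcon) (use n st edges that in auto)
    moreover have "set (filter (\<lambda>i. i \<noteq> e) [0..<m]) = {..<m} - {e}" by auto
    ultimately show ?thesis by simp
  qed
  moreover have "spans {..<n} (\<lambda>i. {s i, t i}) {..<m}" by (rule spans_mono[OF E[OF m]]) auto
  moreover have "spans ({..<n} - {v}) (\<lambda>i. {s i, t i}) {e \<in> {..<m}. v \<notin> {s e, t e}}" if v: "v < n" for v
  proof -
    have "{..<n} - {v} \<noteq> {}"
    proof -
      have "card ({..<n} - {v}) = n - 1" using v by simp
      then have "card ({..<n} - {v}) \<noteq> 0" using n by linarith
      then show ?thesis by (metis card.empty)
    qed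
    then have "spans ({..<n} - {v}) (\<lambda>i. {s i, t i}) (set (filter (\<lambda>i. v \<noteq> s i \<and> v \<noteq> t i) [0..<m]))"
      by (intro spans_delcon) (use n st verts v in auto)
    moreover have "set (filter (\<lambda>i. v \<noteq> s i \<and> v \<noteq> t i) [0..<m]) = {e \<in> {..<m}. v \<notin> {s e, t e}}" by auto
    ultimately show ?thesis by simp
  qed
  ultimately show ?thesis unfolding block_def by auto
qed

section \<open>The base graphs\<close>

lemma straight_coordinates:
  assumes "straight a b z = w" "z \<in> lens"
  shows "Re w = Re a + (Re b - Re a) * Re z - (Im b - Im a) * (Im z / 10)"
    "Im w = Im a + (Re b - Re a) * (Im z / 10) + (Im b - Im a) * Re z"
    "Im z / 10 \<le> Re z / 10" "- (Im z / 10) \<le> Re z / 10"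
    "Im z / 10 \<le> (1 - Re z) / 10" "- (Im z / 10) \<le> (1 - Re z) / 10"
  using assms by (auto simp: straight_def lens_def)

lemma straight_avoids:
  assumes "\<And>x y. Re w = Re a + (Re b - Re a) * x - (Im b - Im a) * y \<Longrightarrow>
      Im w = Im a + (Re b - Re a) * y + (Im b - Im a) * x \<Longrightarrow>
      y \<le> x / 10 \<Longrightarrow> - y \<le> x / 10 \<Longrightarrow> y \<le> (1 - x) / 10 \<Longrightarrow> - y \<le> (1 - x) / 10 \<Longrightarrow> 0 < x \<Longrightarrow> x < 1 \<Longrightarrow> False"
    "z \<in> lens" "0 < Re z" "Re z < 1"
  shows "straight a b z \<noteq> w"
  using assms(1)[OF straight_coordinates[OF _ assms(2)] assms(3,4)] by blast

text \<open>For concrete points, the assumption is a problem of linear arithmetic in the coordinates of the points of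
  the two squares.\<close>

lemma straight_apart:
  assumes "\<And>x y x' y'. Re a + (Re b - Re a) * x - (Im b - Im a) * y = Re c + (Re d - Re c) * x' - (Im d - Im c) * y' \<Longrightarrow>
      Im a + (Re b - Re a) * y + (Im b - Im a) * x = Im c + (Re d - Re c) * y' + (Im d - Im c) * x' \<Longrightarrow>
      y \<le> x / 10 \<Longrightarrow> - y \<le> x / 10 \<Longrightarrow> y \<le> (1 - x) / 10 \<Longrightarrow> - y \<le> (1 - x) / 10 \<Longrightarrow> 0 < x \<Longrightarrow> x < 1 \<Longrightarrow>
      y' \<le> x' / 10 \<Longrightarrow> - y' \<le> x' / 10 \<Longrightarrow> y' \<le> (1 - x') / 10 \<Longrightarrow> - y' \<le> (1 - x') / 10 \<Longrightarrow> False"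
    "z \<in> lens" "z' \<in> lens" "0 < Re z" "Re z < 1"
  shows "straight a b z \<noteq> straight c d z'"
proof
  assume eq: "straight a b z = straight c d z'"
  note S = straight_coordinates[OF eq assms(2)] and S' = straight_coordinates[of c d z', OF refl assms(3)]
  show False
    by (rule assms(1)[of "Re z" "Im z / 10" "Re z'" "Im z' / 10"]) (use S S' assms(4,5) in linarith)+
qed

lemma segment_outside_triangle:
  assumes "cross a b p \<le> 0 \<and> cross a b q \<le> 0 \<or> cross b c p \<le> 0 \<and> cross b c q \<le> 0 \<or> cross c a p \<le> 0 \<and> cross c a q \<le> 0"
    and "0 \<le> u" "u \<le> 1"
  shows "(1 - u) *\<^sub>R p + u *\<^sub>R q \<notin> triangle a b c"
proof -
  have "\<not> 0 < (1 - u) * x + u * y" if "x \<le> 0" "y \<le> 0" for x y :: real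
    using mult_nonneg_nonpos[of "1 - u" x] mult_nonneg_nonpos[of u y] that assms(2,3) by simp
  then show ?thesis using assms(1) unfolding triangle_def mem_Collect_eq cross_affine by blast
qed

lemma less_6: "(i::nat) < 6 \<longleftrightarrow> i = 0 \<or> i = 1 \<or> i = 2 \<or> i = 3 \<or> i = 4 \<or> i = 5" by auto
lemma less_4: "(i::nat) < 4 \<longleftrightarrow> i = 0 \<or> i = 1 \<or> i = 2 \<or> i = 3" by auto
lemma less_3: "(i::nat) < 3 \<longleftrightarrow> i = 0 \<or> i = 1 \<or> i = 2" by auto
lemma less_5: "(i::nat) < 5 \<longleftrightarrow> i = 0 \<or> i = 1 \<or> i = 2 \<or> i = 3 \<or> i = 4" by auto
lemma less_10: "(i::nat) < 10 \<longleftrightarrow> i = 0 \<or> i = 1 \<or> i = 2 \<or> i = 3 \<or> i = 4 \<or> i = 5 \<or> i = 6 \<or> i = 7 \<or> i = 8 \<or> i = 9" by auto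

text \<open>The complete graph on four vertices: a triangle with a central vertex 0, whose edges come first.\<close>

definition pos4 :: "nat \<Rightarrow> complex" where
  "pos4 k = [0, Complex 2 (-1), Complex 0 2, Complex (-2) (-1)] ! k"
definition src4 :: "nat \<Rightarrow> nat" where "src4 i = [0, 0, 0, 1, 2, 3] ! i"
definition tgt4 :: "nat \<Rightarrow> nat" where "tgt4 i = [1, 2, 3, 2, 3, 1] ! i"

lemmas K4_defs = pos4_def src4_def tgt4_def

interpretation K4: straight_polygon 4 6 3 pos4 src4 tgt4
  "\<lambda>_. 0" "\<lambda>f. f + 1" "\<lambda>f. [2, 3, 1] ! f" "\<lambda>f. f" "\<lambda>f. f + 3" "\<lambda>f. [1, 2, 0] ! f"
  "\<lambda>i. [4, 5, 3, 2, 0, 1] ! i" "\<lambda>k. [3, 1, 2, 0] ! k"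
proof
  show "inj_on pos4 {..<4}"
  proof -
    have "{..<4} = {0, 1, 2, 3 :: nat}" by auto
    then show ?thesis by (simp add: inj_on_def pos4_def complex_eq_iff)
  qed
  show "src4 i < 4 \<and> tgt4 i < 4 \<and> src4 i \<noteq> tgt4 i" if "i < 6" for i
    using that unfolding less_6 by (elim disjE) (simp_all add: K4_defs)
  show "straight (pos4 (src4 i)) (pos4 (tgt4 i)) z \<noteq> straight (pos4 (src4 j)) (pos4 (tgt4 j)) z'"
    if "i < 6" "j < 6" "i < j" "z \<in> lens" "z' \<in> lens" "0 < Re z" "Re z < 1" for i j z z'
    by (rule straight_apart[OF _ that(4-7)])
      (use that(1-3) in \<open>unfold less_6, elim disjE; clarsimp simp: K4_defs; linarith\<close>)
  show "straight (pos4 (src4 i)) (pos4 (tgt4 i)) z \<noteq> pos4 k"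
    if "i < 6" "k < 4" "z \<in> lens" "0 < Re z" "Re z < 1" for i k z
    by (rule straight_avoids[OF _ that(3-5)])
      (use that(1,2) in \<open>unfold less_6 less_4, elim disjE; clarsimp simp: K4_defs; linarith\<close>)
  show "0 < (4::nat) \<and> f + 1 < 4 \<and> [2, 3, 1] ! f < (4::nat)" if "f < 3" for f
    using that unfolding less_3 by auto
  show "0 < cross (pos4 0) (pos4 (f + 1)) (pos4 ([2, 3, 1] ! f))" if "f < 3" for f
    using that unfolding less_3 by (elim disjE) (simp_all add: K4_defs cross_def)
  show "f < 6 \<and> f + 3 < 6 \<and> [1, 2, 0] ! f < (6::nat) \<and> {src4 f, tgt4 f} = {0, f + 1} \<and>
      {src4 (f + 3), tgt4 (f + 3)} = {f + 1, [2, 3, 1] ! f} \<and>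
      {src4 ([1, 2, 0] ! f), tgt4 ([1, 2, 0] ! f)} = {[2, 3, 1] ! f, 0}" if "f < 3" for f
    using that unfolding less_3 by (elim disjE) (simp_all add: K4_defs insert_commute numeral_eq_Suc)
  show "(1 - u) *\<^sub>R pos4 (src4 i) + u *\<^sub>R pos4 (tgt4 i) \<notin> triangle (pos4 0) (pos4 (f + 1)) (pos4 ([2, 3, 1] ! f))"
    if "f < 3" "i < 6" "0 \<le> u" "u \<le> 1" for f i u
    by (rule segment_outside_triangle[OF _ that(3,4)])
      (use that(1,2) in \<open>unfold less_3 less_6, elim disjE; simp add: K4_defs cross_def\<close>)
  show "f = f'" if "f < 3" "f' < 3" "{f, f + 3, [1, 2, 0] ! f} = {f', f' + 3, [1, 2, 0] ! f'}" for f f' :: nat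
    using that unfolding less_3 by (elim disjE) (simp_all add: doubleton_eq_iff set_eq_iff, presburger+)
  show "\<exists>i<6. k = src4 i \<or> k = tgt4 i" if "k < 4" for k
  proof -
    have src: "src4 0 = 0" "src4 3 = 1" "src4 4 = 2" "src4 5 = 3" by (simp_all add: src4_def)
    show ?thesis
      using that unfolding less_4 by (elim disjE) (rule exI[of _ 0], simp add: src, rule exI[of _ 3], simp add: src, rule exI[of _ 4], simp add: src, rule exI[of _ 5], simp add: src)
  qed
  show "block {..<4} (\<lambda>i. {src4 i, tgt4 i}) {..<6}"
    by (rule block_delcon) (auto simp: less_6 K4_defs upt_rec)
  show "[4, 5, 3, 2, 0, 1] ! i < (6::nat) \<and> [4, 5, 3, 2, 0, 1] ! ([4, 5, 3, 2, 0, 1] ! i) = i \<and>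
      [4, 5, 3, 2, 0, 1] ! i \<noteq> i" if "i < 6" for i :: nat
    using that unfolding less_6 by (elim disjE) simp_all
  show "bij_betw (\<lambda>k. [3, 1, 2, 0] ! k) {..<4} {..3::nat}"
  proof -
    have "{..<4} = {0, 1, 2, 3::nat}" "{..3} = {0, 1, 2, 3::nat}" by auto
    then show ?thesis by (auto simp: bij_betw_def inj_on_def)
  qed
  show "let X = {f \<in> {..<3}. [4, 5, 3, 2, 0, 1] ! i \<in> {f, f + 3, [1, 2, 0] ! f}} in
      (\<lambda>k. [3, 1, 2, 0] ! k) ` {src4 i, tgt4 i} = (if card X = 1 then insert 3 X else X) \<and> X \<noteq> {}"
    if "i < 6" for i :: nat
  proof -
    have F: "{f \<in> {..<3}. P f} = (if P 0 then {0} else {}) \<union> (if P 1 then {1} else {}) \<union> (if P 2 then {2} else {})"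
      for P :: "nat \<Rightarrow> bool" by (auto simp: less_3 intro!: gr0I)
    show ?thesis using that unfolding less_6 F by (elim disjE) (auto simp: K4_defs Let_def)
  qed
qed auto

lemma K4_count:
  assumes "0 < p1" "0 < p2" "0 < p3" "0 < q1" "0 < q2" "(0::nat) < q3"
  shows "tree_sum K4.V (lens_ends K4.L) {..<6} (\<lambda>i. [p1, p2, p3, q3, q1, q2] ! i) (\<lambda>i. [q1, q2, q3, p3, p1, p2] ! i) =
    (p1 * p2 * p3 + p1 * q2 * q3 + p2 * q1 * q3 + p3 * q1 * q2)\<^sup>2"
  unfolding K4.tree_sum_list using assms
  by (simp add: upt_rec K4_defs) (simp add: power2_eq_square algebra_simps)

text \<open>The wheel with five spokes; the spokes come first.\<close>

definition pos5 :: "nat \<Rightarrow> complex" where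
  "pos5 k = [0, Complex 2 (-2), Complex 3 1, Complex 0 3, Complex (-3) 1, Complex (-2) (-2)] ! k"
definition src5 :: "nat \<Rightarrow> nat" where "src5 i = [0, 0, 0, 0, 0, 1, 2, 3, 4, 5] ! i"
definition tgt5 :: "nat \<Rightarrow> nat" where "tgt5 i = [1, 2, 3, 4, 5, 2, 3, 4, 5, 1] ! i"

lemmas W5_defs = pos5_def src5_def tgt5_def

interpretation W5: straight_polygon 6 10 5 pos5 src5 tgt5
  "\<lambda>_. 0" "\<lambda>f. f + 1" "\<lambda>f. [2, 3, 4, 5, 1] ! f" "\<lambda>f. f" "\<lambda>f. f + 5" "\<lambda>f. [1, 2, 3, 4, 0] ! f"
  "\<lambda>i. [7, 8, 9, 5, 6, 3, 4, 0, 1, 2] ! i" "\<lambda>k. [5, 2, 3, 4, 0, 1] ! k"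
proof
  show "inj_on pos5 {..<6}"
  proof -
    have "{..<6} = {0, 1, 2, 3, 4, 5 :: nat}" by auto
    then show ?thesis by (simp add: inj_on_def pos5_def complex_eq_iff)
  qed
  show "src5 i < 6 \<and> tgt5 i < 6 \<and> src5 i \<noteq> tgt5 i" if "i < 10" for i
    using that unfolding less_10 by (elim disjE) (simp_all add: W5_defs)
  show "straight (pos5 (src5 i)) (pos5 (tgt5 i)) z \<noteq> straight (pos5 (src5 j)) (pos5 (tgt5 j)) z'"
    if "i < 10" "j < 10" "i < j" "z \<in> lens" "z' \<in> lens" "0 < Re z" "Re z < 1" for i j z z'
  proof (rule straight_apart[OF _ that(4-7)])
  qed (use that(1-3) in \<open>unfold less_10, elim disjE; clarsimp simp: W5_defs; linarith\<close>)
  show "straight (pos5 (src5 i)) (pos5 (tgt5 i)) z \<noteq> pos5 k"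
    if "i < 10" "k < 6" "z \<in> lens" "0 < Re z" "Re z < 1" for i k z
    by (rule straight_avoids[OF _ that(3-5)])
      (use that(1,2) in \<open>unfold less_10 less_6, elim disjE; clarsimp simp: W5_defs; linarith\<close>)
  show "0 < (6::nat) \<and> f + 1 < 6 \<and> [2, 3, 4, 5, 1] ! f < (6::nat)" if "f < 5" for f
    using that unfolding less_5 by auto
  show "0 < cross (pos5 0) (pos5 (f + 1)) (pos5 ([2, 3, 4, 5, 1] ! f))" if "f < 5" for f
    using that unfolding less_5 by (elim disjE) (simp_all add: W5_defs cross_def)
  show "f < 10 \<and> f + 5 < 10 \<and> [1, 2, 3, 4, 0] ! f < (10::nat) \<and> {src5 f, tgt5 f} = {0, f + 1} \<and>
      {src5 (f + 5), tgt5 (f + 5)} = {f + 1, [2, 3, 4, 5, 1] ! f} \<and>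
      {src5 ([1, 2, 3, 4, 0] ! f), tgt5 ([1, 2, 3, 4, 0] ! f)} = {[2, 3, 4, 5, 1] ! f, 0}" if "f < 5" for f
    using that unfolding less_5 by (elim disjE) (simp_all add: W5_defs insert_commute numeral_eq_Suc)
  show "(1 - u) *\<^sub>R pos5 (src5 i) + u *\<^sub>R pos5 (tgt5 i) \<notin> triangle (pos5 0) (pos5 (f + 1)) (pos5 ([2, 3, 4, 5, 1] ! f))"
    if "f < 5" "i < 10" "0 \<le> u" "u \<le> 1" for f i u
    by (rule segment_outside_triangle[OF _ that(3,4)])
      (use that(1,2) in \<open>unfold less_5 less_10, elim disjE; simp add: W5_defs cross_def\<close>)
  show "f = f'" if "f < 5" "f' < 5" "{f, f + 5, [1, 2, 3, 4, 0] ! f} = {f', f' + 5, [1, 2, 3, 4, 0] ! f'}" for f f' :: nat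
    using that unfolding less_5 by (elim disjE) (simp_all add: doubleton_eq_iff set_eq_iff, presburger+)
  show "\<exists>i<10. k = src5 i \<or> k = tgt5 i" if "k < 6" for k
  proof -
    have src: "src5 0 = 0" "src5 5 = 1" "src5 6 = 2" "src5 7 = 3" "src5 8 = 4" "src5 9 = 5" by (simp_all add: src5_def)
    show ?thesis
      using that unfolding less_6 by (elim disjE) (rule exI[of _ 0], simp add: src, rule exI[of _ 5], simp add: src, rule exI[of _ 6], simp add: src, rule exI[of _ 7], simp add: src, rule exI[of _ 8], simp add: src, rule exI[of _ 9], simp add: src)
  qed
  show "block {..<6} (\<lambda>i. {src5 i, tgt5 i}) {..<10}"
  proof (rule block_delcon)
  qed (auto simp: less_10 W5_defs upt_rec)
  show "[7, 8, 9, 5, 6, 3, 4, 0, 1, 2] ! i < (10::nat) \<and>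
      [7, 8, 9, 5, 6, 3, 4, 0, 1, 2] ! ([7, 8, 9, 5, 6, 3, 4, 0, 1, 2] ! i) = i \<and>
      [7, 8, 9, 5, 6, 3, 4, 0, 1, 2] ! i \<noteq> i" if "i < 10" for i :: nat
    using that unfolding less_10 by (elim disjE) simp_all
  show "bij_betw (\<lambda>k. [5, 2, 3, 4, 0, 1] ! k) {..<6} {..5::nat}"
  proof -
    have "{..<6} = {0, 1, 2, 3, 4, 5::nat}" "{..5} = {0, 1, 2, 3, 4, 5::nat}" by auto
    then show ?thesis by (auto simp: bij_betw_def inj_on_def)
  qed
  show "let X = {f \<in> {..<5}. [7, 8, 9, 5, 6, 3, 4, 0, 1, 2] ! i \<in> {f, f + 5, [1, 2, 3, 4, 0] ! f}} in
      (\<lambda>k. [5, 2, 3, 4, 0, 1] ! k) ` {src5 i, tgt5 i} = (if card X = 1 then insert 5 X else X) \<and> X \<noteq> {}"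
    if "i < 10" for i :: nat
  proof -
    have F: "{f \<in> {..<5}. P f} = (if P 0 then {0} else {}) \<union> (if P 1 then {1} else {}) \<union> (if P 2 then {2} else {}) \<union>
        (if P 3 then {3} else {}) \<union> (if P 4 then {4} else {})"
      for P :: "nat \<Rightarrow> bool" by (auto simp: less_5 intro!: gr0I)
    show ?thesis using that unfolding less_10 F by (elim disjE) (auto simp: W5_defs Let_def)
  qed
qed auto

lemma W5_count: "tree_sum W5.V (lens_ends W5.L) {..<10} (\<lambda>_. 1) (\<lambda>_. 1) = 121"
  unfolding W5.tree_sum_list by (simp add: upt_rec W5_defs)

definition realized :: "nat \<Rightarrow> bool" where
  "realized n \<longleftrightarrow> (\<exists>V E. plane_drawing V E \<and> E \<noteq> {} \<and> self_dual V E \<and>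
     \<not> (\<exists>v. cut_vertex (drawn_graph V E) v) \<and> card (spanning_trees (drawn_graph V E)) = n)"

lemma realizedI:
  assumes "polar V I L \<sigma> \<phi>" "I \<noteq> {}" "tree_sum V (lens_ends L) I (\<lambda>_. 1) (\<lambda>_. 1) = n"
  shows "realized n"
  unfolding realized_def using polar_realizes[OF assms(1,2)] assms(3) by blast

lemma realized_121: "realized 121"
proof -
  obtain \<phi> where "polar W5.V {..<10} W5.L (\<lambda>i. [7, 8, 9, 5, 6, 3, 4, 0, 1, 2] ! i) \<phi>" using W5.polar by blast
  moreover have "{..<10 :: nat} \<noteq> {}" by (simp add: lessThan_empty_iff)
  ultimately show ?thesis using W5_count by (rule realizedI)
qed

lemma refines_all_ones:
  assumes R: "refines V I L \<sigma> e p q V' I' L' \<sigma>'" and xy: "\<And>i. i \<in> I' - (I - {e, \<sigma> e}) \<Longrightarrow> x i = 1 \<and> y i = 1"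
  shows "tree_sum V' (lens_ends L') I' x y = tree_sum V (lens_ends L) I (x(e := p, \<sigma> e := q)) (y(e := q, \<sigma> e := p))"
  using R xy unfolding refines_def by blast

lemma realized_K4:
  assumes c: "coprime p1 q1" "coprime p2 q2" "coprime p3 (q3 :: nat)"
    and pos: "0 < p1" "0 < q1" "0 < p2" "0 < q2" "0 < p3" "0 < q3"
  shows "realized ((p1 * p2 * p3 + p1 * q2 * q3 + p2 * q1 * q3 + p3 * q1 * q2)\<^sup>2)"
proof -
  define \<sigma> :: "nat \<Rightarrow> nat" where "\<sigma> = (\<lambda>i. [4, 5, 3, 2, 0, 1] ! i)"
  obtain \<phi> where P: "polar K4.V {..<6} K4.L \<sigma> \<phi>" using K4.polar unfolding \<sigma>_def by blast
  have \<sigma>: "\<sigma> 0 = 4" "\<sigma> 1 = 5" "\<sigma> 2 = 3" by (simp_all add: \<sigma>_def)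
  obtain V1 I1 L1 \<sigma>1 \<phi>1 where S1: "polar V1 I1 L1 \<sigma>1 \<phi>1" "refines K4.V {..<6} K4.L \<sigma> 0 p1 q1 V1 I1 L1 \<sigma>1"
    using network[OF P, of 0 p1 q1] c pos by auto
  have \<sigma>1: "\<sigma>1 1 = 5" "\<sigma>1 2 = 3" "{..<6} \<subseteq> I1" using S1(2) \<sigma> by (auto simp: refines_def)
  then have i1: "{0, 1, 2, 3, 4, 5} \<subseteq> I1" by auto
  obtain V2 I2 L2 \<sigma>2 \<phi>2 where S2: "polar V2 I2 L2 \<sigma>2 \<phi>2" "refines V1 I1 L1 \<sigma>1 1 p2 q2 V2 I2 L2 \<sigma>2"
    using network[OF S1(1), of 1 p2 q2] c pos i1 by auto
  have \<sigma>2: "\<sigma>2 2 = 3" "I1 \<subseteq> I2" using S2(2) \<sigma>1 i1 by (auto simp: refines_def)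
  have i2: "2 \<in> I2" using i1 \<sigma>2 by auto
  obtain V3 I3 L3 \<sigma>3 \<phi>3 where S3: "polar V3 I3 L3 \<sigma>3 \<phi>3" "refines V2 I2 L2 \<sigma>2 2 p3 q3 V3 I3 L3 \<sigma>3"
    using network[OF S2(1), of 2 p3 q3] c pos i2 by auto
  have "I2 \<subseteq> I3" using S3(2) by (simp add: refines_def)
  then have ne: "I3 \<noteq> {}" using i1 \<sigma>2 by auto
  let ?o = "(\<lambda>_. 1) :: nat \<Rightarrow> nat"
  define x3 y3 where "x3 = ?o(2 := p3, 3 := q3)" and "y3 = ?o(2 := q3, 3 := p3)"
  define x2 y2 where "x2 = x3(1 := p2, 5 := q2)" and "y2 = y3(1 := q2, 5 := p2)"
  define x1 y1 where "x1 = x2(0 := p1, 4 := q1)" and "y1 = y2(0 := q1, 4 := p1)"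
  have "tree_sum V3 (lens_ends L3) I3 ?o ?o = tree_sum V2 (lens_ends L2) I2 x3 y3"
    unfolding x3_def y3_def using refines_all_ones[OF S3(2), of ?o ?o] \<sigma>2(1) by simp
  also have "\<dots> = tree_sum V1 (lens_ends L1) I1 x2 y2"
    unfolding x2_def y2_def \<sigma>1(1)[symmetric]
    by (rule refines_all_ones[OF S2(2)]) (use i1 \<sigma>1 in \<open>auto simp: x3_def y3_def\<close>)
  also have "\<dots> = tree_sum K4.V (lens_ends K4.L) {..<6} x1 y1"
  proof -
    have "tree_sum V1 (lens_ends L1) I1 x2 y2 = tree_sum K4.V (lens_ends K4.L) {..<6}
        (x2(0 := p1, \<sigma> 0 := q1)) (y2(0 := q1, \<sigma> 0 := p1))"
      by (rule refines_all_ones[OF S1(2)]) (use \<sigma> in \<open>auto simp: x2_def y2_def x3_def y3_def\<close>)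
    then show ?thesis unfolding \<sigma>(1) x1_def y1_def .
  qed
  also have "\<dots> = tree_sum K4.V (lens_ends K4.L) {..<6} (\<lambda>i. [p1, p2, p3, q3, q1, q2] ! i) (\<lambda>i. [q1, q2, q3, p3, p1, p2] ! i)"
    by (rule tree_sum_cong) (auto simp: less_6 x1_def y1_def x2_def y2_def x3_def y3_def)
  finally show ?thesis using realizedI[OF S3(1) ne] K4_count pos by simp
qed

lemma realized_digon:
  assumes c: "coprime p (q :: nat)" and pos: "0 < p" "0 < q"
  shows "realized (p\<^sup>2 + q\<^sup>2)"
proof -
  have "lens_drawing {0, 1} {0 :: nat} (\<lambda>_ z. z)"
    by (auto simp: lens_drawing_def lens_ends_def inj_on_def)
  then have D: "lens_drawing {0, 1} (insert 1 {0 :: nat})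
      ((\<lambda>_ z. z)(0 := (\<lambda>z. z) \<circ> lens_middle, 1 := (\<lambda>z. z) \<circ> lens_upper))"
    by (rule lens_double) auto
  define L :: "nat \<Rightarrow> complex \<Rightarrow> complex" where "L = (\<lambda>_ z. z)(0 := lens_middle, 1 := lens_upper)"
  have L: "lens_drawing {0, 1} {0, 1} L" unfolding L_def using D by (simp add: insert_commute o_def)
  have Le: "lens_ends L i = {0, 1}" if "i \<in> {0, 1}" for i using that by (auto simp: L_def lens_ends_def lens_middle_def lens_upper_def complex_eq_iff)
  define E where "E = lens_edges {0, 1} L"
  interpret plane_graph "{0, 1}" E unfolding E_def by (rule lens_plane_graph[OF L])
  have inj: "inj_on (\<lambda>i. seg (L i)) {0, 1}" by (rule lens_inj[OF L])
  have sp: "spans {0, 1} (lens_ends L) {i}" if i: "i \<in> {0, 1}" for i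
    using Le[OF i] reach_edge[of i "{i}" "lens_ends L" 0 1] reach_edge[of i "{i}" "lens_ends L" 1 0]
    by (auto simp: spans_def insert_commute)
  have B: "block {0, 1} (lens_ends L) {0, 1}"
  proof -
    have "{0, 1} - {0} = {1::nat}" "{0, 1} - {1} = {0::nat}" "{0, 1} - {0} = {1::complex}" "{0, 1} - {1} = {0::complex}" by auto
    then show ?thesis unfolding block_def
      using sp[of 0] sp[of 1] spans_mono[OF sp[of 0], of "{0, 1}"] by (auto simp: spans_def)
  qed
  have E2: "E = {seg (L 0), seg (L 1)}" "seg (L 0) \<noteq> seg (L 1)"
    using inj_onD[OF inj, of 0 1] by (auto simp: E_def)
  have dE: "seg (L i) \<inter> {0, 1} = {0, 1}" if "i \<in> {0, 1}" for i
    using lens_drawingD(5)[OF L that] Le[OF that] by simp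
  have rE: "reach (drawn_ends {0, 1}) {seg (L i)} 0 1" if "i \<in> {0, 1}" for i
    by (rule reach_edge[of "seg (L i)"]) (use dE[OF that] in auto)
  have "spans {0, 1} (drawn_ends {0, 1}) E"
  proof (rule spansI_root[of _ _ _ 0])
    have "reach (drawn_ends {0, 1}) E 0 1" by (rule reach_mono[OF rE[of 0]]) (auto simp: E2)
    then show "reach (drawn_ends {0, 1}) E 0 v" if "v \<in> {0, 1}" for v using that by auto
  qed
  then have F: "finite (faces {0, 1} E)" "card (faces {0, 1} E) = 2"
    using euler E2 by auto
  have S: "sides {0, 1} E (seg (L i)) = faces {0, 1} E" if i: "i \<in> {0, 1}" for i
  proof -
    have "E - {seg (L 0)} = {seg (L 1)}" "E - {seg (L 1)} = {seg (L 0)}" unfolding E2(1) using E2(2) by blast+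
    moreover from i have "i = 0 \<or> i = 1" by simp
    ultimately have rest: "E - {seg (L i)} = {seg (L (1 - i))}" by (elim disjE) simp_all
    have "1 - i \<in> {0, 1}" using i by auto
    then have "reach (drawn_ends {0, 1}) (E - {seg (L i)}) 0 1" unfolding rest by (rule rE)
    moreover have "seg (L i) \<in> E" using i E2 by auto
    ultimately obtain U1 U2 where "U1 \<noteq> U2" "sides {0, 1} E (seg (L i)) = {U1, U2}"
      using sides_nonbridge[of "seg (L i)" 0 1] dE[OF i] by metis
    then have "card (sides {0, 1} E (seg (L i))) = 2" by simp
    moreover have "sides {0, 1} E (seg (L i)) \<subseteq> faces {0, 1} E" by (auto simp: sides_def)
    ultimately show ?thesis using F card_subset_eq by metis
  qed
  obtain \<phi> where \<phi>: "bij_betw \<phi> {0, 1 :: complex} (faces {0, 1} E)"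
    using finite_same_card_bij[of "{0, 1 :: complex}" "faces {0, 1} E"] F by auto
  have P: "polar {0, 1} {0, 1} L (\<lambda>i. 1 - i) \<phi>"
    unfolding polar_def E_def[symmetric] using L B \<phi> S Le by (auto simp: bij_betw_def)
  obtain V1 I1 L1 \<sigma>1 \<phi>1 where S1: "polar V1 I1 L1 \<sigma>1 \<phi>1" "refines {0, 1} {0, 1} L (\<lambda>i. 1 - i) 0 p q V1 I1 L1 \<sigma>1"
    using network[OF P, of 0 p q] c pos by auto
  have "I1 \<noteq> {}" using S1(2) by (auto simp: refines_def)
  moreover have "tree_sum V1 (lens_ends L1) I1 (\<lambda>_. 1) (\<lambda>_. 1) = p\<^sup>2 + q\<^sup>2"
  proof -
    let ?x = "(\<lambda>_. 1)(0 := p, 1 := q) :: nat \<Rightarrow> nat" and ?y = "(\<lambda>_. 1)(0 := q, 1 := p) :: nat \<Rightarrow> nat"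
    have "tree_sum V1 (lens_ends L1) I1 (\<lambda>_. 1) (\<lambda>_. 1) = tree_sum {0, 1} (lens_ends L) {0, 1} ?x ?y"
      using refines_all_ones[OF S1(2), of "\<lambda>_. 1" "\<lambda>_. 1"] by simp
    also have "\<dots> = tree_sum {0, 1} (lens_ends L) (set [0, 1]) ?x ?y" by simp
    also have "\<dots> = delcon (card {0, 1 :: complex}) (map (\<lambda>i. (0 :: complex, 1, ?x i, ?y i)) [0, 1])"
      by (rule delcon_tree_sum) (use Le in auto)
    also have "\<dots> = p\<^sup>2 + q\<^sup>2" using pos by (simp add: power2_eq_square)
    finally show ?thesis .
  qed
  ultimately show ?thesis using realizedI[OF S1(1)] by blast
qed

text \<open>With all but one or two of the weights of the complete graph equal to 1 or 2, its root \<open>p1 p2 p3 + p1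
  q2 q3 + p2 q1 q3 + p3 q1 q2\<close> is \<open>3 * (j + 1)\<close>, \<open>5 + 4 * q\<close> or \<open>15 + 4
  * q\<close>, where \<open>q\<close> has to be prime to 3 in the last case.\<close>

lemma odd_square_realized:
  fixes m :: nat
  assumes m: "odd m" "m \<noteq> 1" "m \<noteq> 3" "m \<noteq> 7"
  shows "realized (m\<^sup>2)"
proof -
  have ge: "5 \<le> m" using m by presburger
  have "m = 5 \<or> m = 11 \<or> 3 dvd m \<and> 9 \<le> m \<or> m mod 4 = 1 \<and> 9 \<le> m \<or> m mod 4 = 3 \<and> 19 \<le> m \<and> \<not> 3 dvd m"
  proof (cases "m < 19")
    case True
    then have "m = 5 \<or> m = 9 \<or> m = 11 \<or> m = 13 \<or> m = 15 \<or> m = 17" using m ge by presburger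
    then show ?thesis by (elim disjE) simp_all
  next
    case False
    moreover have "m mod 4 = 1 \<or> m mod 4 = 3" using m(1) by presburger
    ultimately show ?thesis by auto
  qed
  then consider "m = 5" | "m = 11" | "3 dvd m" "9 \<le> m" | "m mod 4 = 1" "9 \<le> m" | "m mod 4 = 3" "19 \<le> m" "\<not> 3 dvd m"
    by blast
  then show ?thesis
  proof cases
    case 1
    have "coprime (3 :: nat) 4" by (simp add: coprime_iff_gcd_eq_1 gcd_non_0_nat)
    then show ?thesis using realized_digon[of 3 4] 1 by simp
  next
    case 2
    then show ?thesis using realized_121 by simp
  next
    case 3
    then obtain k where k: "m = 3 * k" by blast
    define j where "j = k - 1"
    have "realized ((1 * 2 * j + 1 * 1 * 1 + 2 * 1 * 1 + j * 1 * 1)\<^sup>2)"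
      by (rule realized_K4) (use 3 k in \<open>auto simp: j_def\<close>)
    moreover have "1 * 2 * j + 1 * 1 * 1 + 2 * 1 * 1 + j * 1 * 1 = m" using 3 k by (simp add: j_def)
    ultimately show ?thesis by (simp only:)
  next
    case 4
    define q where "q = m div 4 - 1"
    have "m = 4 * (m div 4) + 1" using mult_div_mod_eq[of 4 m] 4(1) by simp
    then have q: "m = 5 + 4 * q" "0 < q" unfolding q_def using 4(2) by linarith+
    have "realized ((2 * 2 * 1 + 2 * 1 * q + 2 * 1 * q + 1 * 1 * 1)\<^sup>2)"
      by (rule realized_K4) (use q in simp_all)
    moreover have "2 * 2 * 1 + 2 * 1 * q + 2 * 1 * q + 1 * 1 * 1 = m" using q(1) by linarith
    ultimately show ?thesis by (simp only:)
  next
    case 5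
    define q where "q = m div 4 - 3"
    have "m = 4 * (m div 4) + 3" using mult_div_mod_eq[of 4 m] 5(1) by simp
    then have q: "m = 15 + 4 * q" "0 < q" unfolding q_def using 5(2) by linarith+
    have "\<not> 3 dvd q" using q 5 by presburger
    then have "coprime 3 q" by (simp add: prime_imp_coprime_nat)
    then have "realized ((2 * 2 * 3 + 2 * 1 * q + 2 * 1 * q + 3 * 1 * 1)\<^sup>2)"
      by (intro realized_K4) (use q in simp_all)
    moreover have "2 * 2 * 3 + 2 * 1 * q + 2 * 1 * q + 3 * 1 * 1 = m" using q(1) by linarith
    ultimately show ?thesis by (simp only:)
  qed
qed

section \<open>The exceptions\<close>

lemma sum_squares_7:
  assumes "7 dvd x\<^sup>2 + y\<^sup>2"
  shows "7 dvd (x :: int)"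
proof -
  have key: "a = 0" if ab: "0 \<le> a" "a < 7" "0 \<le> b" "b < 7" and z: "(a\<^sup>2 + b\<^sup>2) mod 7 = 0" for a b :: int
  proof -
    have "a = 0 \<or> a = 1 \<or> a = 2 \<or> a = 3 \<or> a = 4 \<or> a = 5 \<or> a = 6" "b = 0 \<or> b = 1 \<or> b = 2 \<or> b = 3 \<or> b = 4 \<or> b = 5 \<or> b = 6"
      using ab by presburger+
    then show ?thesis using z by (elim disjE) simp_all
  qed
  have "((x mod 7)\<^sup>2 + (y mod 7)\<^sup>2) mod 7 = 0"
    by (rule trans[OF mod_add_cong[OF power_mod power_mod] dvd_imp_mod_0[OF assms]])
  from key[OF _ _ _ _ this] have "x mod 7 = 0" by simp
  then show ?thesis by presburger
qed

lemma sum_squares_3: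
  assumes "3 dvd x\<^sup>2 + y\<^sup>2"
  shows "3 dvd (x :: int)"
proof -
  have key: "a = 0" if ab: "0 \<le> a" "a < 3" "0 \<le> b" "b < 3" and z: "(a\<^sup>2 + b\<^sup>2) mod 3 = 0" for a b :: int
  proof -
    have "a = 0 \<or> a = 1 \<or> a = 2" "b = 0 \<or> b = 1 \<or> b = 2"
      using ab by presburger+
    then show ?thesis using z by (elim disjE) simp_all
  qed
  have "((x mod 3)\<^sup>2 + (y mod 3)\<^sup>2) mod 3 = 0"
    by (rule trans[OF mod_add_cong[OF power_mod power_mod] dvd_imp_mod_0[OF assms]])
  from key[OF _ _ _ _ this] have "x mod 3 = 0" by simp
  then show ?thesis by presburger
qed

text \<open>By duality of trees, an isomorphism with the dual graph turns a spanning tree into the complement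
  of one.\<close>

lemma self_dual_structure:
  assumes d: "plane_drawing V E" and sd: "self_dual V E"
    and nc: "\<not> (\<exists>v. cut_vertex (drawn_graph V E) v)" and n: "0 < card (spanning_trees (drawn_graph V E))"
  obtains src tgt \<sigma> where "oriented_graph V (drawn_ends V) E src tgt"
    "\<And>v. v \<in> V \<Longrightarrow> spans (V - {v}) (drawn_ends V) {e \<in> E. v \<notin> drawn_ends V e}"
    "card E + 2 = 2 * card V" "\<And>e. e \<in> E \<Longrightarrow> \<sigma> e \<in> E"
    "\<And>e. e \<in> E \<Longrightarrow> oriented_graph.tc V (drawn_ends V) E {\<sigma> e} =
       oriented_graph.\<tau> V (drawn_ends V) E - oriented_graph.tc V (drawn_ends V) E {e}"
    "oriented_graph.\<tau> V (drawn_ends V) E = int (card (spanning_trees (drawn_graph V E)))"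
proof -
  interpret plane_graph V E by unfold_locales (rule d)
  let ?d = "drawn_ends V"
  have ne: "trees V ?d E \<noteq> {}" using n unfolding spanning_trees_drawn by (auto simp: card_gt_0_iff)
  then obtain T0 where T0: "T0 \<in> trees V ?d E" by blast
  have sp: "spans V ?d E" using T0 spans_mono by (auto simp: trees_def)
  have "\<forall>e\<in>E. \<exists>u v. u \<noteq> v \<and> e \<inter> V = {u, v}" using ends_ex2 by blast
  then obtain src tgt where ori: "\<And>e. e \<in> E \<Longrightarrow> src e \<noteq> tgt e \<and> e \<inter> V = {src e, tgt e}" by metis
  interpret O: oriented_graph V ?d E src tgt by unfold_locales (use sp ori in auto)
  obtain f g where fg: "bij_betw f V (faces V E)" "bij_betw g E E"
    "\<And>e. e \<in> E \<Longrightarrow> sides V E (g e) = f ` (e \<inter> V)"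
    using sd unfolding self_dual_def isomorphic_def by (auto simp: drawn_graph_def dual_graph_def sides_def)
  have gE: "g e \<in> E" if "e \<in> E" for e using fg(2) that by (auto simp: bij_betw_def)
  have injf: "inj_on f V" and imf: "f ` V = faces V E" and injg: "inj_on g E" and img: "g ` E = E"
    using fg by (auto simp: bij_betw_def)
  have cF: "card (faces V E) = card V" using bij_betw_same_card[OF fg(1)] by simp
  define \<Phi> where "\<Phi> T = {e \<in> E. g e \<notin> T}" for T
  have g\<Phi>: "g ` \<Phi> T = E - T" for T
  proof -
    have "g ` \<Phi> T = g ` E - T" by (auto simp: \<Phi>_def)
    then show ?thesis by (simp add: img)
  qed
  have \<Phi>: "\<Phi> T \<in> trees V ?d E" if T: "T \<in> trees V ?d E" for T
  proof -
    note im = g\<Phi>[of T]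
    have D: "E - T \<in> trees (faces V E) (sides V E) E" by (rule dual_tree[OF T])
    have "spans (faces V E) (\<lambda>e. sides V E (g e)) (\<Phi> T)"
      using D im spans_edge_image[of "faces V E" "sides V E" g "\<Phi> T"] by (simp add: trees_def)
    moreover have "reach (\<lambda>e. sides V E (g e)) (\<Phi> T) x y \<longleftrightarrow> reach (\<lambda>e. f ` ?d e) (\<Phi> T) x y" for x y
      by (rule reach_cong) (use fg(3) in \<open>auto simp: \<Phi>_def\<close>)
    ultimately have im_spans: "spans (f ` V) (\<lambda>e. f ` ?d e) (\<Phi> T)" by (simp add: spans_def imf)
    have ends: "\<exists>s\<in>V. \<exists>t\<in>V. ?d i = {s, t}" if "i \<in> \<Phi> T" for i using ends_ex[of i] that by (auto simp: \<Phi>_def)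
    have "spans V ?d (\<Phi> T)" using im_spans spans_vertex_image[where T = "\<Phi> T" and d = ?d, OF injf ends] by blast
    moreover have "card (\<Phi> T) = card (E - T)"
      using card_image[OF inj_on_subset[OF injg], of "\<Phi> T"] im by (auto simp: \<Phi>_def)
    moreover have "card (E - T) + 1 = card V" using D cF by (simp add: trees_def)
    ultimately show ?thesis by (auto simp: trees_def \<Phi>_def)
  qed
  have inj\<Phi>: "inj_on \<Phi> (trees V ?d E)"
  proof (rule inj_onI)
    fix T T' assume T: "T \<in> trees V ?d E" "T' \<in> trees V ?d E" "\<Phi> T = \<Phi> T'"
    have "E - T = E - T'"
      using g\<Phi>[of T] g\<Phi>[of T'] T(3) by simp
    then show "T = T'" using T(1,2) by (auto simp: trees_def)
  qed
  have im\<Phi>: "\<Phi> ` trees V ?d E = trees V ?d E"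
    by (rule endo_inj_surj[OF trees_finite _ inj\<Phi>]) (use \<Phi> in blast)
  have tcg: "O.tc {g e} = O.\<tau> - O.tc {e}" if e: "e \<in> E" for e
  proof -
    let ?T = "trees V ?d E"
    have "{T \<in> ?T. e \<in> T} = \<Phi> ` {T \<in> ?T. g e \<notin> T}"
    proof (intro equalityI subsetI)
      fix T assume T: "T \<in> {T \<in> ?T. e \<in> T}"
      then obtain T' where "T' \<in> ?T" "T = \<Phi> T'" using im\<Phi> by blast
      then show "T \<in> \<Phi> ` {T \<in> ?T. g e \<notin> T}" using T by (auto simp: \<Phi>_def)
    next
      fix T assume "T \<in> \<Phi> ` {T \<in> ?T. g e \<notin> T}"
      then show "T \<in> {T \<in> ?T. e \<in> T}" using \<Phi> e by (auto simp: \<Phi>_def)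
    qed
    then have "card {T \<in> ?T. e \<in> T} = card {T \<in> ?T. g e \<notin> T}"
      using card_image[OF inj_on_subset[OF inj\<Phi>], of "{T \<in> ?T. g e \<notin> T}"] by auto
    moreover have "card ?T = card {T \<in> ?T. g e \<in> T} + card {T \<in> ?T. g e \<notin> T}"
    proof -
      have "{T \<in> ?T. g e \<in> T} \<union> {T \<in> ?T. g e \<notin> T} = ?T" by blast
      then show ?thesis
        using card_Un_disjoint[of "{T \<in> ?T. g e \<in> T}" "{T \<in> ?T. g e \<notin> T}"] trees_finite
        by (simp add: disjoint_iff)
    qed
    ultimately show ?thesis by (simp add: O.tc_def O.\<tau>_def O.TT_def)
  qed
  show thesis
  proof (rule that[of src tgt g])
    show "oriented_graph V ?d E src tgt" by unfold_locales
    show "spans (V - {v}) ?d {e \<in> E. v \<notin> ?d e}" if v: "v \<in> V" for v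
      unfolding spans_def
    proof (intro ballI)
      fix u w assume uw: "u \<in> V - {v}" "w \<in> V - {v}"
      have "\<not> cut_vertex (drawn_graph V E) v" using nc by blast
      moreover have "reach ?d E u w" using sp uw by (auto simp: spans_def)
      ultimately have "reachable (delete_vertex (drawn_graph V E) v) u w"
        using uw v by (auto simp: cut_vertex_def reachable_reach drawn_graph_def)
      then show "reach ?d {e \<in> E. v \<notin> ?d e} u w"
        by (simp add: reachable_reach delete_vertex_def drawn_graph_def)
    qed
    show "card E + 2 = 2 * card V" using euler(2)[OF sp] cF by simp
    show "O.\<tau> = int (card (spanning_trees (drawn_graph V E)))"
      unfolding spanning_trees_drawn by (simp add: O.\<tau>_def O.TT_def)
  qed (use gE tcg in auto)
qed

lemma not_realized:
  assumes "realized n" "n = 1 \<or> n = 9 \<or> n = 49"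
  shows False
proof -
  obtain V E where VE: "plane_drawing V E" "E \<noteq> {}" "self_dual V E" "\<not> (\<exists>v. cut_vertex (drawn_graph V E) v)"
    "card (spanning_trees (drawn_graph V E)) = n" using assms(1) by (auto simp: realized_def)
  have n0: "0 < card (spanning_trees (drawn_graph V E))" using VE(5) assms(2) by auto
  obtain src tgt \<sigma> where S: "oriented_graph V (drawn_ends V) E src tgt"
    "\<And>v. v \<in> V \<Longrightarrow> spans (V - {v}) (drawn_ends V) {e \<in> E. v \<notin> drawn_ends V e}"
    "card E + 2 = 2 * card V" "\<And>e. e \<in> E \<Longrightarrow> \<sigma> e \<in> E"
    "\<And>e. e \<in> E \<Longrightarrow> oriented_graph.tc V (drawn_ends V) E {\<sigma> e} =
       oriented_graph.\<tau> V (drawn_ends V) E - oriented_graph.tc V (drawn_ends V) E {e}"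
    "oriented_graph.\<tau> V (drawn_ends V) E = int (card (spanning_trees (drawn_graph V E)))"
    by (rule self_dual_structure[OF VE(1,3,4) n0]) (rule that)
  interpret O: oriented_graph V "drawn_ends V" E src tgt by (rule S(1))
  obtain e where e: "e \<in> E" using VE(2) by blast
  have \<tau>: "O.\<tau> = int n" using S(6) VE(5) by simp
  from assms(2) show False
  proof (elim disjE)
    assume "n = 1"
    then show False using O.tc_pos[OF e] O.tc_pos[OF S(4)[OF e]] S(5)[OF e] \<tau> by simp
  next
    assume n9: "n = 9"
    interpret square_graph V "drawn_ends V" E src tgt 3 \<sigma>
    proof unfold_locales
      show "spans (V - {v}) (drawn_ends V) {e \<in> E. v \<notin> drawn_ends V e}" if "v \<in> V" for v by (rule S(2)[OF that])
      show "card E + 2 = 2 * card V" by (rule S(3))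
      show "O.\<tau> = 3\<^sup>2" using \<tau> n9 by simp
      show "(3 :: int) > 1" "odd (3 :: int)" by simp_all
      show "3 dvd x" if "3 dvd x\<^sup>2 + y\<^sup>2" for x y :: int by (rule sum_squares_3[OF that])
      show "\<sigma> e \<in> E" if "e \<in> E" for e by (rule S(4)[OF that])
      show "O.tc {\<sigma> e} = O.\<tau> - O.tc {e}" if "e \<in> E" for e by (rule S(5)[OF that])
    qed
    show False
      using t_not_1[OF e] t_not_1[OF S(4)[OF e]] t_pos[OF e] t_pos[OF S(4)[OF e]] t_\<sigma>[OF e] by linarith
  next
    assume n49: "n = 49"
    interpret graph49 V "drawn_ends V" E src tgt 7 \<sigma>
    proof unfold_locales
      show "spans (V - {v}) (drawn_ends V) {e \<in> E. v \<notin> drawn_ends V e}" if "v \<in> V" for v by (rule S(2)[OF that])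
      show "card E + 2 = 2 * card V" by (rule S(3))
      show "O.\<tau> = 7\<^sup>2" using \<tau> n49 by simp
      show "(7 :: int) > 1" "odd (7 :: int)" by simp_all
      show "7 dvd x" if "7 dvd x\<^sup>2 + y\<^sup>2" for x y :: int by (rule sum_squares_7[OF that])
      show "\<sigma> e \<in> E" if "e \<in> E" for e by (rule S(4)[OF that])
      show "O.tc {\<sigma> e} = O.\<tau> - O.tc {e}" if "e \<in> E" for e by (rule S(5)[OF that])
    qed simp
    show False using no_edges e by blast
  qed
qed

theorem theorem6p2:
  fixes n :: nat
  assumes "odd n" and "is_square n"
  shows "(\<exists>V E. plane_drawing V E \<and> E \<noteq> {} \<and> self_dual V E \<and>
            \<not> (\<exists>v. cut_vertex (drawn_graph V E) v) \<and>
            card (spanning_trees (drawn_graph V E)) = n)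
         \<longleftrightarrow> n \<noteq> 1 \<and> n \<noteq> 9 \<and> n \<noteq> 49"
proof -
  obtain m where m: "n = m\<^sup>2" using assms(2) by (auto elim: is_nth_powerE)
  have "realized n \<longleftrightarrow> n \<noteq> 1 \<and> n \<noteq> 9 \<and> n \<noteq> 49"
  proof
    show "realized n \<Longrightarrow> n \<noteq> 1 \<and> n \<noteq> 9 \<and> n \<noteq> 49" using not_realized by blast
    assume "n \<noteq> 1 \<and> n \<noteq> 9 \<and> n \<noteq> 49"
    then have "m \<noteq> 1" "m \<noteq> 3" "m \<noteq> 7" using m by auto
    moreover have "odd m" using assms(1) m by simp
    ultimately show "realized n" using odd_square_realized m by blast
  qed
  then show ?thesis unfolding realized_def .
qed

end
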